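(* Let $\{U_{jk},1\le j<k\le d\}$ be rank-type $U$-statistics of degree $m$, $$U_{jk}=\frac{1}{n(n-1)\cdots(n-m+1)}\sum_{i_1\neq i_2\neq\cdots\neq i_m}h(X_{i_1,\{j,k\}},\ldots,X_{i_m,\{j,k\}}),$$ and suppose that the kernel function $h$ is bounded and non-degenerate. Let $\widetilde L_n=\max_{j<k}|U_{jk}-E_{H_0}(U_{jk})|$ and $\sigma_U^2=n\,\mathrm{var}_{H_0}(U_{jk})$. Then, under $H_0$, if $\log d=o(n^{1/3})$ as $n$ grows, for any $y\in\mathbb{R}$, $$\Big|\mathrm{pr}\big(n\widetilde L_n^2/\sigma_U^2 - 4\log d + \log\log d \leq y\big) - \exp\{-(8\pi)^{-1/2}\exp(-y/2)\}\Big| = o_y(1).$$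
   Context: Setting: $X=(X_1,\ldots,X_d)^{\mathrm T}$ is a continuous random vector in $\mathbb{R}^d$ (so ties occur with probability zero), and $X_{1,\cdot},\ldots,X_{n,\cdot}$, $X_{i,\cdot}=(X_{i,1},\ldots,X_{i,d})^{\mathrm T}$, are $n$ independent copies of $X$. The dimension $d=d_n$ is allowed to depend on $n$; both $n$ and $d$ tend to infinity. The null hypothesis is $H_0$: $X_1,\ldots,X_d$ are mutually independent. Relative ranks: $Q_{ni}^j$ is the rank of $X_{i,j}$ in $\{X_{1,j},\ldots,X_{n,j}\}$, and for $j\ne k$, $R_{ni}^{jk}=Q_{ni'}^k$ where $i'$ is the index with $Q_{ni'}^j=i$. Rank-type $U$-statistics: $X_{i,\{j,k\}}$ is the sub-vector $(X_{i,j},X_{i,k})$; the sum is over pairwise distinct indices in $\{1,\ldots,n\}$; $m<n$ is fixed; the kernel $h$ is a fixed function, not necessarily symmetric; and $U_{jk}$ is assumed to depend on the data only through $\{R_{ni}^{jk}\}_{i=1}^n$. Hence under $H_0$ the distribution of $U_{jk}$ depends neither on the distribution of $X$ nor on $(j,k)$; $E_{H_0},\mathrm{var}_{H_0}$ are expectation and variance under $H_0$. "Non-degenerate" means that the $U$-statistic is non-degenerate in the usual sense under $H_0$: the conditional expectation given its first argument of the (symmetrized) kernel has strictly positive variance. $o_y(1)$ denotes a quantity that tends to $0$ as $n\to\infty$ for each fixed $y$. *)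

theory Defs
  imports "HOL-Probability.Probability" "HOL-Library.Landau_Symbols"
begin

text \<open>
  All indices start at 0: observations are \<open>i < n\<close>, coordinates \<open>j < d\<close>, kernel arguments \<open>l < m\<close>.
  A point of a finite power is an extensional function, as in \<^const>\<open>PiM\<close>.
\<close>

definition coord_vec :: "nat \<Rightarrow> (nat \<Rightarrow> 'a \<Rightarrow> real) \<Rightarrow> 'a \<Rightarrow> nat \<Rightarrow> real" where
  "coord_vec d X \<omega> = (\<lambda>j\<in>{..<d}. X j \<omega>)"

text \<open>\<open>Z i j\<close> is coordinate \<open>j\<close> of observation \<open>i\<close>.\<close>

definition indep_copies ::
  "'a measure \<Rightarrow> nat \<Rightarrow> nat \<Rightarrow> (nat \<Rightarrow> 'a \<Rightarrow> real) \<Rightarrow> (nat \<Rightarrow> nat \<Rightarrow> 'a \<Rightarrow> real) \<Rightarrow> bool" where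
  "indep_copies M n d X Z \<longleftrightarrow>
     prob_space.indep_vars M (\<lambda>_. PiM {..<d} (\<lambda>_. borel)) (\<lambda>i. coord_vec d (Z i)) {..<n} \<and>
     (\<forall>i<n. distr M (PiM {..<d} (\<lambda>_. borel)) (coord_vec d (Z i))
          = distr M (PiM {..<d} (\<lambda>_. borel)) (coord_vec d X))"

definition null_hyp :: "'a measure \<Rightarrow> nat \<Rightarrow> (nat \<Rightarrow> 'a \<Rightarrow> real) \<Rightarrow> bool" where
  "null_hyp M d X \<longleftrightarrow> prob_space.indep_vars M (\<lambda>_. borel) X {..<d}"

text \<open>
  Continuity of the marginal distribution functions: this is what excludes ties, and it does not
  require a density.
\<close>

definition continuous_vec :: "'a measure \<Rightarrow> nat \<Rightarrow> (nat \<Rightarrow> 'a \<Rightarrow> real) \<Rightarrow> bool" where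
  "continuous_vec M d X \<longleftrightarrow>
     (\<forall>j<d. X j \<in> borel_measurable M \<and> (\<forall>a. measure M {\<omega> \<in> space M. X j \<omega> = a} = 0))"

type_synonym kernel = "(nat \<Rightarrow> real \<times> real) \<Rightarrow> real"

definition ustat :: "nat \<Rightarrow> kernel \<Rightarrow> nat \<Rightarrow> (nat \<Rightarrow> real \<times> real) \<Rightarrow> real" where
  "ustat m h n z =
     (\<Sum>i | i \<in> {..<m} \<rightarrow>\<^sub>E {..<n} \<and> inj_on i {..<m}. h (\<lambda>l\<in>{..<m}. z (i l)))
       / (\<Prod>l<m. real n - real l)"

definition rank_among :: "nat \<Rightarrow> (nat \<Rightarrow> real) \<Rightarrow> nat \<Rightarrow> nat" where
  "rank_among n x i = card {l. l < n \<and> x l \<le> x i}"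

definition rel_rank :: "nat \<Rightarrow> (nat \<Rightarrow> real) \<Rightarrow> (nat \<Rightarrow> real) \<Rightarrow> nat \<Rightarrow> nat" where
  "rel_rank n x y r = rank_among n y (THE i. i < n \<and> rank_among n x i = r)"

definition no_ties :: "nat \<Rightarrow> (nat \<Rightarrow> real \<times> real) \<Rightarrow> bool" where
  "no_ties n z \<longleftrightarrow> inj_on (fst \<circ> z) {..<n} \<and> inj_on (snd \<circ> z) {..<n}"

text \<open>
  The statistic depends on the data only through the relative ranks. Samples with ties, for which
  relative ranks are not defined, are left unconstrained.
\<close>

definition rank_type :: "nat \<Rightarrow> kernel \<Rightarrow> bool" where
  "rank_type m h \<longleftrightarrow>
     (\<forall>n>m. \<forall>z z'. no_ties n z \<longrightarrow> no_ties n z' \<longrightarrow>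
        (\<forall>r\<in>{1..n}. rel_rank n (fst \<circ> z) (snd \<circ> z) r = rel_rank n (fst \<circ> z') (snd \<circ> z') r) \<longrightarrow>
        ustat m h n z = ustat m h n z')"

definition symmetrized :: "nat \<Rightarrow> kernel \<Rightarrow> kernel" where
  "symmetrized m h z = (\<Sum>\<pi> | \<pi> permutes {..<m}. h (\<lambda>l\<in>{..<m}. z (\<pi> l))) / fact m"

text \<open>
  Here \<open>P\<close> is the law of one argument, so that the arguments are independent with law \<open>P\<close> under the
  product measure; the sub-sigma-algebra is the one generated by the first argument.
\<close>

definition nondegenerate :: "nat \<Rightarrow> kernel \<Rightarrow> (real \<times> real) measure \<Rightarrow> bool" where
  "nondegenerate m h P \<longleftrightarrow>
     (let Q = PiM {..<m} (\<lambda>_. P)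
      in prob_space.variance Q
           (real_cond_exp Q (vimage_algebra (space Q) (\<lambda>z. z 0) borel) (symmetrized m h)) > 0)"

definition pair_ustat ::
  "nat \<Rightarrow> kernel \<Rightarrow> nat \<Rightarrow> (nat \<Rightarrow> nat \<Rightarrow> 'a \<Rightarrow> real) \<Rightarrow> nat \<Rightarrow> nat \<Rightarrow> 'a \<Rightarrow> real" where
  "pair_ustat m h n Z j k \<omega> = ustat m h n (\<lambda>i. (Z i j \<omega>, Z i k \<omega>))"

text \<open>
  The mean and variance are taken under \<open>M\<close>. They are the null mean and variance when the data under
  \<open>M\<close> satisfy the null hypothesis. For a rank-type statistic they are then the same for every
  pair of coordinates, so the variance is read off from the pair \<open>(0, 1)\<close>.
\<close>

definition max_stat ::
  "'a measure \<Rightarrow> nat \<Rightarrow> kernel \<Rightarrow> nat \<Rightarrow> nat \<Rightarrow> (nat \<Rightarrow> nat \<Rightarrow> 'a \<Rightarrow> real) \<Rightarrow> 'a \<Rightarrow> real" where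
  "max_stat M m h n d Z \<omega> =
     Max {\<bar>pair_ustat m h n Z j k \<omega> - prob_space.expectation M (pair_ustat m h n Z j k)\<bar> |
          j k. j < k \<and> k < d}"

definition sigma_U_sq ::
  "'a measure \<Rightarrow> nat \<Rightarrow> kernel \<Rightarrow> nat \<Rightarrow> (nat \<Rightarrow> nat \<Rightarrow> 'a \<Rightarrow> real) \<Rightarrow> real" where
  "sigma_U_sq M m h n Z = real n * prob_space.variance M (pair_ustat m h n Z 0 1)"

end

theory Submission
  imports Defs "HOL-Real_Asymp.Real_Asymp"
begin

text \<open>
  The scaled maximum stays below the threshold iff none of the \<open>d (d - 1) / 2\<close> events
  ``the statistic of the pair \<open>(j, k)\<close> exceeds the critical value'' occurs. Three facts turn the
  probability of this into \<open>exp (- \<lambda>)\<close> with \<open>\<lambda> = (8 \<pi>)\<^sup>-\<^sup>1\<^sup>/\<^sup>2 exp (- y / 2)\<close>.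

  The dependence between the events is the first of them. A statistic that depends only on relative ranks has a law that does not change
  when one of its two columns is fixed (without ties) and the other one is an i.i.d. sample from an
  atomless law: both reduce to a uniformly random permutation (\<open>rank_ustat_given_first\<close>,
  \<open>rank_ustat_given_second\<close>). Hence all exceedance events have the same probability \<open>p\<close>, two events
  that share one column are independent (\<open>exceed_shared\<close>), and an event is jointly independent of all
  those that share no column with it (\<open>exceed_far\<close>). For such a family the probability that no event
  occurs differs from \<open>exp (- p d (d - 1) / 2)\<close> by \<open>O(p\<^sup>2 d\<^sup>3)\<close> (\<open>dissociated_poisson\<close>,
  \<open>no_exceedance_poisson\<close>): the probability generating function of the number of events almost solves
  \<open>\<psi>' = c \<psi>\<close> on \<open>[0, 1]\<close> with \<open>c = p d (d - 1) / 2\<close>, and its value at \<open>0\<close> is wanted.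

  The second one is the size of \<open>p\<close>. The threshold corresponds to a standardised level \<open>t\<close> with \<open>t\<^sup>2\<close> close to
  \<open>4 ln d\<close>, so that \<open>p\<close> is needed with relative error \<open>o(1)\<close> at \<open>t = o(n\<^sup>1\<^sup>/\<^sup>6)\<close>. For sums of bounded
  i.i.d. variables this is done by Lindeberg replacement (\<open>iid_moderate_deviation\<close>). The indicator of
  \<open>{x. x > t}\<close> is smoothed into a logistic function of width \<open>1 / t\<close>, whose third derivative is at
  most \<open>t\<^sup>3\<close> times the function itself, up to constants. One replacement therefore changes the mean
  only by a \<^emph>\<open>factor\<close> \<open>1 + O(t\<^sup>3 / n\<^sup>3\<^sup>/\<^sup>2)\<close>, and all \<open>n\<close> of them by \<open>1 + O(t\<^sup>3 / n\<^sup>1\<^sup>/\<^sup>2)\<close>. A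
  multiplicative error needs no a priori estimate of the small tail probability.

  The third one is the passage from sums to U-statistics. By Hoeffding's decomposition the statistic is its mean plus an i.i.d. sum
  plus a degenerate remainder \<open>R\<close> (\<open>ustat_hoeffding\<close>). Expanding the \<open>2 q\<close>-th power, a product of
  kernels has mean zero unless each factor shares two of its indices with other factors; counting the
  index patterns gives \<open>E R\<^sup>2\<^sup>q \<le> (C q / n)\<^sup>2\<^sup>q\<close> (\<open>remainder_moment\<close>). With \<open>q\<close> of order \<open>t\<^sup>2\<close> this makes
  \<open>P(n\<^sup>1\<^sup>/\<^sup>2 |R| > \<delta> / t)\<close> negligible against the Gaussian tail as long as \<open>t = o(n\<^sup>1\<^sup>/\<^sup>6)\<close>, so that
  \<open>ustat_moderate_deviation\<close> follows.

  The laws of the data may change with \<open>n\<close>. As the law of the statistic does not depend on them, all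
  estimates are made under the law \<open>P\<close> of one fixed pair of coordinates, where the variance of the
  i.i.d. part is a positive constant (\<open>zeta_pos\<close>).
\<close>

section \<open>Lindeberg exchange for the logistic function\<close>

definition logistic :: "real \<Rightarrow> real" where
  "logistic u = 1 / (1 + exp (- u))"

lemma logistic_pos: "0 < logistic u"
  unfolding logistic_def by (simp add: add_pos_pos)

lemma logistic_nonneg [simp]: "0 \<le> logistic u"
  using logistic_pos[of u] by simp

lemma logistic_le_1 [simp]: "logistic u \<le> 1"
  unfolding logistic_def by (simp add: add_pos_pos)

lemma logistic_le_exp: "logistic u \<le> exp u"
proof -
  have "1 \<le> exp u * (1 + exp (- u))" by (simp add: algebra_simps flip: exp_add)
  then show ?thesis unfolding logistic_def by (simp add: divide_le_eq add_pos_pos)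
qed

lemma logistic_mono: "u \<le> v \<Longrightarrow> logistic u \<le> logistic v"
  unfolding logistic_def by (intro divide_left_mono) (auto simp: add_pos_pos)

lemma logistic_ge_half: "u \<le> 0 \<Longrightarrow> exp u \<le> 2 * logistic u"
proof -
  assume "u \<le> 0"
  then have "exp u * (1 + exp (- u)) \<le> 2" by (simp add: algebra_simps flip: exp_add)
  then show ?thesis unfolding logistic_def by (simp add: le_divide_eq add_pos_pos)
qed

lemma borel_measurable_logistic [measurable]: "logistic \<in> borel_measurable borel"
  unfolding logistic_def[abs_def] by measurable

text \<open>
  Together with the derivative bound below, this makes all errors of a Taylor expansion
  proportional to the value of the function at the expansion point.
\<close>

lemma logistic_shift: "logistic (u + v) \<le> exp \<bar>v\<bar> * logistic u"
proof -
  have 1: "exp (- u) \<le> exp \<bar>v\<bar> * exp (- (u + v))"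
    by (simp flip: exp_add)
  have "1 \<le> exp \<bar>v\<bar>" by simp
  then have "1 + exp (- u) \<le> exp \<bar>v\<bar> * (1 + exp (- (u + v)))"
    unfolding distrib_left mult_1_right using 1 by (rule add_mono)
  then show ?thesis
    unfolding logistic_def by (simp add: divide_simps add_pos_pos mult.commute)
qed

definition logistic1 :: "real \<Rightarrow> real" where "logistic1 u = logistic u * (1 - logistic u)"
definition logistic2 :: "real \<Rightarrow> real" where "logistic2 u = logistic u * (1 - logistic u) * (1 - 2 * logistic u)"
definition logistic3 :: "real \<Rightarrow> real" where
  "logistic3 u = logistic u * (1 - logistic u) * (1 - 6 * logistic u + 6 * (logistic u)\<^sup>2)"

lemma logistic_deriv: "(logistic has_field_derivative logistic1 u) (at u)"
proof -
  have ne: "1 + exp (- u) \<noteq> 0" using add_pos_pos[of 1 "exp (-u)"] by simp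
  have "(logistic has_field_derivative (exp (- u) / (1 + exp (- u))\<^sup>2)) (at u)"
    unfolding logistic_def[abs_def] using ne
    by (auto intro!: derivative_eq_intros simp: power2_eq_square)
  moreover have "exp (- u) / (1 + exp (- u))\<^sup>2 = logistic1 u"
    unfolding logistic_def logistic1_def using ne by (simp add: field_simps power2_eq_square)
  ultimately show ?thesis by simp
qed

lemma logistic1_deriv: "(logistic1 has_field_derivative logistic2 u) (at u)"
  unfolding logistic1_def[abs_def]
  by (rule derivative_eq_intros logistic_deriv refl)+
     (simp add: logistic1_def logistic2_def algebra_simps power2_eq_square)

lemma logistic2_deriv: "(logistic2 has_field_derivative logistic3 u) (at u)"
  unfolding logistic2_def[abs_def]
  by (rule derivative_eq_intros logistic_deriv refl)+
     (simp add: logistic1_def logistic3_def algebra_simps power2_eq_square)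

text \<open>
  The point of choosing the logistic function: its derivatives are dominated by the function,
  even where the function is exponentially small.
\<close>

lemma logistic3_bound: "\<bar>logistic3 u\<bar> \<le> logistic u"
proof -
  let ?s = "logistic u"
  have s: "0 \<le> ?s" "?s \<le> 1" by auto
  have a: "\<bar>1 - 6 * ?s + 6 * ?s\<^sup>2\<bar> \<le> 1"
  proof -
    have "?s * (1 - ?s) \<ge> 0" using s by (intro mult_nonneg_nonneg) auto
    moreover have "?s * (1 - ?s) \<le> 1/4"
      using zero_le_power2[of "2 * ?s - 1"] by (simp add: power2_eq_square algebra_simps)
    ultimately show ?thesis by (simp add: power2_eq_square algebra_simps abs_le_iff)
  qed
  have "\<bar>logistic3 u\<bar> = ?s * (1 - ?s) * \<bar>1 - 6 * ?s + 6 * ?s\<^sup>2\<bar>"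
    unfolding logistic3_def using s by (simp add: abs_mult)
  also have "\<dots> \<le> ?s * (1 - ?s) * 1"
    using s a by (intro mult_left_mono) auto
  also have "\<dots> \<le> ?s" using s by (simp add: mult_left_le)
  finally show ?thesis .
qed

lemma logistic_taylor:
  "\<bar>logistic (u + v) - (logistic u + logistic1 u * v + logistic2 u / 2 * v\<^sup>2)\<bar> \<le> \<bar>v\<bar> ^ 3 * exp \<bar>v\<bar> / 6 * logistic u"
proof -
  define diff where
    "diff m = (\<lambda>t. if m = 0 then logistic (u + t) else if m = 1 then logistic1 (u + t)
       else if m = 2 then logistic2 (u + t) else logistic3 (u + t))" for m :: nat
  have "\<exists>t. \<bar>t\<bar> \<le> \<bar>v\<bar> \<and> logistic (u + v) = (\<Sum>m<3. diff m 0 / (fact m) * v ^ m) + diff 3 t / (fact 3) * v ^ 3"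
  proof (rule Maclaurin_bi_le[where f = "\<lambda>t. logistic (u + t)"])
    show "diff 0 = (\<lambda>t. logistic (u + t))" by (simp add: diff_def)
    have sh: "((\<lambda>t. g (u + t)) has_field_derivative g' (u + t)) (at t)"
      if "\<And>x. (g has_field_derivative g' x) (at x)" for g g' :: "real \<Rightarrow> real" and t
      using that[of "u + t"] by (simp add: DERIV_shift add.commute)
    show "\<forall>m t. m < 3 \<and> \<bar>t\<bar> \<le> \<bar>v\<bar> \<longrightarrow> DERIV (diff m) t :> diff (Suc m) t"
    proof (intro allI impI)
      fix m :: nat and t :: real
      assume "m < 3 \<and> \<bar>t\<bar> \<le> \<bar>v\<bar>"
      then consider "m = 0" | "m = 1" | "m = 2" by linarith
      then show "DERIV (diff m) t :> diff (Suc m) t"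
        by cases (auto simp: diff_def intro!: sh logistic_deriv logistic1_deriv logistic2_deriv)
    qed
  qed
  then obtain t where t: "\<bar>t\<bar> \<le> \<bar>v\<bar>"
    and eq: "logistic (u + v) = (\<Sum>m<3. diff m 0 / (fact m) * v ^ m) + diff 3 t / (fact 3) * v ^ 3" by auto
  have "(\<Sum>m<3. diff m 0 / (fact m) * v ^ m) = logistic u + logistic1 u * v + logistic2 u / 2 * v\<^sup>2"
    by (simp add: eval_nat_numeral diff_def)
  then have "\<bar>logistic (u + v) - (logistic u + logistic1 u * v + logistic2 u / 2 * v\<^sup>2)\<bar> = \<bar>logistic3 (u + t)\<bar> / 6 * \<bar>v\<bar> ^ 3"
    using eq by (simp add: diff_def abs_mult power_abs fact_numeral)
  also have "\<dots> \<le> (exp \<bar>v\<bar> * logistic u) / 6 * \<bar>v\<bar> ^ 3"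
  proof -
    have "\<bar>logistic3 (u + t)\<bar> \<le> logistic (u + t)" by (rule logistic3_bound)
    also have "\<dots> \<le> exp \<bar>t\<bar> * logistic u" by (rule logistic_shift)
    also have "\<dots> \<le> exp \<bar>v\<bar> * logistic u" using t by (intro mult_right_mono) auto
    finally show ?thesis by (intro mult_right_mono divide_right_mono) auto
  qed
  finally show ?thesis by (simp add: algebra_simps)
qed

text \<open>
  The weight \<open>\<bar>\<xi>\<bar>\<^sup>3 exp \<bar>\<xi>\<bar>\<close> is what the Taylor remainder of \<open>logistic_taylor\<close> requires for step
  sizes up to one. It covers both bounded variables and the Gaussian law they are compared with.
\<close>

definition std_rv :: "'b measure \<Rightarrow> ('b \<Rightarrow> real) \<Rightarrow> bool" where
  "std_rv P \<xi> \<longleftrightarrow> prob_space P \<and> \<xi> \<in> borel_measurable P \<and>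
     integrable P (\<lambda>u. \<bar>\<xi> u\<bar> ^ 3 * exp \<bar>\<xi> u\<bar>) \<and> (\<integral>u. \<xi> u \<partial>P) = 0 \<and> (\<integral>u. (\<xi> u)\<^sup>2 \<partial>P) = 1"

definition exp_third_moment :: "'b measure \<Rightarrow> ('b \<Rightarrow> real) \<Rightarrow> real" where
  "exp_third_moment P \<xi> = (\<integral>u. \<bar>\<xi> u\<bar> ^ 3 * exp \<bar>\<xi> u\<bar> \<partial>P)"

lemma exp_third_moment_nonneg: "0 \<le> exp_third_moment P \<xi>"
  unfolding exp_third_moment_def by (intro integral_nonneg_AE) auto

lemma std_rv_integrable:
  assumes "std_rv P \<xi>"
  shows "integrable P \<xi>" "integrable P (\<lambda>u. (\<xi> u)\<^sup>2)" "integrable P (\<lambda>u. \<bar>\<xi> u\<bar>)"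
proof -
  interpret prob_space P using assms by (simp add: std_rv_def)
  have m [measurable]: "\<xi> \<in> borel_measurable P" using assms by (simp add: std_rv_def)
  have i: "integrable P (\<lambda>u. 1 + \<bar>\<xi> u\<bar> ^ 3 * exp \<bar>\<xi> u\<bar>)"
    using assms by (intro Bochner_Integration.integrable_add) (auto simp: std_rv_def)
  have b: "x \<le> 1 + x ^ 3 * exp x \<and> x\<^sup>2 \<le> 1 + x ^ 3 * exp x" if "0 \<le> x" for x :: real
  proof (cases "x \<le> 1")
    case True
    then have "x\<^sup>2 \<le> 1" using that by (simp add: power_le_one)
    moreover have "0 \<le> x ^ 3 * exp x" using that by simp
    ultimately show ?thesis using True by linarith
  next
    case False
    then have "x \<le> x ^ 3" "x ^ 2 \<le> x ^ 3" using power_increasing[of 1 3 x] by (auto intro!: power_increasing)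
    moreover have "x ^ 3 * 1 \<le> x ^ 3 * exp x" using that by (intro mult_left_mono) auto
    ultimately show ?thesis by simp
  qed
  show "integrable P \<xi>" "integrable P (\<lambda>u. \<bar>\<xi> u\<bar>)"
    using b[OF abs_ge_zero] by (auto intro!: Bochner_Integration.integrable_bound[OF i] AE_I2 order_trans[OF _ abs_ge_self])
  show "integrable P (\<lambda>u. (\<xi> u)\<^sup>2)"
    using b[OF abs_ge_zero] by (auto intro!: Bochner_Integration.integrable_bound[OF i] AE_I2 order_trans[OF _ abs_ge_self])
qed

text \<open>
  Only the first two moments of the law enter the main term, so this term is common to all
  standardised variables.
\<close>

lemma logistic_step:
  assumes "std_rv P \<xi>" and b: "0 \<le> b" "b \<le> 1"
  shows "\<bar>(\<integral>u. logistic (x + b * \<xi> u) \<partial>P) - (logistic x + b\<^sup>2 * logistic2 x / 2)\<bar> \<le> b ^ 3 * exp_third_moment P \<xi> * logistic x"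
proof -
  interpret prob_space P using assms by (simp add: std_rv_def)
  have m [measurable]: "\<xi> \<in> borel_measurable P" using assms by (simp add: std_rv_def)
  note [simp, intro] = std_rv_integrable[OF assms(1)]
  have [simp]: "(\<integral>u. \<xi> u \<partial>P) = 0" "(\<integral>u. (\<xi> u)\<^sup>2 \<partial>P) = 1"
    and i3: "integrable P (\<lambda>u. \<bar>\<xi> u\<bar> ^ 3 * exp \<bar>\<xi> u\<bar>)" using assms by (auto simp: std_rv_def)
  have i1: "integrable P (\<lambda>u. logistic (x + b * \<xi> u))"
    by (rule integrable_const_bound[where B = 1]) auto
  let ?q = "\<lambda>u. logistic x + (logistic1 x * b) * \<xi> u + (logistic2 x / 2 * b\<^sup>2) * (\<xi> u)\<^sup>2"
  have i2: "integrable P ?q" by (intro Bochner_Integration.integrable_add integrable_mult_right) auto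
  have q: "(\<integral>u. ?q u \<partial>P) = logistic x + b\<^sup>2 * logistic2 x / 2"
    by (simp add: prob_space)
  have "\<bar>(\<integral>u. logistic (x + b * \<xi> u) \<partial>P) - (\<integral>u. ?q u \<partial>P)\<bar> = \<bar>\<integral>u. logistic (x + b * \<xi> u) - ?q u \<partial>P\<bar>"
    by (simp add: i1 i2)
  also have "\<dots> \<le> (\<integral>u. \<bar>logistic (x + b * \<xi> u) - ?q u\<bar> \<partial>P)"
    by (rule integral_abs_bound)
  also have "\<dots> \<le> (\<integral>u. b ^ 3 * logistic x * (\<bar>\<xi> u\<bar> ^ 3 * exp \<bar>\<xi> u\<bar>) \<partial>P)"
  proof (rule integral_mono)
    show "integrable P (\<lambda>u. \<bar>logistic (x + b * \<xi> u) - ?q u\<bar>)" using i1 i2 by auto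
    show "integrable P (\<lambda>u. b ^ 3 * logistic x * (\<bar>\<xi> u\<bar> ^ 3 * exp \<bar>\<xi> u\<bar>))" using i3 by auto
    fix u
    have "\<bar>logistic (x + b * \<xi> u) - ?q u\<bar> \<le> \<bar>b * \<xi> u\<bar> ^ 3 * exp \<bar>b * \<xi> u\<bar> / 6 * logistic x"
      using logistic_taylor[of x "b * \<xi> u"] by (simp add: power_mult_distrib algebra_simps)
    also have "\<dots> \<le> \<bar>b * \<xi> u\<bar> ^ 3 * exp \<bar>\<xi> u\<bar> * logistic x"
    proof (rule mult_right_mono)
      have "exp \<bar>b * \<xi> u\<bar> \<le> exp \<bar>\<xi> u\<bar>" using b by (simp add: abs_mult mult_left_le_one_le)
      then have "\<bar>b * \<xi> u\<bar> ^ 3 * exp \<bar>b * \<xi> u\<bar> \<le> \<bar>b * \<xi> u\<bar> ^ 3 * exp \<bar>\<xi> u\<bar>" by (intro mult_left_mono) auto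
      moreover have "0 \<le> \<bar>b * \<xi> u\<bar> ^ 3 * exp \<bar>b * \<xi> u\<bar>" by simp
      ultimately show "\<bar>b * \<xi> u\<bar> ^ 3 * exp \<bar>b * \<xi> u\<bar> / 6 \<le> \<bar>b * \<xi> u\<bar> ^ 3 * exp \<bar>\<xi> u\<bar>" by linarith
    qed simp
    finally show "\<bar>logistic (x + b * \<xi> u) - ?q u\<bar> \<le> b ^ 3 * logistic x * (\<bar>\<xi> u\<bar> ^ 3 * exp \<bar>\<xi> u\<bar>)"
      using b by (simp add: abs_mult power_mult_distrib algebra_simps)
  qed
  also have "\<dots> = b ^ 3 * exp_third_moment P \<xi> * logistic x" by (simp add: exp_third_moment_def)
  finally show ?thesis unfolding q .
qed

text \<open>
  Converts errors proportional to \<open>logistic x\<close> into errors proportional to the mean itself.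
  The bound follows from \<open>logistic (x + v) \<ge> (1 - \<bar>v\<bar>) logistic x\<close> and \<open>E \<bar>\<xi>\<bar> \<le> 1\<close>.
\<close>

lemma logistic_average_lower:
  assumes "std_rv P \<xi>" and b: "0 \<le> b" "b \<le> 1 / 2"
  shows "logistic x \<le> 2 * (\<integral>u. logistic (x + b * \<xi> u) \<partial>P)"
proof -
  interpret prob_space P using assms by (simp add: std_rv_def)
  have m [measurable]: "\<xi> \<in> borel_measurable P" using assms by (simp add: std_rv_def)
  note [simp, intro] = std_rv_integrable[OF assms(1)]
  have [simp]: "(\<integral>u. (\<xi> u)\<^sup>2 \<partial>P) = 1" using assms by (auto simp: std_rv_def)
  have "(\<integral>u. \<bar>\<xi> u\<bar> \<partial>P) \<le> (\<integral>u. (1 + (\<xi> u)\<^sup>2) / 2 \<partial>P)"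
  proof (rule integral_mono)
    fix u show "\<bar>\<xi> u\<bar> \<le> (1 + (\<xi> u)\<^sup>2) / 2"
      using zero_le_power2[of "\<bar>\<xi> u\<bar> - 1"] by (simp add: power2_eq_square algebra_simps)
  qed auto
  also have "\<dots> = 1" by (simp add: prob_space)
  finally have E: "(\<integral>u. \<bar>\<xi> u\<bar> \<partial>P) \<le> 1" .
  have "logistic x / 2 \<le> logistic x * (1 - b * (\<integral>u. \<bar>\<xi> u\<bar> \<partial>P))"
  proof -
    have "b * (\<integral>u. \<bar>\<xi> u\<bar> \<partial>P) \<le> 1/2 * 1" using E b by (intro mult_mono) auto
    then have "logistic x * (1/2) \<le> logistic x * (1 - b * (\<integral>u. \<bar>\<xi> u\<bar> \<partial>P))" by (intro mult_left_mono) auto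
    then show ?thesis by simp
  qed
  also have "\<dots> = (\<integral>u. logistic x * (1 - b * \<bar>\<xi> u\<bar>) \<partial>P)"
    by (simp add: prob_space)
  also have "\<dots> \<le> (\<integral>u. logistic (x + b * \<xi> u) \<partial>P)"
  proof (rule integral_mono)
    show "integrable P (\<lambda>u. logistic (x + b * \<xi> u))"
      by (rule integrable_const_bound[where B = 1]) auto
    show "integrable P (\<lambda>u. logistic x * (1 - b * \<bar>\<xi> u\<bar>))" by auto
    fix u
    have "logistic x \<le> exp \<bar>b * \<xi> u\<bar> * logistic (x + b * \<xi> u)"
      using logistic_shift[of "x + b * \<xi> u" "- (b * \<xi> u)"] by simp
    then have 1: "exp (- \<bar>b * \<xi> u\<bar>) * logistic x \<le> logistic (x + b * \<xi> u)"
      by (simp add: exp_minus field_simps)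
    have "1 - b * \<bar>\<xi> u\<bar> \<le> exp (- \<bar>b * \<xi> u\<bar>)"
      using exp_ge_add_one_self[of "- \<bar>b * \<xi> u\<bar>"] b by (simp add: abs_mult)
    then have "logistic x * (1 - b * \<bar>\<xi> u\<bar>) \<le> logistic x * exp (- \<bar>b * \<xi> u\<bar>)" by (intro mult_left_mono) auto
    with 1 show "logistic x * (1 - b * \<bar>\<xi> u\<bar>) \<le> logistic (x + b * \<xi> u)" by (simp add: mult.commute)
  qed
  finally show ?thesis by simp
qed

lemma logistic_exchange:
  assumes "std_rv P \<xi>" "std_rv N \<zeta>" and b: "0 \<le> b" "b \<le> 1 / 2"
  defines "\<eta> \<equiv> 2 * (exp_third_moment P \<xi> + exp_third_moment N \<zeta>) * b ^ 3"
  shows "\<bar>(\<integral>u. logistic (x + b * \<xi> u) \<partial>P) - (\<integral>u. logistic (x + b * \<zeta> u) \<partial>N)\<bar> \<le> \<eta> * (\<integral>u. logistic (x + b * \<zeta> u) \<partial>N)"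
proof -
  have "\<bar>(\<integral>u. logistic (x + b * \<xi> u) \<partial>P) - (\<integral>u. logistic (x + b * \<zeta> u) \<partial>N)\<bar> \<le> b ^ 3 * exp_third_moment P \<xi> * logistic x + b ^ 3 * exp_third_moment N \<zeta> * logistic x"
    using logistic_step[OF assms(1), of b x] logistic_step[OF assms(2), of b x] b by linarith
  also have "\<dots> = (exp_third_moment P \<xi> + exp_third_moment N \<zeta>) * b ^ 3 * logistic x" by (simp add: algebra_simps)
  also have "\<dots> \<le> (exp_third_moment P \<xi> + exp_third_moment N \<zeta>) * b ^ 3 * (2 * (\<integral>u. logistic (x + b * \<zeta> u) \<partial>N))"
    using logistic_average_lower[OF assms(2) b] b
    by (intro mult_left_mono) (auto intro!: mult_nonneg_nonneg exp_third_moment_nonneg add_nonneg_nonneg)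
  finally show ?thesis by (simp add: \<eta>_def algebra_simps)
qed

definition logistic_mean :: "'b measure \<Rightarrow> ('b \<Rightarrow> real) \<Rightarrow> real \<Rightarrow> nat \<Rightarrow> real \<Rightarrow> real" where
  "logistic_mean P \<xi> b k x = (\<integral>z. logistic (x + b * (\<Sum>i<k. \<xi> (z i))) \<partial>PiM {..<k} (\<lambda>_. P))"

lemma logistic_mean_0: "logistic_mean P \<xi> b 0 x = logistic x"
  by (simp add: logistic_mean_def PiM_empty)

lemma logistic_mean_bounds:
  assumes "std_rv P \<xi>"
  shows "0 \<le> logistic_mean P \<xi> b k x" "logistic_mean P \<xi> b k x \<le> 1"
proof -
  interpret PS: prob_space P using assms by (simp add: std_rv_def)
  interpret Q: prob_space "PiM {..<k} (\<lambda>_. P)" by (intro prob_space_PiM) (rule PS.prob_space_axioms)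
  have m [measurable]: "\<xi> \<in> borel_measurable P" using assms by (simp add: std_rv_def)
  show "0 \<le> logistic_mean P \<xi> b k x" unfolding logistic_mean_def by (intro integral_nonneg_AE) auto
  have "logistic_mean P \<xi> b k x \<le> (\<integral>z. 1 \<partial>PiM {..<k} (\<lambda>_. P))"
    unfolding logistic_mean_def by (intro integral_mono Q.integrable_const_bound[where B = 1]) auto
  then show "logistic_mean P \<xi> b k x \<le> 1" by (simp add: Q.prob_space)
qed

lemma logistic_mean_measurable:
  assumes "std_rv P \<xi>"
  shows "logistic_mean P \<xi> b k \<in> borel_measurable borel"
proof -
  interpret PS: prob_space P using assms by (simp add: std_rv_def)
  interpret Q: prob_space "PiM {..<k} (\<lambda>_. P)" by (intro prob_space_PiM) (rule PS.prob_space_axioms)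
  have m [measurable]: "\<xi> \<in> borel_measurable P" using assms by (simp add: std_rv_def)
  show ?thesis
    unfolding logistic_mean_def[abs_def] by measurable
qed

lemma logistic_mean_Suc:
  assumes "std_rv P \<xi>"
  shows "logistic_mean P \<xi> b (Suc k) x = (\<integral>u. logistic_mean P \<xi> b k (x + b * \<xi> u) \<partial>P)"
proof -
  interpret PS: prob_space P using assms by (simp add: std_rv_def)
  interpret PP: product_prob_space "\<lambda>_. P" "{..<k}" by unfold_locales
  interpret Q: prob_space "PiM {..<k} (\<lambda>_. P)" by (intro prob_space_PiM) (rule PS.prob_space_axioms)
  interpret Q': prob_space "PiM (insert k {..<k}) (\<lambda>_. P)" by (intro prob_space_PiM) (rule PS.prob_space_axioms)
  interpret pair_prob_space P "PiM {..<k} (\<lambda>_. P)" by unfold_locales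
  have m [measurable]: "\<xi> \<in> borel_measurable P" using assms by (simp add: std_rv_def)
  have mm: "(\<lambda>z. logistic (x + b * (\<Sum>i<Suc k. \<xi> (z i)))) \<in> borel_measurable (PiM (insert k {..<k}) (\<lambda>_. P))"
    unfolding lessThan_Suc[symmetric] by measurable
  have "logistic_mean P \<xi> b (Suc k) x = (\<integral>z. logistic (x + b * (\<Sum>i<Suc k. \<xi> (z i))) \<partial>PiM (insert k {..<k}) (\<lambda>_. P))"
    by (simp add: logistic_mean_def lessThan_Suc)
  also have "\<dots> = (\<integral>z. (\<integral>u. logistic (x + b * (\<Sum>i<Suc k. \<xi> ((z(k:=u)) i))) \<partial>P) \<partial>PiM {..<k} (\<lambda>_. P))"
    by (rule PP.product_integral_insert) (use mm in \<open>auto intro!: Q'.integrable_const_bound[where B = 1]\<close>)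
  also have "\<dots> = (\<integral>z. (\<integral>u. logistic ((x + b * \<xi> u) + b * (\<Sum>i<k. \<xi> (z i))) \<partial>P) \<partial>PiM {..<k} (\<lambda>_. P))"
    by (simp add: algebra_simps)
  also have "\<dots> = (\<integral>u. (\<integral>z. logistic ((x + b * \<xi> u) + b * (\<Sum>i<k. \<xi> (z i))) \<partial>PiM {..<k} (\<lambda>_. P)) \<partial>P)"
    by (rule Fubini_integral) (auto intro!: integrable_const_bound[where B = 1] simp: split_beta)
  finally show ?thesis by (simp add: logistic_mean_def)
qed

lemma logistic_mean_integrable:
  assumes "std_rv P \<xi>" "std_rv N \<zeta>"
  shows "integrable N (\<lambda>u. logistic_mean P \<xi> b k (x + c * \<zeta> u))"
proof -
  interpret NS: prob_space N using assms by (simp add: std_rv_def)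
  have m [measurable]: "\<zeta> \<in> borel_measurable N" using assms by (simp add: std_rv_def)
  note [measurable] = logistic_mean_measurable[OF assms(1)]
  show ?thesis
    using logistic_mean_bounds[OF assms(1)] by (intro NS.integrable_const_bound[where B = 1]) auto
qed

lemma logistic_mean_commute:
  assumes "std_rv P \<xi>" "std_rv N \<zeta>"
  shows "(\<integral>u. logistic_mean N \<zeta> b (Suc k) (x + b * \<xi> u) \<partial>P) = (\<integral>v. (\<integral>u. logistic_mean N \<zeta> b k (x + b * \<zeta> v + b * \<xi> u) \<partial>P) \<partial>N)"
proof -
  interpret PS: prob_space P using assms by (simp add: std_rv_def)
  interpret NS: prob_space N using assms by (simp add: std_rv_def)
  interpret pair_prob_space N P by unfold_locales
  have m [measurable]: "\<zeta> \<in> borel_measurable N" "\<xi> \<in> borel_measurable P" using assms by (auto simp add: std_rv_def)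
  note [measurable] = logistic_mean_measurable[OF assms(2)]
  have "(\<integral>u. logistic_mean N \<zeta> b (Suc k) (x + b * \<xi> u) \<partial>P) = (\<integral>u. (\<integral>v. logistic_mean N \<zeta> b k (x + b * \<zeta> v + b * \<xi> u) \<partial>N) \<partial>P)"
    by (simp add: logistic_mean_Suc[OF assms(2)] algebra_simps)
  also have "\<dots> = (\<integral>v. (\<integral>u. logistic_mean N \<zeta> b k (x + b * \<zeta> v + b * \<xi> u) \<partial>P) \<partial>N)"
    using logistic_mean_bounds[OF assms(2)]
    by (intro Fubini_integral) (auto intro!: integrable_const_bound[where B = 1] simp: split_beta)
  finally show ?thesis .
qed

text \<open>
  The comparison of one variable with its Gaussian substitute holds at every point \<open>x\<close>, with an
  error proportional to the Gaussian side. It is therefore inherited by averages over shifts of \<open>x\<close>,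
  in particular over the remaining Gaussian summands.
\<close>

lemma logistic_mean_swap_one:
  assumes PN: "std_rv P \<xi>" "std_rv N \<zeta>" and b: "0 \<le> b" "b \<le> 1 / 2"
  defines "\<eta> \<equiv> 2 * (exp_third_moment P \<xi> + exp_third_moment N \<zeta>) * b ^ 3"
  shows "\<bar>(\<integral>u. logistic_mean N \<zeta> b k (x + b * \<xi> u) \<partial>P) - logistic_mean N \<zeta> b (Suc k) x\<bar> \<le> \<eta> * logistic_mean N \<zeta> b (Suc k) x"
proof (induction k arbitrary: x)
  case 0
  show ?case using logistic_exchange[OF PN b, of x] by (simp add: logistic_mean_Suc[OF PN(2)] logistic_mean_0 \<eta>_def)
next
  case (Suc k)
  note [measurable] = logistic_mean_measurable[OF PN(2)]
  interpret PS: prob_space P using PN by (simp add: std_rv_def)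
  interpret NS: prob_space N using PN by (simp add: std_rv_def)
  have m [measurable]: "\<zeta> \<in> borel_measurable N" "\<xi> \<in> borel_measurable P" using PN by (auto simp add: std_rv_def)
  let ?A = "\<lambda>v. (\<integral>u. logistic_mean N \<zeta> b k (x + b * \<zeta> v + b * \<xi> u) \<partial>P)"
  let ?B = "\<lambda>v. logistic_mean N \<zeta> b (Suc k) (x + b * \<zeta> v)"
  have iB: "integrable N ?B" by (rule logistic_mean_integrable[OF PN(2) PN(2)])
  have bd: "\<bar>?A v\<bar> \<le> 1" for v
  proof -
    have "?A v \<le> (\<integral>u. 1 \<partial>P)"
      using logistic_mean_bounds[OF PN(2)] by (intro integral_mono logistic_mean_integrable[OF PN(2) PN(1)]) auto
    moreover have "0 \<le> ?A v" using logistic_mean_bounds[OF PN(2)] by (intro integral_nonneg_AE) auto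
    ultimately show ?thesis by (simp add: PS.prob_space)
  qed
  have iA: "integrable N ?A"
    using bd by (intro NS.integrable_const_bound[where B = 1]) auto
  have "\<bar>(\<integral>u. logistic_mean N \<zeta> b (Suc k) (x + b * \<xi> u) \<partial>P) - logistic_mean N \<zeta> b (Suc (Suc k)) x\<bar>
      = \<bar>\<integral>v. ?A v - ?B v \<partial>N\<bar>"
    using iA iB by (simp only: logistic_mean_commute[OF PN] logistic_mean_Suc[OF PN(2), of b "Suc k"]) simp
  also have "\<dots> \<le> (\<integral>v. \<bar>?A v - ?B v\<bar> \<partial>N)" by (rule integral_abs_bound)
  also have "\<dots> \<le> (\<integral>v. \<eta> * ?B v \<partial>N)"
    using iA iB Suc.IH by (intro integral_mono) auto
  also have "\<dots> = \<eta> * logistic_mean N \<zeta> b (Suc (Suc k)) x"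
    by (simp add: logistic_mean_Suc[OF PN(2), of b "Suc k"])
  finally show ?case .
qed

text \<open>
  Lindeberg replacement of all \<open>k\<close> summands. The errors multiply instead of adding up.
\<close>

lemma logistic_mean_compare:
  assumes PN: "std_rv P \<xi>" "std_rv N \<zeta>" and b: "0 \<le> b" "b \<le> 1 / 2"
  defines "\<eta> \<equiv> 2 * (exp_third_moment P \<xi> + exp_third_moment N \<zeta>) * b ^ 3"
  assumes \<eta>: "\<eta> \<le> 1"
  shows "(1 - \<eta>) ^ k * logistic_mean N \<zeta> b k x \<le> logistic_mean P \<xi> b k x \<and>
         logistic_mean P \<xi> b k x \<le> (1 + \<eta>) ^ k * logistic_mean N \<zeta> b k x"
proof (induction k arbitrary: x)
  case 0
  then show ?case by (simp add: logistic_mean_0)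
next
  case (Suc k)
  have \<eta>0: "0 \<le> \<eta>" unfolding \<eta>_def using b by (intro mult_nonneg_nonneg add_nonneg_nonneg exp_third_moment_nonneg) auto
  let ?I = "\<integral>u. logistic_mean N \<zeta> b k (x + b * \<xi> u) \<partial>P"
  have sw: "?I \<le> (1 + \<eta>) * logistic_mean N \<zeta> b (Suc k) x" "(1 - \<eta>) * logistic_mean N \<zeta> b (Suc k) x \<le> ?I"
    using logistic_mean_swap_one[OF PN b, of k x] unfolding \<eta>_def[symmetric] by (auto simp: algebra_simps abs_le_iff)
  have "logistic_mean P \<xi> b (Suc k) x \<le> (\<integral>u. (1 + \<eta>) ^ k * logistic_mean N \<zeta> b k (x + b * \<xi> u) \<partial>P)"
    unfolding logistic_mean_Suc[OF PN(1)] using Suc.IH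
    by (intro integral_mono integrable_mult_right logistic_mean_integrable[OF _ PN(1)] PN) auto
  also have "\<dots> = (1 + \<eta>) ^ k * ?I" by simp
  also have "\<dots> \<le> (1 + \<eta>) ^ k * ((1 + \<eta>) * logistic_mean N \<zeta> b (Suc k) x)"
    using sw \<eta>0 by (intro mult_left_mono) auto
  finally have U: "logistic_mean P \<xi> b (Suc k) x \<le> (1 + \<eta>) ^ Suc k * logistic_mean N \<zeta> b (Suc k) x" by (simp add: algebra_simps)
  have "(1 - \<eta>) ^ k * ((1 - \<eta>) * logistic_mean N \<zeta> b (Suc k) x) \<le> (1 - \<eta>) ^ k * ?I"
    using sw \<eta> by (intro mult_left_mono) auto
  also have "\<dots> = (\<integral>u. (1 - \<eta>) ^ k * logistic_mean N \<zeta> b k (x + b * \<xi> u) \<partial>P)" by simp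
  also have "\<dots> \<le> logistic_mean P \<xi> b (Suc k) x"
    unfolding logistic_mean_Suc[OF PN(1)] using Suc.IH
    by (intro integral_mono integrable_mult_right logistic_mean_integrable[OF _ PN(1)] PN) auto
  finally have L: "(1 - \<eta>) ^ Suc k * logistic_mean N \<zeta> b (Suc k) x \<le> logistic_mean P \<xi> b (Suc k) x" by (simp add: algebra_simps)
  from U L show ?case by blast
qed

section \<open>Logistic smoothing of the Gaussian tail\<close>

text \<open>
  Near \<open>t\<close> the Gaussian density at \<open>t + u / t\<close> is proportional to \<open>exp (- u)\<close>, so this integral is
  the limiting ratio of the smoothed and the exact Gaussian tail. It tends to the integral of
  \<open>exp (- u)\<close> over the positive half-line as the smoothing disappears (\<open>\<kappa> \<rightarrow> \<infinity>\<close>).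
\<close>

definition logistic_laplace :: "real \<Rightarrow> real" where
  "logistic_laplace \<kappa> = (\<integral>u. logistic (\<kappa> * u) * exp (- u) \<partial>lborel)"

lemma integrable_exp_neg_abs: "integrable lborel (\<lambda>u::real. exp (- \<bar>u\<bar>))"
proof -
  have a: "integrable lborel (\<lambda>u::real. indicator {0<..} u * exp (- u))"
    using integrable_I0i_exp_mscale[of 1] by (simp add: set_integrable_def)
  have "integrable lborel (\<lambda>u::real. indicator {0<..} (0 + (-1) * u) * exp (- (0 + (-1) * u)))"
    by (rule lborel_integrable_real_affine[OF a]) simp
  with a have b: "integrable lborel (\<lambda>u::real. indicator {0<..} u * exp (- u) + indicator {0<..} (- u) * exp u)"
    by (intro Bochner_Integration.integrable_add) auto
  show ?thesis
  proof (rule Bochner_Integration.integrable_bound[OF b])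
    show "AE u in lborel. norm (exp (- \<bar>u::real\<bar>)) \<le> norm (indicator {0<..} u * exp (- u) + indicator {0<..} (- u) * exp u)"
      using AE_lborel_singleton[of "0::real"]
      by eventually_elim (auto simp: indicator_def abs_if)
  qed simp
qed

text \<open>
  For \<open>\<kappa> \<ge> 2\<close> the logistic function decays faster than \<open>exp (- u)\<close> grows on the negative axis;
  this bound, free of \<open>\<kappa>\<close>, justifies the passage to the limit.
\<close>

lemma logistic_exp_bound:
  assumes "2 \<le> \<kappa>"
  shows "\<bar>logistic (\<kappa> * u) * exp (- u)\<bar> \<le> exp (- \<bar>u\<bar>)"
proof (cases "0 \<le> u")
  case True
  then show ?thesis using mult_right_mono[OF logistic_le_1, of "exp (- u)"] by simp
next
  case False
  have "\<kappa> * u \<le> 2 * u" using assms False by (intro mult_right_mono_neg) auto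
  then have "exp (\<kappa> * u) * exp (- u) \<le> exp (- \<bar>u\<bar>)"
    using False by (simp flip: exp_add)
  moreover have "logistic (\<kappa> * u) * exp (- u) \<le> exp (\<kappa> * u) * exp (- u)"
    by (intro mult_right_mono logistic_le_exp) auto
  ultimately have "logistic (\<kappa> * u) * exp (- u) \<le> exp (- \<bar>u\<bar>)" by (rule order_trans[rotated])
  then show ?thesis by (simp add: abs_mult)
qed

lemma logistic_laplace_integrable:
  assumes "2 \<le> \<kappa>"
  shows "integrable lborel (\<lambda>u. logistic (\<kappa> * u) * exp (- u))"
  using logistic_exp_bound[OF assms]
  by (intro Bochner_Integration.integrable_bound[OF integrable_exp_neg_abs]) auto

lemma logistic_at_top: "(logistic \<longlongrightarrow> 1) at_top"
proof -
  have "((\<lambda>u::real. 1 / (1 + exp (- u))) \<longlongrightarrow> 1 / (1 + 0)) at_top"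
    by (intro tendsto_intros filterlim_compose[OF exp_at_bot] filterlim_uminus_at_bot_at_top) auto
  then show ?thesis by (simp add: logistic_def[abs_def])
qed

lemma logistic_at_bot: "(logistic \<longlongrightarrow> 0) at_bot"
  by (rule tendsto_sandwich[OF _ _ tendsto_const exp_at_bot]) (auto intro!: always_eventually logistic_le_exp)

lemma logistic_laplace_tendsto: "(\<lambda>k::nat. logistic_laplace (real k)) \<longlonglongrightarrow> 1"
proof -
  let ?f = "\<lambda>u::real. indicator {0<..} u * exp (- u)"
  have "(\<lambda>k. \<integral>u. logistic (real (k + 2) * u) * exp (- u) \<partial>lborel) \<longlonglongrightarrow> (\<integral>u. ?f u \<partial>lborel)"
  proof (rule integral_dominated_convergence[where w = "\<lambda>u. exp (- \<bar>u\<bar>)"])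
    show "AE u in lborel. (\<lambda>k. logistic (real (k + 2) * u) * exp (- u)) \<longlonglongrightarrow> ?f u"
      using AE_lborel_singleton[of "0::real"]
    proof eventually_elim
      fix u :: real assume u: "u \<noteq> 0"
      have k: "filterlim (\<lambda>k. real (k + 2)) at_top sequentially"
        by (rule filterlim_compose[OF filterlim_real_sequentially filterlim_add_const_nat_at_top])
      show "(\<lambda>k. logistic (real (k + 2) * u) * exp (- u)) \<longlonglongrightarrow> ?f u"
      proof (cases "0 < u")
        case True
        have "filterlim (\<lambda>k. real (k + 2) * u) at_top sequentially"
          by (rule filterlim_at_top_mult_tendsto_pos[OF tendsto_const True k])
        then show ?thesis using True filterlim_compose[OF logistic_at_top]
          by (auto intro!: tendsto_eq_intros)
      next
        case False
        with u have u: "0 < - u" by simp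
        have "filterlim (\<lambda>k. real (k + 2) * - u) at_top sequentially"
          by (rule filterlim_at_top_mult_tendsto_pos[OF tendsto_const u k])
        then have "filterlim (\<lambda>k. real (k + 2) * u) at_bot sequentially"
          by (simp add: filterlim_uminus_at_bot)
        then show ?thesis using False filterlim_compose[OF logistic_at_bot]
          by (auto intro!: tendsto_eq_intros)
      qed
    qed
    show "AE u in lborel. norm (logistic (real (k + 2) * u) * exp (- u)) \<le> exp (- \<bar>u\<bar>)" for k
      using logistic_exp_bound[of "real (k + 2)"] by (intro AE_I2) simp
  qed (auto intro: integrable_exp_neg_abs)
  moreover have "(\<integral>u. ?f u \<partial>lborel) = 1"
    using LBINT_I0i_exp_mscale[of 1] by (simp add: interval_lebesgue_integral_0_infty set_lebesgue_integral_def)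
  ultimately have "(\<lambda>k. logistic_laplace (real (k + 2))) \<longlonglongrightarrow> 1"
    by (simp add: logistic_laplace_def)
  then show ?thesis by (rule LIMSEQ_offset)
qed

text \<open>
  The substitution \<open>x = t + u / t\<close> turns the density into
  \<open>exp (- t\<^sup>2 / 2) exp (- u) exp (- u\<^sup>2 / (2 t\<^sup>2))\<close> up to the normalisation, whose last factor tends to
  one. The shift by \<open>c / t\<close> in the argument costs the factor \<open>exp (- c)\<close>.
\<close>

lemma gaussian_logistic_tail:
  fixes t :: "nat \<Rightarrow> real"
  assumes t: "filterlim t at_top sequentially" and \<kappa>: "2 \<le> \<kappa>"
  shows "(\<lambda>n. t n * exp ((t n)\<^sup>2 / 2) * sqrt (2 * pi) *
      (\<integral>x. std_normal_density x * logistic (\<kappa> * t n * x - \<kappa> * (t n)\<^sup>2 - \<kappa> * c) \<partial>lborel))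
    \<longlonglongrightarrow> exp (- c) * logistic_laplace \<kappa>"
proof -
  let ?w = "\<lambda>u. logistic (\<kappa> * u - \<kappa> * c) * exp (- u)"
  have w0: "?w (c + 1 * u) = exp (- c) * (logistic (\<kappa> * u) * exp (- u))" for u
  proof -
    have "exp (- (c + 1 * u)) = exp (- c) * exp (- u)" by (simp add: exp_diff exp_minus field_simps)
    moreover have "\<kappa> * (c + 1 * u) - \<kappa> * c = \<kappa> * u" by (simp add: algebra_simps)
    ultimately show ?thesis by (metis mult.left_commute)
  qed
  have w_int: "(\<integral>u. ?w u \<partial>lborel) = exp (- c) * logistic_laplace \<kappa>"
    using lborel_integral_real_affine[of 1 ?w c] unfolding w0 by (simp add: logistic_laplace_def)
  have w_able: "integrable lborel ?w"
    using lborel_integrable_real_affine_iff[of 1 ?w c] logistic_laplace_integrable[OF \<kappa>]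
    unfolding w0 by simp
  let ?g = "\<lambda>s u. ?w u * exp (- (u\<^sup>2 / (2 * s\<^sup>2)))"
  have eq: "s * exp (s\<^sup>2 / 2) * sqrt (2 * pi) *
      (\<integral>x. std_normal_density x * logistic (\<kappa> * s * x - \<kappa> * s\<^sup>2 - \<kappa> * c) \<partial>lborel) = (\<integral>u. ?g s u \<partial>lborel)"
    if s: "0 < s" for s
  proof -
    have p: "std_normal_density (s + 1 / s * u) * logistic (\<kappa> * s * (s + 1 / s * u) - \<kappa> * s\<^sup>2 - \<kappa> * c)
        = (1 / (exp (s\<^sup>2 / 2) * sqrt (2 * pi))) * ?g s u" for u
    proof -
      \<comment> \<open>expanding the square: the cross term \<open>- u\<close> survives, the last term vanishes in the limit\<close>
      have e: "- (s + 1 / s * u)\<^sup>2 / 2 = - (s\<^sup>2 / 2) + (- u + - (u\<^sup>2 / (2 * s\<^sup>2)))"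
        using s by (simp add: power2_eq_square field_simps)
      have a: "\<kappa> * s * (s + 1 / s * u) - \<kappa> * s\<^sup>2 - \<kappa> * c = \<kappa> * u - \<kappa> * c"
        using s by (simp add: power2_eq_square field_simps)
      show ?thesis
        unfolding std_normal_density_def e a exp_add by (simp add: exp_minus field_simps)
    qed
    have "(\<integral>x. std_normal_density x * logistic (\<kappa> * s * x - \<kappa> * s\<^sup>2 - \<kappa> * c) \<partial>lborel)
        = (1 / s) * (\<integral>u. (1 / (exp (s\<^sup>2 / 2) * sqrt (2 * pi))) * ?g s u \<partial>lborel)"
      using s by (subst lborel_integral_real_affine[of "1 / s" _ s]) (simp_all only: p, simp_all)
    also have "\<dots> = (1 / s) * (1 / (exp (s\<^sup>2 / 2) * sqrt (2 * pi))) * (\<integral>u. ?g s u \<partial>lborel)"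
      by simp
    finally show ?thesis using s by simp
  qed
  have "(\<lambda>n. \<integral>u. ?g (t n) u \<partial>lborel) \<longlonglongrightarrow> (\<integral>u. ?w u \<partial>lborel)"
  proof (rule integral_dominated_convergence[where w = ?w])
    show "AE u in lborel. (\<lambda>n. ?g (t n) u) \<longlonglongrightarrow> ?w u"
    proof (rule AE_I2)
      fix u :: real
      have "(\<lambda>n. ?w u * exp (- ((u\<^sup>2 / 2) * (inverse (t n))\<^sup>2))) \<longlonglongrightarrow> ?w u * exp (- ((u\<^sup>2 / 2) * 0\<^sup>2))"
        by (intro tendsto_intros tendsto_inverse_0_at_top t)
      then show "(\<lambda>n. ?g (t n) u) \<longlonglongrightarrow> ?w u" by (simp add: field_simps)
    qed
    show "AE u in lborel. norm (?g (t n) u) \<le> ?w u" for n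
      by (auto simp: abs_mult intro!: AE_I2 mult_left_le)
  qed (auto intro: w_able)
  then show ?thesis
    unfolding w_int
    by (rule Lim_transform_eventually)
       (use filterlim_at_top_dense[THEN iffD1, OF t, rule_format, of 0] in eventually_elim, auto simp: eq)
qed

abbreviation "std_normal \<equiv> density lborel (\<lambda>x. ennreal (std_normal_density x))"

lemma std_rv_std_normal: "std_rv std_normal (\<lambda>u. u)"
proof -
  have i: "integrable lborel (\<lambda>x. std_normal_density x * (\<bar>x\<bar> ^ 3 * exp \<bar>x\<bar>))"
  proof (rule Bochner_Integration.integrable_bound)
    show "integrable lborel (\<lambda>x. (exp 1 * sqrt 2) * (normal_density 0 (sqrt 2) x * \<bar>x - 0\<bar> ^ 3))"
      by (intro integrable_mult_right integrable_normal_moment_abs) simp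
    show "AE x in lborel. norm (std_normal_density x * (\<bar>x\<bar> ^ 3 * exp \<bar>x\<bar>))
        \<le> norm ((exp 1 * sqrt 2) * (normal_density 0 (sqrt 2) x * \<bar>x - 0\<bar> ^ 3))"
    proof (rule AE_I2)
      fix x :: real
      have "\<bar>x\<bar> \<le> 1 + x\<^sup>2 / 4"
        using zero_le_power2[of "\<bar>x\<bar> / 2 - 1"] by (simp add: power2_eq_square algebra_simps)
      then have "exp (- x\<^sup>2 / 2) * exp \<bar>x\<bar> \<le> exp 1 * exp (- x\<^sup>2 / 4)"
        by (simp flip: exp_add)
      then have "\<bar>x\<bar> ^ 3 / sqrt (2 * pi) * (exp (- x\<^sup>2 / 2) * exp \<bar>x\<bar>) \<le> \<bar>x\<bar> ^ 3 / sqrt (2 * pi) * (exp 1 * exp (- x\<^sup>2 / 4))"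
        by (intro mult_left_mono) auto
      moreover have "sqrt 2 * normal_density 0 (sqrt 2) x = exp (- x\<^sup>2 / 4) / sqrt (2 * pi)"
      proof -
        have "sqrt (2 * pi * (sqrt 2)\<^sup>2) = sqrt 2 * sqrt (2 * pi)" by (simp add: real_sqrt_mult)
        then show ?thesis unfolding normal_density_def by simp
      qed
      ultimately have "std_normal_density x * (\<bar>x\<bar> ^ 3 * exp \<bar>x\<bar>)
        \<le> (exp 1 * sqrt 2) * (normal_density 0 (sqrt 2) x * \<bar>x - 0\<bar> ^ 3)"
        by (simp add: std_normal_density_def algebra_simps)
      then show "norm (std_normal_density x * (\<bar>x\<bar> ^ 3 * exp \<bar>x\<bar>))
        \<le> norm ((exp 1 * sqrt 2) * (normal_density 0 (sqrt 2) x * \<bar>x - 0\<bar> ^ 3))"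
        by simp
    qed
  qed simp
  have 0: "(\<integral>u. u \<partial>std_normal) = 0"
    using integral_std_normal_moment_odd[of 0] by (subst integral_real_density) auto
  have 2: "(\<integral>u. u\<^sup>2 \<partial>std_normal) = 1"
    using integral_std_normal_moment_even[of 1] by (subst integral_real_density) auto
  have 3: "integrable std_normal (\<lambda>u. \<bar>u\<bar> ^ 3 * exp \<bar>u\<bar>)"
    using i by (subst integrable_real_density) auto
  show ?thesis
    unfolding std_rv_def using 0 2 3 by (auto intro: prob_space_normal_density)
qed

lemma indep_vars_PiM_components:
  assumes "\<And>i. i \<in> I \<Longrightarrow> prob_space (M i)" and "I \<noteq> {}"
  shows "prob_space.indep_vars (PiM I M) M (\<lambda>i z. z i) I"
proof -
  interpret prob_space "PiM I M" by (intro prob_space_PiM assms)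
  have "distr (PiM I M) (PiM I M) (\<lambda>x. \<lambda>i\<in>I. x i) = distr (PiM I M) (PiM I M) (\<lambda>x. x)"
    by (intro distr_cong) (auto simp: space_PiM PiE_def extensional_restrict)
  also have "\<dots> = PiM I M" by (simp add: distr_id)
  also have "\<dots> = PiM I (\<lambda>i. distr (PiM I M) (M i) (\<lambda>x. x i))"
    by (intro PiM_cong refl) (simp add: distr_PiM_component assms)
  finally show ?thesis by (subst indep_vars_iff_distr_eq_PiM') (auto simp: assms)
qed

text \<open>
  A sum of independent standard normal variables is normal, so the Gaussian side of the comparison is
  an explicit integral.
\<close>

lemma logistic_mean_std_normal:
  assumes "0 < n"
  shows "logistic_mean std_normal (\<lambda>u. u) b n x = (\<integral>v. std_normal_density v * logistic (x + b * sqrt (real n) * v) \<partial>lborel)"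
proof -
  interpret N: prob_space std_normal by (rule prob_space_normal_density) simp
  let ?Q = "PiM {..<n} (\<lambda>_. std_normal)"
  interpret Q: prob_space ?Q by (intro prob_space_PiM) (rule N.prob_space_axioms)
  have ind: "Q.indep_vars (\<lambda>_. borel) (\<lambda>i z. z i) {..<n}"
  proof -
    have "Q.indep_vars (\<lambda>_. std_normal) (\<lambda>i z. z i) {..<n}"
      using assms by (intro indep_vars_PiM_components) (auto intro: N.prob_space_axioms)
    then have "Q.indep_vars (\<lambda>_. borel) (\<lambda>i z. (\<lambda>u. u) (z i)) {..<n}"
      by (rule Q.indep_vars_compose2) simp
    then show ?thesis by simp
  qed
  have D: "distributed ?Q lborel (\<lambda>z. z i) (normal_density 0 1)" if "i < n" for i
  proof -
    have "distr ?Q lborel (\<lambda>z. z i) = distr ?Q std_normal (\<lambda>z. z i)" by (intro distr_cong) auto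
    also have "\<dots> = std_normal" using that by (intro distr_PiM_component) (auto intro: N.prob_space_axioms)
    finally have "distr ?Q lborel (\<lambda>z. z i) = std_normal" .
    moreover have "(\<lambda>z. z i) \<in> measurable ?Q lborel"
      using measurable_component_singleton[of i "{..<n}" "\<lambda>_. std_normal"] that by simp
    ultimately show ?thesis by (simp add: distributed_def)
  qed
  have "distributed ?Q lborel (\<lambda>z. \<Sum>i<n. z i) (normal_density (\<Sum>i<n. 0) (sqrt (\<Sum>i<n. 1\<^sup>2)))"
    using assms D ind by (intro Q.sum_indep_normal) auto
  then have S: "distributed ?Q lborel (\<lambda>z. \<Sum>i<n. z i) (normal_density 0 (sqrt (real n)))" by simp
  have "logistic_mean std_normal (\<lambda>u. u) b n x = (\<integral>v. normal_density 0 (sqrt (real n)) v * logistic (x + b * v) \<partial>lborel)"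
    unfolding logistic_mean_def by (rule distributed_integral[OF S, symmetric]) auto
  also have "\<dots> = sqrt (real n) * (\<integral>v. normal_density 0 (sqrt (real n)) (0 + sqrt (real n) * v) * logistic (x + b * (0 + sqrt (real n) * v)) \<partial>lborel)"
    using assms by (subst lborel_integral_real_affine[of "sqrt (real n)" _ 0]) auto
  also have "\<dots> = (\<integral>v. sqrt (real n) * (normal_density 0 (sqrt (real n)) (0 + sqrt (real n) * v) * logistic (x + b * (0 + sqrt (real n) * v))) \<partial>lborel)"
    by simp
  also have "\<dots> = (\<integral>v. std_normal_density v * logistic (x + b * sqrt (real n) * v) \<partial>lborel)"
    using assms by (intro Bochner_Integration.integral_cong refl)
      (simp add: normal_density_def real_sqrt_mult power_mult_distrib field_simps)
  finally show ?thesis .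
qed

section \<open>Moderate deviations of independent sums\<close>

text \<open>
  The step size is \<open>b = \<kappa> t / \<surd>n\<close>, hence \<open>n b\<^sup>3 = \<kappa>\<^sup>3 t\<^sup>3 / \<surd>n\<close> vanishes and the \<open>n\<close>-fold product of
  the exchange factors tends to one.
\<close>

lemma logistic_mean_tail:
  fixes t :: "nat \<Rightarrow> real"
  assumes P: "std_rv P \<xi>" and t: "filterlim t at_top sequentially"
    and t3: "(\<lambda>n. (t n) ^ 3 / sqrt (real n)) \<longlonglongrightarrow> 0" and \<kappa>: "2 \<le> \<kappa>"
  shows "(\<lambda>n. t n * exp ((t n)\<^sup>2 / 2) * sqrt (2 * pi) *
      logistic_mean P \<xi> (\<kappa> * t n / sqrt (real n)) n (- \<kappa> * (t n)\<^sup>2 - \<kappa> * c))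
    \<longlonglongrightarrow> exp (- c) * logistic_laplace \<kappa>"
proof -
  define K where "K = 2 * (exp_third_moment P \<xi> + exp_third_moment std_normal (\<lambda>u. u))"
  define G where "G n = t n * exp ((t n)\<^sup>2 / 2) * sqrt (2 * pi)" for n
  define b where "b n = \<kappa> * t n / sqrt (real n)" for n
  define x where "x n = - \<kappa> * (t n)\<^sup>2 - \<kappa> * c" for n
  define \<eta> where "\<eta> n = K * (b n) ^ 3" for n
  let ?F = "\<lambda>n. logistic_mean P \<xi> (b n) n (x n)"
  let ?FN = "\<lambda>n. logistic_mean std_normal (\<lambda>u. u) (b n) n (x n)"
  have K: "0 \<le> K" unfolding K_def by (intro mult_nonneg_nonneg add_nonneg_nonneg exp_third_moment_nonneg) auto
  have t1: "eventually (\<lambda>n. 1 \<le> t n) sequentially"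
    using t by (simp add: filterlim_at_top)
  have n1: "eventually (\<lambda>n. 0 < n) sequentially" by (rule eventually_gt_at_top)
  have \<eta>0: "(\<lambda>n. real n * \<eta> n) \<longlonglongrightarrow> 0"
  proof (rule Lim_transform_eventually)
    show "(\<lambda>n. K * \<kappa> ^ 3 * ((t n) ^ 3 / sqrt (real n))) \<longlonglongrightarrow> 0"
      using tendsto_mult_left[OF t3, of "K * \<kappa> ^ 3"] by simp
    show "\<forall>\<^sub>F n in sequentially. K * \<kappa> ^ 3 * ((t n) ^ 3 / sqrt (real n)) = real n * \<eta> n"
      using n1
    proof eventually_elim
      fix n :: nat assume "0 < n"
      then have "sqrt (real n) ^ 3 = real n * sqrt (real n)"
        by (simp add: power3_eq_cube)
      with \<open>0 < n\<close> show "K * \<kappa> ^ 3 * ((t n) ^ 3 / sqrt (real n)) = real n * \<eta> n"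
        by (simp add: \<eta>_def b_def power_mult_distrib power_divide)
    qed
  qed
  have b0: "b \<longlonglongrightarrow> 0"
  proof (rule tendsto_sandwich[where f = "\<lambda>_. 0"])
    show "(\<lambda>n. \<kappa> * ((t n) ^ 3 / sqrt (real n))) \<longlonglongrightarrow> 0"
      using tendsto_mult_left[OF t3, of "\<kappa>"] by simp
    show "\<forall>\<^sub>F n in sequentially. b n \<le> \<kappa> * ((t n) ^ 3 / sqrt (real n))"
      using t1
    proof eventually_elim
      fix n assume "1 \<le> t n"
      then have "t n \<le> (t n) ^ 3" using power_increasing[of 1 3 "t n"] by simp
      then show "b n \<le> \<kappa> * ((t n) ^ 3 / sqrt (real n))"
        using \<kappa> unfolding b_def times_divide_eq_right[symmetric] by (intro mult_left_mono divide_right_mono) auto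
    qed
    show "\<forall>\<^sub>F n in sequentially. 0 \<le> b n"
      using t1 by eventually_elim (use \<kappa> in \<open>auto simp: b_def\<close>)
  qed (rule tendsto_const)
  have b_small: "eventually (\<lambda>n. b n \<le> 1 / 2) sequentially"
    using order_tendstoD(2)[OF b0, of "1 / 2"] by (auto elim: eventually_mono)
  have \<eta>_small: "eventually (\<lambda>n. real n * \<eta> n < 1) sequentially"
    using order_tendstoD(2)[OF \<eta>0, of 1] by simp
  have good: "eventually (\<lambda>n. (1 - real n * \<eta> n) * (G n * ?FN n) \<le> G n * ?F n \<and>
      G n * ?F n \<le> exp (real n * \<eta> n) * (G n * ?FN n)) sequentially"
    using t1 n1 b_small \<eta>_small
  proof eventually_elim
    fix n :: nat
    assume t1: "1 \<le> t n" and n: "0 < n" and bs: "b n \<le> 1 / 2" and es: "real n * \<eta> n < 1"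
    have b0: "0 \<le> b n" using t1 \<kappa> by (auto simp: b_def)
    have e0: "0 \<le> \<eta> n" using b0 K by (auto simp: \<eta>_def)
    have e1: "\<eta> n \<le> 1"
    proof -
      have "1 * \<eta> n \<le> real n * \<eta> n" using n e0 by (intro mult_right_mono) auto
      with es show ?thesis by simp
    qed
    have G0: "0 \<le> G n" using t1 by (simp add: G_def)
    have FN0: "0 \<le> ?FN n" by (rule logistic_mean_bounds[OF std_rv_std_normal])
    note cmp = logistic_mean_compare[OF P std_rv_std_normal b0 bs, folded K_def, folded \<eta>_def, OF e1, of n "x n"]
    have "(1 + \<eta> n) ^ n \<le> exp (\<eta> n) ^ n" using e0 by (intro power_mono exp_ge_add_one_self) auto
    then have up: "(1 + \<eta> n) ^ n \<le> exp (real n * \<eta> n)" by (simp add: exp_of_nat_mult)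
    have lo: "1 - real n * \<eta> n \<le> (1 - \<eta> n) ^ n"
      using Bernoulli_inequality[of "- \<eta> n" n] e1 by simp
    have "?F n \<le> exp (real n * \<eta> n) * ?FN n"
      using cmp mult_right_mono[OF up FN0] by linarith
    moreover have "(1 - real n * \<eta> n) * ?FN n \<le> ?F n"
      using cmp mult_right_mono[OF lo FN0] by linarith
    ultimately show "(1 - real n * \<eta> n) * (G n * ?FN n) \<le> G n * ?F n \<and>
      G n * ?F n \<le> exp (real n * \<eta> n) * (G n * ?FN n)"
      using G0 mult_left_mono[of _ _ "G n"] by (metis mult.left_commute)
  qed
  have FN: "(\<lambda>n. G n * ?FN n) \<longlonglongrightarrow> exp (- c) * logistic_laplace \<kappa>"
  proof (rule Lim_transform_eventually[OF gaussian_logistic_tail[OF t \<kappa>, of c]])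
    show "\<forall>\<^sub>F n in sequentially. t n * exp ((t n)\<^sup>2 / 2) * sqrt (2 * pi) *
        (\<integral>x. std_normal_density x * logistic (\<kappa> * t n * x - \<kappa> * (t n)\<^sup>2 - \<kappa> * c) \<partial>lborel) = G n * ?FN n"
      using n1
    proof eventually_elim
      fix n :: nat assume n: "0 < n"
      have "x n + b n * sqrt (real n) * v = \<kappa> * t n * v - \<kappa> * (t n)\<^sup>2 - \<kappa> * c" for v
        using n by (simp add: x_def b_def)
      then show "t n * exp ((t n)\<^sup>2 / 2) * sqrt (2 * pi) *
        (\<integral>x. std_normal_density x * logistic (\<kappa> * t n * x - \<kappa> * (t n)\<^sup>2 - \<kappa> * c) \<partial>lborel) = G n * ?FN n"
        by (simp add: logistic_mean_std_normal[OF n] G_def)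
    qed
  qed
  have "(\<lambda>n. G n * ?F n) \<longlonglongrightarrow> exp (- c) * logistic_laplace \<kappa>"
  proof (rule tendsto_sandwich)
    show "(\<lambda>n. (1 - real n * \<eta> n) * (G n * ?FN n)) \<longlonglongrightarrow> exp (- c) * logistic_laplace \<kappa>"
      using tendsto_mult[OF tendsto_diff[OF tendsto_const[of 1] \<eta>0] FN] by simp
    show "(\<lambda>n. exp (real n * \<eta> n) * (G n * ?FN n)) \<longlonglongrightarrow> exp (- c) * logistic_laplace \<kappa>"
      using tendsto_mult[OF tendsto_exp[OF \<eta>0] FN] by simp
    show "\<forall>\<^sub>F n in sequentially. (1 - real n * \<eta> n) * (G n * ?FN n) \<le> G n * ?F n"
      "\<forall>\<^sub>F n in sequentially. G n * ?F n \<le> exp (real n * \<eta> n) * (G n * ?FN n)"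
      using good by (auto elim: eventually_mono)
  qed
  then show ?thesis by (simp add: G_def b_def x_def)
qed

text \<open>
  Sandwich between the indicator of \<open>{x. x > t}\<close> and logistic functions centred at \<open>t \<mp> \<beta> / t\<close>. In the
  lower bound the part of the logistic function to the left of \<open>t\<close> is at most \<open>2 exp (- \<kappa> \<beta>)\<close> times the
  logistic function centred at \<open>t\<close>, because it decays like an exponential there.
\<close>

lemma tail_logistic_mean_bounds:
  fixes n :: nat and t :: real
  assumes P: "std_rv P \<xi>" and t: "0 < t" and n: "0 < n" and \<kappa>: "0 < \<kappa>" and \<beta>: "0 \<le> \<beta>"
  defines "p \<equiv> measure (PiM {..<n} (\<lambda>_. P)) {z \<in> space (PiM {..<n} (\<lambda>_. P)). t < (\<Sum>i<n. \<xi> (z i)) / sqrt (real n)}"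
  defines "F \<equiv> \<lambda>c. logistic_mean P \<xi> (\<kappa> * t / sqrt (real n)) n (- \<kappa> * t\<^sup>2 - \<kappa> * c)"
  shows "p \<le> (1 + exp (- (\<kappa> * \<beta>))) * F (- \<beta>)"
    and "F \<beta> - 2 * exp (- (\<kappa> * \<beta>)) * F 0 \<le> p"
proof -
  interpret PS: prob_space P using P by (simp add: std_rv_def)
  have m [measurable]: "\<xi> \<in> borel_measurable P" using P by (simp add: std_rv_def)
  let ?Q = "PiM {..<n} (\<lambda>_. P)"
  interpret Q: prob_space ?Q by (intro prob_space_PiM) (rule PS.prob_space_axioms)
  define S where "S z = (\<Sum>i<n. \<xi> (z i)) / sqrt (real n)" for z
  have S [measurable]: "S \<in> borel_measurable ?Q" unfolding S_def[abs_def] by measurable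
  have F: "F c = (\<integral>z. logistic (\<kappa> * t * (S z - t) - \<kappa> * c) \<partial>?Q)" for c
    unfolding F_def logistic_mean_def S_def using n
    by (intro Bochner_Integration.integral_cong refl arg_cong[where f = logistic])
       (simp add: power2_eq_square algebra_simps)
  have p: "p = (\<integral>z. indicator {z \<in> space ?Q. t < S z} z \<partial>?Q)"
    unfolding p_def S_def[symmetric] by (subst Bochner_Integration.integral_indicator) (auto simp: Int_absorb2)
  have i: "integrable ?Q (\<lambda>z. logistic (\<kappa> * t * (S z - t) - \<kappa> * c))" for c
    by (rule Q.integrable_const_bound[where B = 1]) auto
  have iI: "integrable ?Q (\<lambda>z. indicator {z \<in> space ?Q. t < S z} z :: real)"
    by (rule Q.integrable_const_bound[where B = 1]) (auto simp: indicator_def)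
  have "p \<le> (\<integral>z. (1 + exp (- (\<kappa> * \<beta>))) * logistic (\<kappa> * t * (S z - t) - \<kappa> * (- \<beta>)) \<partial>?Q)"
    unfolding p
  proof (rule integral_mono)
    fix z
    have pos: "0 < 1 + exp (- (\<kappa> * \<beta>))" by (simp add: add_pos_pos)
    have 1: "(1 + exp (- (\<kappa> * \<beta>))) * logistic (\<kappa> * \<beta>) = 1"
      using pos by (simp add: logistic_def)
    show "indicator {z \<in> space ?Q. t < S z} z \<le> (1 + exp (- (\<kappa> * \<beta>))) * logistic (\<kappa> * t * (S z - t) - \<kappa> * (- \<beta>))"
    proof (cases "t < S z")
      case True
      then have "\<kappa> * \<beta> \<le> \<kappa> * t * (S z - t) - \<kappa> * (- \<beta>)" using \<kappa> t by simp
      then have "(1 + exp (- (\<kappa> * \<beta>))) * logistic (\<kappa> * \<beta>) \<le> (1 + exp (- (\<kappa> * \<beta>))) * logistic (\<kappa> * t * (S z - t) - \<kappa> * (- \<beta>))"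
        using pos by (intro mult_left_mono logistic_mono) auto
      then show ?thesis using 1 by (simp add: indicator_def)
    next
      case False
      then show ?thesis using pos by (simp add: indicator_def)
    qed
  qed (rule iI integrable_mult_right i)+
  then show "p \<le> (1 + exp (- (\<kappa> * \<beta>))) * F (- \<beta>)" unfolding F by simp
  have "F \<beta> \<le> (\<integral>z. indicator {z \<in> space ?Q. t < S z} z + 2 * exp (- (\<kappa> * \<beta>)) * logistic (\<kappa> * t * (S z - t) - \<kappa> * 0) \<partial>?Q)"
    unfolding F
  proof (rule integral_mono)
    fix z assume z: "z \<in> space ?Q"
    show "logistic (\<kappa> * t * (S z - t) - \<kappa> * \<beta>) \<le> indicator {z \<in> space ?Q. t < S z} z + 2 * exp (- (\<kappa> * \<beta>)) * logistic (\<kappa> * t * (S z - t) - \<kappa> * 0)"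
    proof (cases "t < S z")
      case True
      have "logistic (\<kappa> * t * (S z - t) - \<kappa> * \<beta>) \<le> 1" by simp
      then show ?thesis using True z by (simp add: indicator_def add_increasing2)
    next
      case False
      let ?a = "\<kappa> * t * (S z - t)"
      have a: "?a \<le> 0" using False \<kappa> t by (simp add: mult_nonneg_nonpos)
      have "logistic (?a - \<kappa> * \<beta>) \<le> exp (- (\<kappa> * \<beta>)) * exp ?a"
        using logistic_le_exp[of "?a - \<kappa> * \<beta>"] by (simp flip: exp_add)
      also have "\<dots> \<le> exp (- (\<kappa> * \<beta>)) * (2 * logistic ?a)"
        using logistic_ge_half[OF a] by (intro mult_left_mono) auto
      finally show ?thesis using False by (simp add: indicator_def algebra_simps)
    qed
  next
    show "integrable ?Q (\<lambda>z. indicator {z \<in> space ?Q. t < S z} z + 2 * exp (- (\<kappa> * \<beta>)) * logistic (\<kappa> * t * (S z - t) - \<kappa> * 0))"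
      by (intro Bochner_Integration.integrable_add integrable_mult_right i iI)
  qed (rule i)
  also have "\<dots> = p + 2 * exp (- (\<kappa> * \<beta>)) * F 0"
    unfolding p F by (subst Bochner_Integration.integral_add[OF iI integrable_mult_right[OF i]]) simp
  finally show "F \<beta> - 2 * exp (- (\<kappa> * \<beta>)) * F 0 \<le> p" by simp
qed

text \<open>
  The sandwich holds for each fixed \<open>\<kappa> = k\<close>; with \<open>\<beta> = 1 / \<surd>k\<close> both the shift factors
  \<open>exp (\<plusminus> \<beta>)\<close> and the error \<open>exp (- \<kappa> \<beta>) = exp (- \<surd>k)\<close> become harmless as \<open>k\<close> grows.
\<close>

theorem iid_moderate_deviation:
  fixes t :: "nat \<Rightarrow> real"
  assumes P: "std_rv P \<xi>" and t: "filterlim t at_top sequentially"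
    and t3: "(\<lambda>n. (t n) ^ 3 / sqrt (real n)) \<longlonglongrightarrow> 0"
  shows "(\<lambda>n. t n * exp ((t n)\<^sup>2 / 2) * sqrt (2 * pi) *
      measure (PiM {..<n} (\<lambda>_. P)) {z \<in> space (PiM {..<n} (\<lambda>_. P)). t n < (\<Sum>i<n. \<xi> (z i)) / sqrt (real n)}) \<longlonglongrightarrow> 1"
proof -
  define G where "G n = t n * exp ((t n)\<^sup>2 / 2) * sqrt (2 * pi)" for n
  define p where "p n = measure (PiM {..<n} (\<lambda>_. P)) {z \<in> space (PiM {..<n} (\<lambda>_. P)). t n < (\<Sum>i<n. \<xi> (z i)) / sqrt (real n)}" for n
  define F where "F \<kappa> c n = logistic_mean P \<xi> (\<kappa> * t n / sqrt (real n)) n (- \<kappa> * (t n)\<^sup>2 - \<kappa> * c)" for \<kappa> c n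
  define J where "J k = logistic_laplace (real k)" for k
  define u where "u k = (1 + exp (- sqrt (real k))) * (exp (1 / sqrt (real k)) * J k)" for k :: nat
  define l where "l k = exp (- (1 / sqrt (real k))) * J k - 2 * exp (- sqrt (real k)) * (exp (- 0) * J k)" for k :: nat
  have FJ: "(\<lambda>n. G n * F (real k) c n) \<longlonglongrightarrow> exp (- c) * J k" if "2 \<le> k" for k c
    using logistic_mean_tail[OF P t t3, of "real k" c] that by (simp add: G_def F_def J_def)
  have J: "J \<longlonglongrightarrow> 1" unfolding J_def by (rule logistic_laplace_tendsto)
  have sq: "filterlim (\<lambda>k. sqrt (real k)) at_top sequentially"
    by (rule filterlim_compose[OF sqrt_at_top filterlim_real_sequentially])
  have e1: "(\<lambda>k. exp (- sqrt (real k))) \<longlonglongrightarrow> 0"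
    by (intro filterlim_compose[OF exp_at_bot] filterlim_compose[OF filterlim_uminus_at_bot_at_top] sq)
  have e2: "(\<lambda>k. 1 / sqrt (real k)) \<longlonglongrightarrow> 0"
    by (rule tendsto_divide_0[OF tendsto_const]) (rule filterlim_at_top_imp_at_infinity[OF sq])
  have u: "u \<longlonglongrightarrow> (1 + 0) * (exp 0 * 1)" unfolding u_def by (intro tendsto_intros e1 e2 J)
  have l: "l \<longlonglongrightarrow> exp (- 0) * 1 - 2 * 0 * (exp (- 0) * 1)" unfolding l_def by (intro tendsto_intros e1 e2 J)
  have ev: "eventually (\<lambda>n. 0 < t n \<and> 0 < n) sequentially"
    using t by (auto simp: filterlim_at_top_dense eventually_conj_iff eventually_gt_at_top)
  have kb: "real k * (1 / sqrt (real k)) = sqrt (real k)" for k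
    by (simp add: real_div_sqrt)
  have bounds: "eventually (\<lambda>n. G n * p n \<le> (1 + exp (- sqrt (real k))) * (G n * F (real k) (- (1 / sqrt (real k))) n)
      \<and> G n * F (real k) (1 / sqrt (real k)) n - 2 * exp (- sqrt (real k)) * (G n * F (real k) 0 n) \<le> G n * p n) sequentially"
    if k: "2 \<le> k" for k
    using ev
  proof eventually_elim
    fix n assume tn: "0 < t n \<and> 0 < n"
    then have G: "0 \<le> G n" by (simp add: G_def)
    note b = tail_logistic_mean_bounds[OF P, of "t n" n "real k" "1 / sqrt (real k)", folded p_def, folded F_def, unfolded kb]
    have "G n * p n \<le> G n * ((1 + exp (- sqrt (real k))) * F (real k) (- (1 / sqrt (real k))) n)"
      using b(1) tn k G by (intro mult_left_mono) auto
    moreover have "G n * (F (real k) (1 / sqrt (real k)) n - 2 * exp (- sqrt (real k)) * F (real k) 0 n) \<le> G n * p n"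
      using b(2) tn k G by (intro mult_left_mono) auto
    ultimately show "G n * p n \<le> (1 + exp (- sqrt (real k))) * (G n * F (real k) (- (1 / sqrt (real k))) n)
      \<and> G n * F (real k) (1 / sqrt (real k)) n - 2 * exp (- sqrt (real k)) * (G n * F (real k) 0 n) \<le> G n * p n"
      by (simp add: algebra_simps)
  qed
  have "(\<lambda>n. G n * p n) \<longlonglongrightarrow> 1"
  proof (rule order_tendstoI)
    fix a :: real assume "a < 1"
    then have "eventually (\<lambda>k. a < l k) sequentially" using l by (intro order_tendstoD) auto
    then obtain k where k: "a < l k" "2 \<le> k"
      using eventually_happens'[OF sequentially_bot eventually_conj[OF _ eventually_ge_at_top[of 2]]] by blast
    have "(\<lambda>n. G n * F (real k) (1 / sqrt (real k)) n - 2 * exp (- sqrt (real k)) * (G n * F (real k) 0 n)) \<longlonglongrightarrow> l k"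
      unfolding l_def using k by (intro tendsto_intros FJ)
    from order_tendstoD(1)[OF this k(1)] bounds[OF k(2)]
    show "\<forall>\<^sub>F n in sequentially. a < G n * p n" by eventually_elim linarith
  next
    fix a :: real assume "1 < a"
    then have "eventually (\<lambda>k. u k < a) sequentially" using u by (intro order_tendstoD) auto
    then obtain k where k: "u k < a" "2 \<le> k"
      using eventually_happens'[OF sequentially_bot eventually_conj[OF _ eventually_ge_at_top[of 2]]] by blast
    have "(\<lambda>n. (1 + exp (- sqrt (real k))) * (G n * F (real k) (- (1 / sqrt (real k))) n)) \<longlonglongrightarrow>
        (1 + exp (- sqrt (real k))) * (exp (- (- (1 / sqrt (real k)))) * J k)"
      using k by (intro tendsto_mult tendsto_const FJ)
    then have "(\<lambda>n. (1 + exp (- sqrt (real k))) * (G n * F (real k) (- (1 / sqrt (real k))) n)) \<longlonglongrightarrow> u k"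
      by (simp add: u_def)
    from order_tendstoD(2)[OF this k(1)] bounds[OF k(2)]
    show "\<forall>\<^sub>F n in sequentially. G n * p n < a" by eventually_elim linarith
  qed
  then show ?thesis by (simp add: G_def p_def)
qed

section \<open>High moments of degenerate sums\<close>

definition inj_tuples :: "nat \<Rightarrow> nat \<Rightarrow> (nat \<Rightarrow> nat) set" where
  "inj_tuples m n = {i. i \<in> {..<m} \<rightarrow>\<^sub>E {..<n} \<and> inj_on i {..<m}}"

lemma finite_inj_tuples [simp]: "finite (inj_tuples m n)"
proof -
  have "inj_tuples m n \<subseteq> {..<m} \<rightarrow>\<^sub>E {..<n}" by (auto simp: inj_tuples_def)
  then show ?thesis by (rule finite_subset) (simp add: finite_PiE)
qed

lemma inj_tuplesD:
  assumes "I \<in> inj_tuples m n"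
  shows "I \<in> {..<m} \<rightarrow>\<^sub>E {..<n}" "inj_on I {..<m}" "\<And>l. l < m \<Longrightarrow> I l < n"
  using assms by (auto simp: inj_tuples_def PiE_def Pi_def)

lemma card_inj_tuples: "real (card (inj_tuples m n)) = (\<Prod>l<m. real n - real l)"
proof -
  have "card (inj_tuples m n) = (\<Prod>l<m. n - l)"
    using card_inj_on_subset_funcset[of "{..<m}" "{..<n}" "{..<m}"]
    by (simp add: inj_tuples_def atLeast0LessThan)
  also have "real \<dots> = (\<Prod>l<m. real n - real l)"
  proof (cases "m \<le> n")
    case True
    then show ?thesis by (simp add: of_nat_diff)
  next
    case False
    then have "n \<in> {..<m}" by simp
    then have a: "(\<Prod>l<m. n - l) = 0" and b: "(\<Prod>l<m. real n - real l) = 0"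
      by (auto intro!: prod_zero)
    show ?thesis unfolding a b by simp
  qed
  finally show ?thesis .
qed

text \<open>
  By symmetry: exchanging two values \<open>i\<close> and \<open>i'\<close> is a bijection between the tuples with \<open>I l = i\<close>
  and those with \<open>I l = i'\<close>.
\<close>

lemma sum_inj_tuples_component:
  fixes \<phi> :: "nat \<Rightarrow> real"
  assumes l: "l < m"
  shows "real n * (\<Sum>I\<in>inj_tuples m n. \<phi> (I l)) = real (card (inj_tuples m n)) * (\<Sum>i<n. \<phi> i)"
proof -
  define c where "c i = real (card {I \<in> inj_tuples m n. I l = i})" for i
  have ceq: "c i = c i'" if i: "i < n" "i' < n" for i i'
  proof -
    \<comment> \<open>\<open>\<tau>\<close> swaps the two values in every slot and is an involution\<close>
    define \<tau> where "\<tau> I = (\<lambda>k\<in>{..<m}. Transposition.transpose i i' (I k))" for I :: "nat \<Rightarrow> nat"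
    have \<tau>\<tau>: "\<tau> (\<tau> I) = I" if "I \<in> inj_tuples m n" for I
      using inj_tuplesD(1)[OF that] by (auto simp: \<tau>_def PiE_def extensional_def fun_eq_iff)
    have mem: "\<tau> I \<in> inj_tuples m n" if "I \<in> inj_tuples m n" for I
    proof -
      have "\<tau> I \<in> {..<m} \<rightarrow>\<^sub>E {..<n}"
        using inj_tuplesD(3)[OF that] i by (auto simp: \<tau>_def Transposition.transpose_def)
      moreover have "inj_on (\<tau> I) {..<m}"
        using inj_tuplesD(2)[OF that] by (auto simp: \<tau>_def inj_on_def dest: injD[OF inj_transpose])
      ultimately show ?thesis by (simp add: inj_tuples_def)
    qed
    have "bij_betw \<tau> {I \<in> inj_tuples m n. I l = i} {I \<in> inj_tuples m n. I l = i'}"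
      by (rule bij_betw_byWitness[where f' = \<tau>])
         (use l in \<open>auto simp: \<tau>\<tau> mem\<close>, auto simp: \<tau>_def)
    then show ?thesis by (simp add: c_def bij_betw_same_card)
  qed
  have rng: "(\<lambda>I. I l) ` inj_tuples m n \<subseteq> {..<n}" using inj_tuplesD(3) l by auto
  have group: "(\<Sum>I\<in>inj_tuples m n. \<psi> (I l)) = (\<Sum>i<n. c i * \<psi> i)" for \<psi> :: "nat \<Rightarrow> real"
  proof -
    have "(\<Sum>I\<in>inj_tuples m n. \<psi> (I l)) = (\<Sum>i<n. \<Sum>I | I \<in> inj_tuples m n \<and> I l = i. \<psi> (I l))"
      by (rule sum.group[symmetric]) (use rng in auto)
    also have "\<dots> = (\<Sum>i<n. c i * \<psi> i)"
      by (intro sum.cong refl) (auto simp: c_def)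
    finally show ?thesis .
  qed
  have "real (card (inj_tuples m n)) = (\<Sum>i<n. c i)" using group[of "\<lambda>_. 1"] by simp
  then have N: "real (card (inj_tuples m n)) = real n * c i" if "i < n" for i
    using ceq[OF _ that] by (simp add: sum.cong[of "{..<n}" _ c "\<lambda>_. c i"])
  have "real n * (\<Sum>I\<in>inj_tuples m n. \<phi> (I l)) = (\<Sum>i<n. real n * c i * \<phi> i)"
    by (simp add: group sum_distrib_left algebra_simps)
  also have "\<dots> = (\<Sum>i<n. real (card (inj_tuples m n)) * \<phi> i)"
    by (intro sum.cong refl) (simp add: N)
  finally show ?thesis by (simp add: sum_distrib_left)
qed

text \<open>
  A generating function for the number of distinct letters of a word. Letters are appended one at a
  time: at most \<open>card S\<close> of the \<open>n\<close> choices repeat an old letter and gain a factor \<open>u\<close>. Large weights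
  \<open>u\<close> show that words with many repetitions are rare.
\<close>

lemma sum_words_weight:
  fixes u :: real
  assumes "finite S" "0 \<le> u"
  shows "(\<Sum>W\<in>S \<rightarrow>\<^sub>E {..<n}. u ^ (card S - card (W ` S))) \<le> (real n + real (card S) * u) ^ card S"
  using assms(1)
proof (induction S rule: finite_induct)
  case empty
  then show ?case by simp
next
  case (insert s S)
  let ?e = "\<lambda>W. card S - card (W ` S)"
  have "(\<Sum>W\<in>insert s S \<rightarrow>\<^sub>E {..<n}. u ^ (card (insert s S) - card (W ` insert s S)))
      = (\<Sum>(y, W)\<in>{..<n} \<times> (S \<rightarrow>\<^sub>E {..<n}). u ^ (card (insert s S) - card ((W(s := y)) ` insert s S)))"
    unfolding PiE_insert_eq
    by (subst sum.reindex[OF inj_combinator[OF insert.hyps(2)]]) (simp only: comp_def case_prod_unfold)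
  also have "\<dots> = (\<Sum>W\<in>S \<rightarrow>\<^sub>E {..<n}. \<Sum>y<n. u ^ (card (insert s S) - card ((W(s := y)) ` insert s S)))"
    by (subst sum.swap) (simp add: sum.cartesian_product)
  also have "\<dots> \<le> (\<Sum>W\<in>S \<rightarrow>\<^sub>E {..<n}. u ^ ?e W * (real n + real (card S) * u))"
  proof (rule sum_mono)
    fix W assume W: "W \<in> S \<rightarrow>\<^sub>E {..<n}"
    have cW: "card (W ` S) \<le> card S" using insert.hyps(1) by (rule card_image_le)
    have "(\<Sum>y<n. u ^ (card (insert s S) - card ((W(s := y)) ` insert s S)))
        \<le> (\<Sum>y<n. u ^ ?e W * (1 + (if y \<in> W ` S then u else 0)))"
    proof (rule sum_mono)
      fix y assume "y \<in> {..<n}"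
      have "(W(s := y)) ` insert s S = insert y (W ` S)" using insert.hyps(2) by auto
      then have "card ((W(s := y)) ` insert s S) = (if y \<in> W ` S then card (W ` S) else Suc (card (W ` S)))"
        using insert.hyps(1) by (simp add: card_insert_if)
      then have "card (insert s S) - card ((W(s := y)) ` insert s S) = (if y \<in> W ` S then Suc (?e W) else ?e W)"
        using insert.hyps cW by (simp add: Suc_diff_le)
      then show "u ^ (card (insert s S) - card ((W(s := y)) ` insert s S)) \<le> u ^ ?e W * (1 + (if y \<in> W ` S then u else 0))"
        using assms(2) by (simp add: algebra_simps)
    qed
    also have "\<dots> = u ^ ?e W * (real n + (\<Sum>y<n. if y \<in> W ` S then u else 0))"
      by (simp add: sum_distrib_left[symmetric] sum.distrib)
    also have "\<dots> \<le> u ^ ?e W * (real n + real (card S) * u)"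
    proof (intro mult_left_mono add_left_mono)
      have "(\<Sum>y<n. if y \<in> W ` S then u else 0) = real (card ({..<n} \<inter> W ` S)) * u"
        by (simp add: sum.If_cases)
      also have "\<dots> \<le> real (card S) * u"
      proof (intro mult_right_mono assms(2))
        have "card ({..<n} \<inter> W ` S) \<le> card (W ` S)" using insert.hyps(1) by (intro card_mono) auto
        with cW show "real (card ({..<n} \<inter> W ` S)) \<le> real (card S)" by simp
      qed
      finally show "(\<Sum>y<n. if y \<in> W ` S then u else 0) \<le> real (card S) * u" .
    qed (use assms(2) in auto)
    finally show "(\<Sum>y<n. u ^ (card (insert s S) - card ((W(s := y)) ` insert s S)))
      \<le> u ^ ?e W * (real n + real (card S) * u)" .
  qed
  also have "\<dots> = (\<Sum>W\<in>S \<rightarrow>\<^sub>E {..<n}. u ^ ?e W) * (real n + real (card S) * u)"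
    by (simp add: sum_distrib_right)
  also have "\<dots> \<le> (real n + real (card S) * u) ^ card S * (real n + real (card S) * u)"
    using insert.IH assms(2) by (intro mult_right_mono) auto
  also have "\<dots> = (real n + real (card S) * u) ^ card (insert s S)"
    using insert.hyps by simp
  also have "\<dots> \<le> (real n + real (card (insert s S)) * u) ^ card (insert s S)"
    using assms(2) insert.hyps by (intro power_mono add_left_mono mult_right_mono) auto
  finally show ?case .
qed

text \<open>
  Counts letters when each of the \<open>q\<close> tuples has, whichever slot \<open>l0\<close> is ignored, a further entry
  occurring in another tuple. Then each tuple has two slots whose letter occurs at least twice.
  Giving weight \<open>1\<close> to such slots and \<open>2\<close> to the others, every letter has total weight at least \<open>2\<close>,
  while every tuple has total weight at most \<open>2 m - 2\<close>.
\<close>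

lemma card_letters_le:
  fixes w :: "nat \<Rightarrow> nat \<Rightarrow> nat"
  assumes w: "\<And>a. a < q \<Longrightarrow> inj_on (w a) {..<m}"
    and shared: "\<And>a l0. a < q \<Longrightarrow> l0 < m \<Longrightarrow>
      \<exists>l<m. l \<noteq> l0 \<and> (\<exists>a'<q. a' \<noteq> a \<and> w a l \<in> w a' ` {..<m})"
    and m: "0 < m"
  shows "card ((\<lambda>(a, l). w a l) ` ({..<q} \<times> {..<m})) + q \<le> q * m"
proof -
  let ?S = "{..<q} \<times> {..<m}"
  let ?W = "\<lambda>(a, l). w a l"
  define g :: "nat \<times> nat \<Rightarrow> nat" where
    "g s = (if \<exists>s'\<in>?S. s' \<noteq> s \<and> ?W s' = ?W s then 1 else 2)" for s
  have fibre: "2 \<le> sum g {s \<in> ?S. ?W s = y}" if y: "y \<in> ?W ` ?S" for y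
  proof -
    from y obtain s where s: "s \<in> ?S" "?W s = y" by blast
    show ?thesis
    proof (cases "\<exists>s'\<in>?S. s' \<noteq> s \<and> ?W s' = ?W s")
      case True
      then obtain s' where s': "s' \<in> ?S" "s' \<noteq> s" "?W s' = ?W s" by blast
      have "sum g {s, s'} \<le> sum g {s \<in> ?S. ?W s = y}"
        using s s' by (intro sum_mono2) auto
      moreover have "1 \<le> g s" "1 \<le> g s'" by (auto simp: g_def)
      ultimately show ?thesis using s'(2) by simp
    next
      case False
      then have "g s = 2" by (simp add: g_def)
      moreover have "sum g {s} \<le> sum g {s \<in> ?S. ?W s = y}"
        using s by (intro sum_mono2) auto
      ultimately show ?thesis by simp
    qed
  qed
  have "2 * card (?W ` ?S) = (\<Sum>y\<in>?W ` ?S. 2)" by simp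
  also have "\<dots> \<le> (\<Sum>y\<in>?W ` ?S. sum g {s \<in> ?S. ?W s = y})" by (intro sum_mono fibre)
  also have "\<dots> = sum g ?S" by (rule sum.image_gen[symmetric]) simp
  also have "\<dots> = (\<Sum>a<q. \<Sum>l<m. g (a, l))" by (simp add: sum.cartesian_product)
  finally have A: "2 * card (?W ` ?S) \<le> (\<Sum>a<q. \<Sum>l<m. g (a, l))" .
  have tuple: "(\<Sum>l<m. g (a, l)) + 2 \<le> 2 * m" if a: "a < q" for a
  proof -
    have one: "g (a, l) = 1" if l: "l < m" and ex: "\<exists>a'<q. a' \<noteq> a \<and> w a l \<in> w a' ` {..<m}" for l
    proof -
      from ex obtain a' l' where "a' < q" "a' \<noteq> a" "l' < m" "w a l = w a' l'" by auto
      then have "\<exists>s'\<in>?S. s' \<noteq> (a, l) \<and> ?W s' = ?W (a, l)"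
        by (intro bexI[of _ "(a', l')"]) auto
      then show ?thesis by (simp add: g_def)
    qed
    from shared[OF a m] obtain l1 where l1: "l1 < m" "g (a, l1) = 1" using one by blast
    from shared[OF a l1(1)] obtain l2 where l2: "l2 < m" "l2 \<noteq> l1" "g (a, l2) = 1" using one by blast
    have "(\<Sum>l<m. g (a, l)) = g (a, l1) + (g (a, l2) + (\<Sum>l\<in>{..<m} - {l1} - {l2}. g (a, l)))"
      using l1 l2 by (simp add: sum.remove[of _ l1] sum.remove[of _ l2])
    also have "\<dots> \<le> 1 + (1 + (\<Sum>l\<in>{..<m} - {l1} - {l2}. 2))"
      using l1 l2 by (intro add_mono sum_mono) (auto simp: g_def)
    also have "\<dots> = 2 + 2 * (m - 2)"
      using l1 l2 by (simp add: card_Diff_singleton_if)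
    finally show ?thesis using l1 l2 by linarith
  qed
  have "(\<Sum>a<q. \<Sum>l<m. g (a, l)) + 2 * q = (\<Sum>a<q. (\<Sum>l<m. g (a, l)) + 2)"
    by (simp only: sum.distrib) simp
  also have "\<dots> \<le> (\<Sum>a<q. 2 * m)" using tuple by (intro sum_mono) auto
  finally have "(\<Sum>a<q. \<Sum>l<m. g (a, l)) + 2 * q \<le> 2 * (q * m)" by simp
  with A show ?thesis by linarith
qed

text \<open>
  Resampling the coordinates in \<open>J\<close> from an independent copy does not change a product law. This is
  used in place of Fubini's theorem for the splitting of the index set into \<open>J\<close> and its complement.
\<close>

lemma distr_PiM_splice:
  fixes P :: "'b measure" and I J :: "'i set"
  assumes P: "prob_space P" and I: "finite I"
  shows "distr (PiM I (\<lambda>_. P) \<Otimes>\<^sub>M PiM I (\<lambda>_. P)) (PiM I (\<lambda>_. P)) (\<lambda>(z, z'). \<lambda>i\<in>I. if i \<in> J then z' i else z i)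
    = PiM I (\<lambda>_. P)"
proof -
  interpret PS: prob_space P by fact
  interpret PP: product_prob_space "\<lambda>_. P" I by unfold_locales
  let ?Q = "PiM I (\<lambda>_. P)"
  have Q: "prob_space ?Q" by (intro prob_space_PiM) (rule P)
  let ?T = "\<lambda>(z, z'). \<lambda>i\<in>I. if i \<in> J then z' i else z i"
  have T [measurable]: "?T \<in> measurable (?Q \<Otimes>\<^sub>M ?Q) ?Q"
    unfolding split_beta by (rule measurable_restrict) (auto simp: split_beta)
  show ?thesis
  proof (rule PP.PiM_eqI[OF I])
    show "sets (distr (?Q \<Otimes>\<^sub>M ?Q) ?Q ?T) = sets ?Q" by simp
    fix A assume A: "\<And>i. i \<in> I \<Longrightarrow> A i \<in> sets P"
    let ?B = "\<lambda>i. if i \<in> J then space P else A i" and ?C = "\<lambda>i. if i \<in> J then A i else space P"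
    have B: "PiE I ?B \<in> sets ?Q" "PiE I ?C \<in> sets ?Q" "PiE I A \<in> sets ?Q"
      using A I by (auto intro!: sets_PiM_I_finite)
    have "emeasure (distr (?Q \<Otimes>\<^sub>M ?Q) ?Q ?T) (PiE I A) = emeasure (?Q \<Otimes>\<^sub>M ?Q) (?T -` PiE I A \<inter> space (?Q \<Otimes>\<^sub>M ?Q))"
      using B by (intro emeasure_distr) auto
    also have "?T -` PiE I A \<inter> space (?Q \<Otimes>\<^sub>M ?Q) = PiE I ?B \<times> PiE I ?C"
    proof -
      have sub: "A i \<subseteq> space P" if "i \<in> I" for i using A[OF that] by (rule sets.sets_into_space)
      have pw: "((if i \<in> J then b else a) \<in> A i \<and> a \<in> space P \<and> b \<in> space P) = (a \<in> ?B i \<and> b \<in> ?C i)"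
        if "i \<in> I" for i a b
        using sub[OF that] by auto
      show ?thesis
      proof (intro set_eqI)
        fix x :: "('i \<Rightarrow> 'b) \<times> ('i \<Rightarrow> 'b)"
        obtain z z' where x: "x = (z, z')" by (cases x)
        have "x \<in> ?T -` PiE I A \<inter> space (?Q \<Otimes>\<^sub>M ?Q) \<longleftrightarrow> z \<in> extensional I \<and> z' \<in> extensional I \<and>
          (\<forall>i\<in>I. (if i \<in> J then z' i else z i) \<in> A i \<and> z i \<in> space P \<and> z' i \<in> space P)"
          unfolding x by (simp add: space_pair_measure space_PiM PiE_iff ball_conj_distrib) blast
        also have "\<dots> \<longleftrightarrow> z \<in> extensional I \<and> z' \<in> extensional I \<and> (\<forall>i\<in>I. z i \<in> ?B i \<and> z' i \<in> ?C i)"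
          by (intro conj_cong ball_cong refl pw)
        also have "\<dots> \<longleftrightarrow> x \<in> PiE I ?B \<times> PiE I ?C"
          unfolding x mem_Times_iff PiE_iff fst_conv snd_conv ball_conj_distrib by blast
        finally show "x \<in> ?T -` PiE I A \<inter> space (?Q \<Otimes>\<^sub>M ?Q) \<longleftrightarrow> x \<in> PiE I ?B \<times> PiE I ?C" .
      qed
    qed
    also have "emeasure (?Q \<Otimes>\<^sub>M ?Q) (PiE I ?B \<times> PiE I ?C) = emeasure ?Q (PiE I ?B) * emeasure ?Q (PiE I ?C)"
      using B by (intro sigma_finite_measure.emeasure_pair_measure_Times[OF prob_space_imp_sigma_finite[OF Q]])
    also have "\<dots> = (\<Prod>i\<in>I. emeasure P (?B i)) * (\<Prod>i\<in>I. emeasure P (?C i))"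
      using A by (simp add: PP.emeasure_PiM I)
    also have "\<dots> = (\<Prod>i\<in>I. emeasure P (A i))"
      unfolding prod.distrib[symmetric] by (intro prod.cong refl) (auto simp: PS.emeasure_space_1)
    finally show "emeasure (distr (?Q \<Otimes>\<^sub>M ?Q) ?Q ?T) (PiE I A) = (\<Prod>i\<in>I. emeasure P (A i))" .
  qed
qed

lemma integral_PiM_splice:
  fixes f :: "('i \<Rightarrow> 'b) \<Rightarrow> real"
  assumes P: "prob_space P" and I: "finite I"
    and f: "f \<in> borel_measurable (PiM I (\<lambda>_. P))" and bd: "\<And>z. z \<in> space (PiM I (\<lambda>_. P)) \<Longrightarrow> \<bar>f z\<bar> \<le> B"
  shows "(\<integral>z. f z \<partial>PiM I (\<lambda>_. P)) = (\<integral>z. (\<integral>z'. f (\<lambda>i\<in>I. if i \<in> J then z' i else z i) \<partial>PiM I (\<lambda>_. P)) \<partial>PiM I (\<lambda>_. P))"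
proof -
  let ?Q = "PiM I (\<lambda>_. P)"
  interpret Q: prob_space ?Q by (intro prob_space_PiM) (rule P)
  interpret QQ: pair_prob_space ?Q ?Q by unfold_locales
  let ?T = "\<lambda>(z, z'). \<lambda>i\<in>I. if i \<in> J then z' i else z i"
  note [measurable] = f
  have T [measurable]: "?T \<in> measurable (?Q \<Otimes>\<^sub>M ?Q) ?Q"
    unfolding split_beta by (rule measurable_restrict) (auto simp: split_beta)
  have "(\<integral>z. f z \<partial>?Q) = (\<integral>z. f z \<partial>distr (?Q \<Otimes>\<^sub>M ?Q) ?Q ?T)"
    by (subst distr_PiM_splice[OF P I]) (rule refl)
  also have "\<dots> = (\<integral>x. f (?T x) \<partial>(?Q \<Otimes>\<^sub>M ?Q))"
    by (intro integral_distr) auto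
  also have "\<dots> = (\<integral>z. (\<integral>z'. f (?T (z, z')) \<partial>?Q) \<partial>?Q)"
  proof (rule QQ.integral_fst'[symmetric])
    show "integrable (?Q \<Otimes>\<^sub>M ?Q) (\<lambda>x. f (?T x))"
    proof (rule QQ.integrable_const_bound[where B = B])
      show "AE x in ?Q \<Otimes>\<^sub>M ?Q. norm (f (?T x)) \<le> B"
        using bd measurable_space[OF T] by (auto intro!: AE_I2)
    qed measurable
  qed
  finally show ?thesis by simp
qed

text \<open>
  If all but one of the indices of a factor \<open>r\<close> occur nowhere else, then integrating over them first,
  with the argument in slot \<open>l0\<close> held fixed, gives zero by degeneracy.
\<close>

lemma integral_degenerate_eq_0:
  fixes r G :: "_ \<Rightarrow> real"
  assumes P: "prob_space P"
    and r: "r \<in> borel_measurable (PiM {..<m} (\<lambda>_. P))"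
    and r_bd: "\<And>z. z \<in> space (PiM {..<m} (\<lambda>_. P)) \<Longrightarrow> \<bar>r z\<bar> \<le> B"
    and deg: "\<And>x. x \<in> space P \<Longrightarrow> (\<integral>z. r (z(l0 := x)) \<partial>PiM {..<m} (\<lambda>_. P)) = 0"
    and I: "I \<in> inj_tuples m n" and l0: "l0 < m"
    and G: "G \<in> borel_measurable (PiM {..<n} (\<lambda>_. P))"
    and G_bd: "\<And>z. z \<in> space (PiM {..<n} (\<lambda>_. P)) \<Longrightarrow> \<bar>G z\<bar> \<le> B'"
    and G_indep: "\<And>z z'. z \<in> space (PiM {..<n} (\<lambda>_. P)) \<Longrightarrow> z' \<in> space (PiM {..<n} (\<lambda>_. P)) \<Longrightarrow>
       (\<And>i. i < n \<Longrightarrow> i \<notin> I ` ({..<m} - {l0}) \<Longrightarrow> z i = z' i) \<Longrightarrow> G z = G z'"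
  shows "(\<integral>z. r (\<lambda>l\<in>{..<m}. z (I l)) * G z \<partial>PiM {..<n} (\<lambda>_. P)) = 0"
proof -
  let ?Q = "PiM {..<n} (\<lambda>_. P)" and ?Qm = "PiM {..<m} (\<lambda>_. P)"
  interpret PS: prob_space P by fact
  interpret Q: prob_space ?Q by (intro prob_space_PiM) (rule P)
  interpret Qm: prob_space ?Qm by (intro prob_space_PiM) (rule P)
  note [measurable] = r G
  note ID = inj_tuplesD[OF I]
  define J where "J = I ` ({..<m} - {l0})"
  have sel [measurable]: "(\<lambda>z. \<lambda>l\<in>{..<m}. z (I l)) \<in> measurable ?Q ?Qm"
    using ID(3) by (intro measurable_restrict measurable_component_singleton) auto
  have selD: "distr ?Q ?Qm (\<lambda>z. \<lambda>l\<in>{..<m}. z (I l)) = ?Qm"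
    using ID by (intro distr_PiM_reindex P) auto
  have B: "0 \<le> B" using r_bd Qm.not_empty by (meson abs_ge_zero all_not_in_conv order_trans)
  have "(\<integral>z. r (\<lambda>l\<in>{..<m}. z (I l)) * G z \<partial>?Q)
    = (\<integral>z. (\<integral>z'. r (\<lambda>l\<in>{..<m}. (\<lambda>i\<in>{..<n}. if i \<in> J then z' i else z i) (I l)) * G (\<lambda>i\<in>{..<n}. if i \<in> J then z' i else z i) \<partial>?Q) \<partial>?Q)"
  proof (rule integral_PiM_splice[OF P, where B = "B * B'"])
    fix z assume z: "z \<in> space ?Q"
    show "\<bar>r (\<lambda>l\<in>{..<m}. z (I l)) * G z\<bar> \<le> B * B'"
      unfolding abs_mult using r_bd[OF measurable_space[OF sel z]] G_bd[OF z] B by (intro mult_mono) auto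
  qed auto
  also have "\<dots> = (\<integral>z. 0 \<partial>?Q)"
  proof (rule Bochner_Integration.integral_cong[OF refl])
    fix z assume z: "z \<in> space ?Q"
    have x: "z (I l0) \<in> space P" using z ID(3)[OF l0] by (auto simp: space_PiM PiE_def)
    have upd [measurable]: "(\<lambda>v. v(l0 := z (I l0))) \<in> measurable ?Qm ?Qm"
      using x l0 by (intro measurable_fun_upd[where J = "{..<m}"]) auto
    have "(\<integral>z'. r (\<lambda>l\<in>{..<m}. (\<lambda>i\<in>{..<n}. if i \<in> J then z' i else z i) (I l)) * G (\<lambda>i\<in>{..<n}. if i \<in> J then z' i else z i) \<partial>?Q)
       = (\<integral>z'. r ((\<lambda>l\<in>{..<m}. z' (I l))(l0 := z (I l0))) * G z \<partial>?Q)"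
    proof (rule Bochner_Integration.integral_cong[OF refl])
      fix z' assume z': "z' \<in> space ?Q"
      have "(\<lambda>l\<in>{..<m}. (\<lambda>i\<in>{..<n}. if i \<in> J then z' i else z i) (I l)) = (\<lambda>l\<in>{..<m}. z' (I l))(l0 := z (I l0))"
        using ID l0 by (auto simp: fun_eq_iff J_def inj_on_def)
      moreover have "G (\<lambda>i\<in>{..<n}. if i \<in> J then z' i else z i) = G z"
        using z z' by (intro G_indep) (auto simp: space_PiM J_def PiE_def Pi_def)
      ultimately show "r (\<lambda>l\<in>{..<m}. (\<lambda>i\<in>{..<n}. if i \<in> J then z' i else z i) (I l)) * G (\<lambda>i\<in>{..<n}. if i \<in> J then z' i else z i)
        = r ((\<lambda>l\<in>{..<m}. z' (I l))(l0 := z (I l0))) * G z" by simp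
    qed
    also have "\<dots> = (\<integral>z'. r ((\<lambda>l\<in>{..<m}. z' (I l))(l0 := z (I l0))) \<partial>?Q) * G z"
      by simp
    also have "(\<integral>z'. r ((\<lambda>l\<in>{..<m}. z' (I l))(l0 := z (I l0))) \<partial>?Q) = (\<integral>v. r (v(l0 := z (I l0))) \<partial>distr ?Q ?Qm (\<lambda>z. \<lambda>l\<in>{..<m}. z (I l)))"
      by (rule integral_distr[OF sel, symmetric]) measurable
    also have "\<dots> = 0" unfolding selD by (rule deg[OF x])
    finally show "(\<integral>z'. r (\<lambda>l\<in>{..<m}. (\<lambda>i\<in>{..<n}. if i \<in> J then z' i else z i) (I l)) * G (\<lambda>i\<in>{..<n}. if i \<in> J then z' i else z i) \<partial>?Q) = 0"
      by (simp only: mult_zero_left)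
  qed
  finally show ?thesis by simp
qed

text \<open>
  Expand the \<open>q\<close>-th power over all \<open>q\<close>-tuples of index tuples. By \<open>integral_degenerate_eq_0\<close> a term
  vanishes unless \<open>card_letters_le\<close> applies to it, so only words of length \<open>q m\<close> with at most \<open>q m - q\<close>
  letters contribute, and \<open>sum_words_weight\<close> with \<open>u = n / (q m)\<close> bounds their number.
\<close>

lemma moment_degenerate_sum:
  fixes r :: "(nat \<Rightarrow> 'b) \<Rightarrow> real"
  assumes P: "prob_space P"
    and r: "r \<in> borel_measurable (PiM {..<m} (\<lambda>_. P))"
    and r_bd: "\<And>z. z \<in> space (PiM {..<m} (\<lambda>_. P)) \<Longrightarrow> \<bar>r z\<bar> \<le> B" and B: "0 \<le> B"
    and deg: "\<And>l x. l < m \<Longrightarrow> x \<in> space P \<Longrightarrow> (\<integral>z. r (z(l := x)) \<partial>PiM {..<m} (\<lambda>_. P)) = 0"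
    and m: "0 < m" and q: "0 < q" and n: "q * m \<le> n"
  shows "(\<integral>z. (\<Sum>I\<in>inj_tuples m n. r (\<lambda>l\<in>{..<m}. z (I l))) ^ q \<partial>PiM {..<n} (\<lambda>_. P))
    \<le> B ^ q * (2 * real n) ^ (q * m) * (real (q * m) / real n) ^ q"
proof -
  let ?Q = "PiM {..<n} (\<lambda>_. P)" and ?Qm = "PiM {..<m} (\<lambda>_. P)"
  let ?S = "{..<q} \<times> {..<m}"
  interpret PS: prob_space P by fact
  interpret Q: prob_space ?Q by (intro prob_space_PiM) (rule P)
  note [measurable] = r
  define a where "a I z = r (\<lambda>l\<in>{..<m}. z (I l))" for I :: "nat \<Rightarrow> nat" and z
  have sel [measurable]: "(\<lambda>z. \<lambda>l\<in>{..<m}. z (I l)) \<in> measurable ?Q ?Qm" if "I \<in> inj_tuples m n" for I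
    using inj_tuplesD(3)[OF that] by (intro measurable_restrict measurable_component_singleton) auto
  have a_meas [measurable]: "a I \<in> borel_measurable ?Q" if "I \<in> inj_tuples m n" for I
    using sel[OF that] unfolding a_def[abs_def] by measurable
  have a_bd: "\<bar>a I z\<bar> \<le> B" if "I \<in> inj_tuples m n" "z \<in> space ?Q" for I z
    unfolding a_def by (rule r_bd[OF measurable_space[OF sel[OF that(1)] that(2)]])
  define \<Omega> where "\<Omega> = {..<q} \<rightarrow>\<^sub>E inj_tuples m n"
  have fin: "finite \<Omega>" unfolding \<Omega>_def by (simp add: finite_PiE)
  have \<Omega>D: "w x \<in> inj_tuples m n" if "w \<in> \<Omega>" "x < q" for w x
    using that by (auto simp: \<Omega>_def PiE_def Pi_def)
  have prod_bd: "\<bar>\<Prod>x\<in>X. a (w x) z\<bar> \<le> B ^ card X" if "w \<in> \<Omega>" "z \<in> space ?Q" "X \<subseteq> {..<q}" for w z X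
  proof -
    have "\<bar>\<Prod>x\<in>X. a (w x) z\<bar> = (\<Prod>x\<in>X. \<bar>a (w x) z\<bar>)" by (rule abs_prod)
    also have "\<dots> \<le> (\<Prod>x\<in>X. B)" using that by (intro prod_mono) (auto intro!: a_bd \<Omega>D)
    finally show ?thesis by simp
  qed
  have prod_meas: "(\<lambda>z. \<Prod>x\<in>X. a (w x) z) \<in> borel_measurable ?Q" if "w \<in> \<Omega>" "X \<subseteq> {..<q}" for w X
    using that by (intro borel_measurable_prod a_meas \<Omega>D) auto
  have prod_int: "integrable ?Q (\<lambda>z. \<Prod>x<q. a (w x) z)" if "w \<in> \<Omega>" for w
    using that prod_bd[OF that] prod_meas[OF that]
    by (intro Q.integrable_const_bound[where B = "B ^ q"]) (auto intro!: AE_I2 simp: order_trans[OF prod_bd[OF that]])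
  define letters where "letters w = (\<lambda>(x, l). w x l) ` ?S" for w :: "nat \<Rightarrow> nat \<Rightarrow> nat"
  define N where "N = q * m"
  \<comment> \<open>this weight balances the two terms \<open>n\<close> and \<open>N u\<close> of the generating function\<close>
  define u where "u = real n / real N"
  have N: "0 < N" using m q by (simp add: N_def)
  have n0: "0 < n" using N n unfolding N_def by (rule less_le_trans)
  have u: "1 \<le> u" using n N by (simp add: u_def N_def flip: of_nat_mult)
  \<comment> \<open>a uniform bound: vanishing terms and those with few letters are both at most the weight\<close>
  have term_bd: "(\<integral>z. (\<Prod>x<q. a (w x) z) \<partial>?Q) \<le> B ^ q * (u ^ (N - card (letters w)) / u ^ q)" if w: "w \<in> \<Omega>" for w
  proof (cases "card (letters w) + q \<le> N")
    case True
    have "(\<integral>z. (\<Prod>x<q. a (w x) z) \<partial>?Q) \<le> (\<integral>z. B ^ q \<partial>?Q)"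
      using prod_bd[OF w _ subset_refl] by (intro integral_mono prod_int w) (auto simp: abs_le_iff)
    also have "\<dots> = B ^ q * 1" by (simp add: Q.prob_space)
    also have "\<dots> \<le> B ^ q * (u ^ (N - card (letters w)) / u ^ q)"
    proof (intro mult_left_mono)
      have "u ^ q \<le> u ^ (N - card (letters w))" using True u by (intro power_increasing) auto
      then show "1 \<le> u ^ (N - card (letters w)) / u ^ q" using u by (simp add: le_divide_eq)
    qed (use B in simp)
    finally show ?thesis .
  next
    case False
    have "\<not> (\<forall>x l0. x < q \<longrightarrow> l0 < m \<longrightarrow> (\<exists>l<m. l \<noteq> l0 \<and> (\<exists>x'<q. x' \<noteq> x \<and> w x l \<in> w x' ` {..<m})))"
    proof
      assume all: "\<forall>x l0. x < q \<longrightarrow> l0 < m \<longrightarrow> (\<exists>l<m. l \<noteq> l0 \<and> (\<exists>x'<q. x' \<noteq> x \<and> w x l \<in> w x' ` {..<m}))"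
      have "card (letters w) + q \<le> N"
        unfolding letters_def N_def
        by (rule card_letters_le[OF _ _ m]) (use all inj_tuplesD(2)[OF \<Omega>D[OF w]] in auto)
      with False show False ..
    qed
    then obtain x l0 where x: "x < q" and l0: "l0 < m"
      and no: "\<And>l x'. l < m \<Longrightarrow> l \<noteq> l0 \<Longrightarrow> x' < q \<Longrightarrow> x' \<noteq> x \<Longrightarrow> w x l \<notin> w x' ` {..<m}" by blast
    have "(\<integral>z. (\<Prod>x<q. a (w x) z) \<partial>?Q) = (\<integral>z. r (\<lambda>l\<in>{..<m}. z (w x l)) * (\<Prod>x'\<in>{..<q} - {x}. a (w x') z) \<partial>?Q)"
      using x by (subst prod.remove[of "{..<q}" x]) (auto simp: a_def)
    also have "\<dots> = 0"
    proof (rule integral_degenerate_eq_0[OF P r r_bd deg[OF l0] \<Omega>D[OF w x] l0])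
      show "(\<lambda>z. \<Prod>x'\<in>{..<q} - {x}. a (w x') z) \<in> borel_measurable ?Q" by (rule prod_meas[OF w]) auto
      show "\<bar>\<Prod>x'\<in>{..<q} - {x}. a (w x') z\<bar> \<le> B ^ card ({..<q} - {x})" if "z \<in> space ?Q" for z
        by (rule prod_bd[OF w that]) auto
      fix z z' :: "nat \<Rightarrow> 'b"
      assume eq: "\<And>i. i < n \<Longrightarrow> i \<notin> w x ` ({..<m} - {l0}) \<Longrightarrow> z i = z' i"
      show "(\<Prod>x'\<in>{..<q} - {x}. a (w x') z) = (\<Prod>x'\<in>{..<q} - {x}. a (w x') z')"
      proof (rule prod.cong[OF refl])
        fix x' assume x': "x' \<in> {..<q} - {x}"
        have "z (w x' l) = z' (w x' l)" if l: "l < m" for l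
        proof (rule eq)
          show "w x' l < n" using inj_tuplesD(3)[OF \<Omega>D[OF w]] x' l by auto
          show "w x' l \<notin> w x ` ({..<m} - {l0})" 
          proof
            assume "w x' l \<in> w x ` ({..<m} - {l0})"
            then obtain l' where eq: "w x' l = w x l'" and l': "l' \<in> {..<m} - {l0}" by (rule imageE)
            have "w x l' \<notin> w x' ` {..<m}" using x' l' by (intro no) auto
            then show False unfolding eq[symmetric] using l by simp
          qed
        qed
        then have "(\<lambda>l\<in>{..<m}. z (w x' l)) = (\<lambda>l\<in>{..<m}. z' (w x' l))" by auto
        then show "a (w x') z = a (w x') z'" by (simp add: a_def)
      qed
    qed auto
    also have "0 \<le> B ^ q * (u ^ (N - card (letters w)) / u ^ q)" using B u by simp
    finally show ?thesis .
  qed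
  have words: "(\<Sum>w\<in>\<Omega>. u ^ (N - card (letters w))) \<le> (2 * real n) ^ N"
  proof -
    define \<iota> where "\<iota> w = (\<lambda>s\<in>?S. case s of (x, l) \<Rightarrow> w x l)" for w :: "nat \<Rightarrow> nat \<Rightarrow> nat"
    have inj: "inj_on \<iota> \<Omega>"
    proof (rule inj_onI)
      fix w w' assume w: "w \<in> \<Omega>" "w' \<in> \<Omega>" and eq: "\<iota> w = \<iota> w'"
      have "w x l = w' x l" if "x < q" "l < m" for x l
        using fun_cong[OF eq, of "(x, l)"] that by (simp add: \<iota>_def)
      then have weq: "w x = w' x" if "x < q" for x
        using inj_tuplesD(1)[OF \<Omega>D[OF w(1) that]] inj_tuplesD(1)[OF \<Omega>D[OF w(2) that]] that
        by (intro PiE_ext[where k = "{..<m}"]) auto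
      show "w = w'" by (rule PiE_ext[OF w(1)[unfolded \<Omega>_def] w(2)[unfolded \<Omega>_def]]) (simp add: weq)
    qed
    have mem: "\<iota> ` \<Omega> \<subseteq> ?S \<rightarrow>\<^sub>E {..<n}"
      unfolding \<iota>_def using inj_tuplesD(3)[OF \<Omega>D]
      by (intro image_subsetI restrict_PiE_iff[THEN iffD2]) auto
    have let_eq: "letters w = \<iota> w ` ?S" for w
      unfolding letters_def \<iota>_def by (intro image_cong) auto
    have "(\<Sum>w\<in>\<Omega>. u ^ (N - card (letters w))) = (\<Sum>W\<in>\<iota> ` \<Omega>. u ^ (card ?S - card (W ` ?S)))"
      using inj by (simp add: sum.reindex let_eq N_def)
    also have "\<dots> \<le> (\<Sum>W\<in>?S \<rightarrow>\<^sub>E {..<n}. u ^ (card ?S - card (W ` ?S)))"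
      using u mem by (intro sum_mono2) (auto intro!: finite_PiE)
    also have "\<dots> \<le> (real n + real (card ?S) * u) ^ card ?S"
      using u by (intro sum_words_weight) auto
    also have "\<dots> = (2 * real n) ^ N" using N by (simp add: u_def N_def)
    finally show ?thesis .
  qed
  have "(\<integral>z. (\<Sum>I\<in>inj_tuples m n. r (\<lambda>l\<in>{..<m}. z (I l))) ^ q \<partial>?Q) = (\<integral>z. (\<Sum>w\<in>\<Omega>. \<Prod>x<q. a (w x) z) \<partial>?Q)"
  proof (rule Bochner_Integration.integral_cong[OF refl])
    fix z
    have "(\<Sum>I\<in>inj_tuples m n. a I z) ^ q = (\<Prod>x<q. \<Sum>I\<in>inj_tuples m n. a I z)" by simp
    also have "\<dots> = (\<Sum>w\<in>\<Omega>. \<Prod>x<q. a (w x) z)" unfolding \<Omega>_def by (rule prod_sum_PiE) auto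
    finally show "(\<Sum>I\<in>inj_tuples m n. r (\<lambda>l\<in>{..<m}. z (I l))) ^ q = (\<Sum>w\<in>\<Omega>. \<Prod>x<q. a (w x) z)"
      by (simp add: a_def)
  qed
  also have "\<dots> = (\<Sum>w\<in>\<Omega>. \<integral>z. (\<Prod>x<q. a (w x) z) \<partial>?Q)"
    by (rule Bochner_Integration.integral_sum) (rule prod_int)
  also have "\<dots> \<le> (\<Sum>w\<in>\<Omega>. B ^ q * (u ^ (N - card (letters w)) / u ^ q))"
    by (intro sum_mono term_bd)
  also have "\<dots> = B ^ q * (\<Sum>w\<in>\<Omega>. u ^ (N - card (letters w))) / u ^ q"
    by (simp add: sum_distrib_left sum_divide_distrib)
  also have "\<dots> \<le> B ^ q * (2 * real n) ^ N / u ^ q"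
    using words B u by (intro divide_right_mono mult_left_mono) auto
  also have "\<dots> = B ^ q * (2 * real n) ^ (q * m) * (real (q * m) / real n) ^ q"
    using N n0 by (simp add: u_def N_def power_divide)
  finally show ?thesis .
qed

section \<open>Hoeffding decomposition of a U-statistic\<close>

lemma (in prob_space) abs_integral_le_const:
  fixes f :: "'a \<Rightarrow> real"
  assumes "\<And>x. x \<in> space M \<Longrightarrow> \<bar>f x\<bar> \<le> B"
  shows "\<bar>\<integral>x. f x \<partial>M\<bar> \<le> B"
proof (cases "integrable M f")
  case True
  have "\<bar>\<integral>x. f x \<partial>M\<bar> \<le> (\<integral>x. \<bar>f x\<bar> \<partial>M)" by (rule integral_abs_bound)
  also have "\<dots> \<le> (\<integral>x. B \<partial>M)" using assms True by (intro integral_mono) auto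
  finally show ?thesis by (simp add: prob_space)
next
  case False
  obtain x where "x \<in> space M" using not_empty by blast
  with assms[OF this] have "0 \<le> B" by (meson abs_ge_zero order_trans)
  with False show ?thesis by (simp add: not_integrable_integral_eq)
qed

lemma ustat_inj_tuples:
  "ustat m h n z = (\<Sum>I\<in>inj_tuples m n. h (\<lambda>l\<in>{..<m}. z (I l))) / real (card (inj_tuples m n))"
  unfolding ustat_def card_inj_tuples by (simp add: inj_tuples_def)

locale bounded_kernel = prob_space P
  for P :: "(real \<times> real) measure" +
  fixes m :: nat and h :: kernel and B :: real
  assumes m: "0 < m"
    and h_meas [measurable]: "h \<in> borel_measurable (PiM {..<m} (\<lambda>_. P))"
    and h_bd: "\<And>z. z \<in> space (PiM {..<m} (\<lambda>_. P)) \<Longrightarrow> \<bar>h z\<bar> \<le> B"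
begin

abbreviation Q :: "nat \<Rightarrow> (nat \<Rightarrow> real \<times> real) measure" where
  "Q n \<equiv> PiM {..<n} (\<lambda>_. P)"

definition theta :: real where "theta = (\<integral>z. h z \<partial>Q m)"

text \<open>
  The conditional expectation of the kernel given its \<open>l\<close>-th argument. The kernel need not be
  symmetric, so there is one such function for every \<open>l\<close>.
\<close>

definition proj :: "nat \<Rightarrow> real \<times> real \<Rightarrow> real" where
  "proj l x = (\<integral>z. h (z(l := x)) \<partial>Q m)"

text \<open>
  The summand of the i.i.d. part: \<open>m\<close> times the centred first projection of the symmetrised kernel.
\<close>

definition hajek :: "real \<times> real \<Rightarrow> real" where
  "hajek x = (\<Sum>l<m. proj l x - theta)"

definition remainder :: kernel where
  "remainder z = h z - theta - (\<Sum>l<m. proj l (z l) - theta)"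

lemma Q_prob: "prob_space (Q n)"
  by (intro prob_space_PiM) (rule prob_space_axioms)

lemma B_nonneg: "0 \<le> B"
proof -
  interpret Qm: prob_space "Q m" by (rule Q_prob)
  obtain z where "z \<in> space (Q m)" using Qm.not_empty by blast
  with h_bd[OF this] show ?thesis by (meson abs_ge_zero order_trans)
qed

lemma upd_meas [measurable]: "l < m \<Longrightarrow> (\<lambda>(x, z). z(l := x)) \<in> measurable (P \<Otimes>\<^sub>M Q m) (Q m)"
  unfolding split_beta by (intro measurable_fun_upd[where J = "{..<m}"]) auto

lemma upd_meas1: "l < m \<Longrightarrow> x \<in> space P \<Longrightarrow> (\<lambda>z. z(l := x)) \<in> measurable (Q m) (Q m)"
  by (intro measurable_fun_upd[where J = "{..<m}"]) auto

lemma proj_meas [measurable]: "l < m \<Longrightarrow> proj l \<in> borel_measurable P"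
proof -
  assume l: "l < m"
  interpret Qm: prob_space "Q m" by (rule Q_prob)
  have "(\<lambda>p. h ((\<lambda>(x, z). z(l := x)) p)) \<in> borel_measurable (P \<Otimes>\<^sub>M Q m)"
    using upd_meas[OF l] by measurable
  then show ?thesis
    unfolding proj_def[abs_def] by (intro Qm.borel_measurable_lebesgue_integral) (simp add: split_beta)
qed

lemma proj_bd: "l < m \<Longrightarrow> x \<in> space P \<Longrightarrow> \<bar>proj l x\<bar> \<le> B"
proof -
  assume l: "l < m" and x: "x \<in> space P"
  interpret Qm: prob_space "Q m" by (rule Q_prob)
  show ?thesis unfolding proj_def
    using h_bd[OF measurable_space[OF upd_meas1[OF l x]]] by (intro Qm.abs_integral_le_const) auto
qed

lemma theta_bd: "\<bar>theta\<bar> \<le> B"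
proof -
  interpret Qm: prob_space "Q m" by (rule Q_prob)
  show ?thesis unfolding theta_def using h_bd by (intro Qm.abs_integral_le_const) auto
qed

lemma integral_component:
  assumes "\<phi> \<in> borel_measurable P" "l < n"
  shows "(\<integral>z. \<phi> (z l) \<partial>Q n) = (\<integral>x. \<phi> x \<partial>P :: real)"
proof -
  have "(\<integral>x. \<phi> x \<partial>P) = (\<integral>x. \<phi> x \<partial>distr (Q n) P (\<lambda>z. z l))"
    using assms by (subst distr_PiM_component) (auto intro: prob_space_axioms)
  also have "\<dots> = (\<integral>z. \<phi> (z l) \<partial>Q n)" using assms by (intro integral_distr) auto
  finally show ?thesis by simp
qed

lemma proj_mean: "l < m \<Longrightarrow> (\<integral>x. proj l x \<partial>P) = theta"
proof -
  assume l: "l < m"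
  have "theta = (\<integral>z. (\<integral>z'. h (\<lambda>i\<in>{..<m}. if i \<in> {..<m} - {l} then z' i else z i) \<partial>Q m) \<partial>Q m)"
    unfolding theta_def using h_bd by (intro integral_PiM_splice) (auto intro: prob_space_axioms)
  also have "\<dots> = (\<integral>z. proj l (z l) \<partial>Q m)"
    unfolding proj_def
  proof (intro Bochner_Integration.integral_cong refl arg_cong[where f = h])
    fix z z' assume "z \<in> space (Q m)" "z' \<in> space (Q m)"
    then show "(\<lambda>i\<in>{..<m}. if i \<in> {..<m} - {l} then z' i else z i) = z'(l := z l)"
      using l by (auto simp: space_PiM PiE_def extensional_def fun_eq_iff)
  qed
  also have "\<dots> = (\<integral>x. proj l x \<partial>P)" using l by (intro integral_component proj_meas)
  finally show ?thesis by simp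
qed

lemma proj_integrable: "l < m \<Longrightarrow> integrable P (proj l)"
  using proj_bd by (intro integrable_const_bound[where B = B]) auto

lemma hajek_meas [measurable]: "hajek \<in> borel_measurable P"
  unfolding hajek_def[abs_def] by (intro borel_measurable_sum borel_measurable_diff proj_meas) auto

lemma hajek_bd: "x \<in> space P \<Longrightarrow> \<bar>hajek x\<bar> \<le> real m * (2 * B)"
proof -
  assume x: "x \<in> space P"
  have "\<bar>hajek x\<bar> \<le> (\<Sum>l<m. \<bar>proj l x - theta\<bar>)" unfolding hajek_def by (rule sum_abs)
  also have "\<dots> \<le> (\<Sum>l<m. 2 * B)"
  proof (rule sum_mono)
    fix l assume "l \<in> {..<m}"
    then show "\<bar>proj l x - theta\<bar> \<le> 2 * B" using proj_bd[of l x] theta_bd x by simp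
  qed
  finally show ?thesis by simp
qed

lemma hajek_mean: "(\<integral>x. hajek x \<partial>P) = 0"
  unfolding hajek_def
  by (subst Bochner_Integration.integral_sum) (auto simp: proj_integrable proj_mean prob_space)

lemma remainder_meas [measurable]: "remainder \<in> borel_measurable (Q m)"
  unfolding remainder_def[abs_def]
  by (intro borel_measurable_sum borel_measurable_diff h_meas measurable_compose[OF _ proj_meas]) auto

lemma remainder_bd: "z \<in> space (Q m) \<Longrightarrow> \<bar>remainder z\<bar> \<le> (2 + 2 * real m) * B"
proof -
  assume z: "z \<in> space (Q m)"
  have zs: "z l \<in> space P" if "l < m" for l using z that by (auto simp: space_PiM PiE_def)
  have "\<bar>\<Sum>l<m. proj l (z l) - theta\<bar> \<le> (\<Sum>l<m. \<bar>proj l (z l) - theta\<bar>)" by (rule sum_abs)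
  also have "\<dots> \<le> (\<Sum>l<m. 2 * B)"
  proof (rule sum_mono)
    fix l assume "l \<in> {..<m}"
    then show "\<bar>proj l (z l) - theta\<bar> \<le> 2 * B" using proj_bd[of l "z l"] theta_bd zs by simp
  qed
  finally have "\<bar>\<Sum>l<m. proj l (z l) - theta\<bar> \<le> real m * (2 * B)" by simp
  moreover have "\<bar>remainder z\<bar> \<le> \<bar>h z\<bar> + \<bar>theta\<bar> + \<bar>\<Sum>l<m. proj l (z l) - theta\<bar>"
    unfolding remainder_def by linarith
  ultimately show ?thesis using h_bd[OF z] theta_bd by (simp add: algebra_simps)
qed

lemma remainder_degenerate:
  assumes l: "l < m" and x: "x \<in> space P"
  shows "(\<integral>z. remainder (z(l := x)) \<partial>Q m) = 0"
proof -
  interpret Qm: prob_space "Q m" by (rule Q_prob)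
  have i1: "integrable (Q m) (\<lambda>z. h (z(l := x)))"
    using h_bd[OF measurable_space[OF upd_meas1[OF l x]]] measurable_compose[OF upd_meas1[OF l x] h_meas]
    by (intro Qm.integrable_const_bound[where B = B]) auto
  have i2: "integrable (Q m) (\<lambda>z. proj l' (z l') - theta)" if l': "l' < m" for l'
  proof (intro Bochner_Integration.integrable_diff)
    show "integrable (Q m) (\<lambda>z. proj l' (z l'))"
    proof (rule Qm.integrable_const_bound[where B = B])
      show "(\<lambda>z. proj l' (z l')) \<in> borel_measurable (Q m)"
        using l' by (intro measurable_compose[OF _ proj_meas]) auto
      show "AE z in Q m. norm (proj l' (z l')) \<le> B"
      proof (rule AE_I2)
        fix z assume "z \<in> space (Q m)"
        then have "z l' \<in> space P" using l' by (auto simp: space_PiM PiE_def)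
        then show "norm (proj l' (z l')) \<le> B" using proj_bd[OF l'] by simp
      qed
    qed
  qed simp
  have eq: "remainder (z(l := x)) = h (z(l := x)) - (\<Sum>l'\<in>{..<m} - {l}. proj l' (z l') - theta) - proj l x" for z
    unfolding remainder_def using l by (subst sum.remove[of "{..<m}" l]) auto
  have iS: "integrable (Q m) (\<lambda>z. \<Sum>l'\<in>{..<m} - {l}. proj l' (z l') - theta)"
    by (intro Bochner_Integration.integrable_sum i2) auto
  have eS: "(\<integral>z. (\<Sum>l'\<in>{..<m} - {l}. proj l' (z l') - theta) \<partial>Q m) = (\<Sum>l'\<in>{..<m} - {l}. (\<integral>z. proj l' (z l') - theta \<partial>Q m))"
    by (intro Bochner_Integration.integral_sum i2) auto
  have z: "(\<integral>z. proj l' (z l') - theta \<partial>Q m) = 0" if l': "l' < m" for l'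
    using integral_component[of "\<lambda>x. proj l' x - theta" l' m] l' proj_mean[OF l'] proj_integrable[OF l']
    by (simp add: proj_meas prob_space)
  have "(\<integral>z. remainder (z(l := x)) \<partial>Q m) = (\<integral>z. h (z(l := x)) \<partial>Q m) - (\<Sum>l'\<in>{..<m} - {l}. (\<integral>z. proj l' (z l') - theta \<partial>Q m)) - proj l x"
    unfolding eq eS[symmetric]
    by (subst Bochner_Integration.integral_diff[OF Bochner_Integration.integrable_diff[OF i1 iS]])
       (auto simp: Bochner_Integration.integral_diff[OF i1 iS] Qm.prob_space)
  also have "\<dots> = 0" using z by (simp add: proj_def)
  finally show ?thesis .
qed

lemma card_inj_tuples_pos: "m \<le> n \<Longrightarrow> 0 < real (card (inj_tuples m n))"
  unfolding card_inj_tuples by (intro prod_pos) auto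

text \<open>
  Each observation appears equally often in each slot of the tuples, so the linear terms add up to an
  i.i.d. sum; \<open>ustat m remainder n z\<close> is what is left.
\<close>

lemma ustat_hoeffding:
  assumes n: "m \<le> n"
  shows "ustat m h n z = theta + (\<Sum>i<n. hajek (z i)) / real n + ustat m remainder n z"
proof -
  let ?T = "inj_tuples m n"
  have c: "0 < real (card ?T)" by (rule card_inj_tuples_pos[OF n])
  have n0: "0 < n" using m n by simp
  have dec: "h (\<lambda>l\<in>{..<m}. z (I l)) = theta + (\<Sum>l<m. proj l (z (I l)) - theta) + remainder (\<lambda>l\<in>{..<m}. z (I l))" for I
    by (simp add: remainder_def)
  have "(\<Sum>I\<in>?T. \<Sum>l<m. proj l (z (I l)) - theta) = (\<Sum>l<m. \<Sum>I\<in>?T. proj l (z (I l)) - theta)"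
    by (rule sum.swap)
  also have "\<dots> = (\<Sum>l<m. real (card ?T) * (\<Sum>i<n. proj l (z i) - theta) / real n)"
  proof (rule sum.cong[OF refl])
    fix l assume "l \<in> {..<m}"
    then have "real n * (\<Sum>I\<in>?T. proj l (z (I l)) - theta) = real (card ?T) * (\<Sum>i<n. proj l (z i) - theta)"
      by (intro sum_inj_tuples_component) auto
    then show "(\<Sum>I\<in>?T. proj l (z (I l)) - theta) = real (card ?T) * (\<Sum>i<n. proj l (z i) - theta) / real n"
      using n0 by (simp add: field_simps)
  qed
  also have "\<dots> = real (card ?T) * ((\<Sum>l<m. \<Sum>i<n. proj l (z i) - theta) / real n)"
    by (simp only: sum_distrib_left sum_divide_distrib times_divide_eq_right)
  also have "(\<Sum>l<m. \<Sum>i<n. proj l (z i) - theta) = (\<Sum>i<n. hajek (z i))"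
    unfolding hajek_def by (rule sum.swap)
  finally have A: "(\<Sum>I\<in>?T. \<Sum>l<m. proj l (z (I l)) - theta) = real (card ?T) * ((\<Sum>i<n. hajek (z i)) / real n)" .
  show ?thesis
    unfolding ustat_inj_tuples dec sum.distrib A using c by (simp add: add_divide_distrib card_gt_0_iff)
qed

lemma sel_meas: "I \<in> inj_tuples m n \<Longrightarrow> (\<lambda>z. \<lambda>l\<in>{..<m}. z (I l)) \<in> measurable (Q n) (Q m)"
  using inj_tuplesD(3) by (intro measurable_restrict measurable_component_singleton) auto

lemma sel_distr: "I \<in> inj_tuples m n \<Longrightarrow> distr (Q n) (Q m) (\<lambda>z. \<lambda>l\<in>{..<m}. z (I l)) = Q m"
  using inj_tuplesD by (intro distr_PiM_reindex prob_space_axioms) auto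

lemma ustat_meas: "f \<in> borel_measurable (Q m) \<Longrightarrow> ustat m f n \<in> borel_measurable (Q n)"
  unfolding ustat_inj_tuples[abs_def]
  by (intro borel_measurable_divide borel_measurable_sum borel_measurable_const measurable_compose[OF sel_meas]) auto

lemma ustat_bd:
  assumes f: "\<And>z. z \<in> space (Q m) \<Longrightarrow> \<bar>f z\<bar> \<le> C" and n: "m \<le> n" and z: "z \<in> space (Q n)"
  shows "\<bar>ustat m f n z\<bar> \<le> C"
proof -
  have "\<bar>\<Sum>I\<in>inj_tuples m n. f (\<lambda>l\<in>{..<m}. z (I l))\<bar> \<le> (\<Sum>I\<in>inj_tuples m n. \<bar>f (\<lambda>l\<in>{..<m}. z (I l))\<bar>)"
    by (rule sum_abs)
  also have "\<dots> \<le> (\<Sum>I\<in>inj_tuples m n. C)"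
    by (intro sum_mono f measurable_space[OF sel_meas z])
  finally show ?thesis
    unfolding ustat_inj_tuples using card_inj_tuples_pos[OF n] by (simp add: abs_divide divide_le_eq mult.commute)
qed

lemma ustat_mean:
  assumes f: "f \<in> borel_measurable (Q m)" "\<And>z. z \<in> space (Q m) \<Longrightarrow> \<bar>f z\<bar> \<le> C" and n: "m \<le> n"
  shows "(\<integral>z. ustat m f n z \<partial>Q n) = (\<integral>z. f z \<partial>Q m)"
proof -
  interpret Qn: prob_space "Q n" by (rule Q_prob)
  have i: "integrable (Q n) (\<lambda>z. f (\<lambda>l\<in>{..<m}. z (I l)))" if I: "I \<in> inj_tuples m n" for I
    using f(2)[OF measurable_space[OF sel_meas[OF I]]] measurable_compose[OF sel_meas[OF I] f(1)]
    by (intro Qn.integrable_const_bound[where B = C]) auto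
  have e: "(\<integral>z. f (\<lambda>l\<in>{..<m}. z (I l)) \<partial>Q n) = (\<integral>z. f z \<partial>Q m)" if I: "I \<in> inj_tuples m n" for I
  proof -
    have "(\<integral>z. f z \<partial>distr (Q n) (Q m) (\<lambda>z. \<lambda>l\<in>{..<m}. z (I l))) = (\<integral>z. f (\<lambda>l\<in>{..<m}. z (I l)) \<partial>Q n)"
      by (rule integral_distr[OF sel_meas[OF I] f(1)])
    then show ?thesis unfolding sel_distr[OF I] by simp
  qed
  show ?thesis
    unfolding ustat_inj_tuples using card_inj_tuples_pos[OF n] i e
    by (simp add: card_gt_0_iff)
qed

lemma ustat_h_mean: "m \<le> n \<Longrightarrow> (\<integral>z. ustat m h n z \<partial>Q n) = theta"
  unfolding theta_def using h_bd by (rule ustat_mean[OF h_meas])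

text \<open>
  The kernel \<open>remainder\<close> is bounded by \<open>(2 + 2 m) B\<close>. The factor \<open>4 ^ m\<close> combines the \<open>2 ^ m\<close> from
  \<open>moment_degenerate_sum\<close> and another \<open>2 ^ m\<close> from the number of tuples, which is at least
  \<open>(n / 2) ^ m\<close>.
\<close>

definition C_rem :: real where "C_rem = (2 + 2 * real m) * B * 4 ^ m * real m"

lemma C_rem_nonneg: "0 \<le> C_rem"
  unfolding C_rem_def using B_nonneg by simp

text \<open>
  The remainder is thus of order \<open>1 / n\<close> with moments that grow like those of an exponential variable, whereas the i.i.d.
  part is of order \<open>1 / \<surd>n\<close>.
\<close>

lemma remainder_moment:
  assumes q: "0 < q" and n: "q * m \<le> n" "2 * m \<le> n"
  shows "(\<integral>z. (ustat m remainder n z) ^ q \<partial>Q n) \<le> (C_rem * real q / real n) ^ q"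
proof -
  let ?c = "real (card (inj_tuples m n))" and ?Br = "(2 + 2 * real m) * B"
  have n0: "0 < real n" using n m by linarith
  have mn: "m \<le> n" using n by simp
  have Br: "0 \<le> ?Br" using B_nonneg by simp
  have c: "(real n / 2) ^ m \<le> ?c"
  proof -
    have "(real n / 2) ^ m = (\<Prod>l<m. real n / 2)" by simp
    also have "\<dots> \<le> (\<Prod>l<m. real n - real l)"
    proof (intro prod_mono conjI)
      fix l assume "l \<in> {..<m}"
      then have "2 * l \<le> n" using n by simp
      then have "2 * real l \<le> real n" by linarith
      then show "real n / 2 \<le> real n - real l" by simp
    qed simp
    finally show ?thesis by (simp add: card_inj_tuples)
  qed
  have "(\<integral>z. (ustat m remainder n z) ^ q \<partial>Q n)
      = (\<integral>z. (\<Sum>I\<in>inj_tuples m n. remainder (\<lambda>l\<in>{..<m}. z (I l))) ^ q \<partial>Q n) / ?c ^ q"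
    unfolding ustat_inj_tuples by (simp add: power_divide)
  also have "\<dots> \<le> (?Br ^ q * (2 * real n) ^ (q * m) * (real (q * m) / real n) ^ q) / ?c ^ q"
    by (rule divide_right_mono[OF moment_degenerate_sum[OF prob_space_axioms remainder_meas remainder_bd Br remainder_degenerate m q n(1)]]) auto
  also have "\<dots> \<le> (?Br ^ q * (2 * real n) ^ (q * m) * (real (q * m) / real n) ^ q) / ((real n / 2) ^ m) ^ q"
    using c n0 Br card_inj_tuples_pos[OF mn] by (intro divide_left_mono power_mono) auto
  also have "\<dots> = (?Br * (2 * real n) ^ m * (real (q * m) / real n) / (real n / 2) ^ m) ^ q"
  proof -
    have a: "(2 * real n) ^ (q * m) = ((2 * real n) ^ m) ^ q"
      unfolding mult.commute[of q m] by (rule power_mult)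
    have "x ^ q * y ^ q * v ^ q / w ^ q = (x * y * v / w) ^ q" for x y v w :: real
      by (simp add: power_mult_distrib power_divide)
    then show ?thesis unfolding a .
  qed
  also have "\<dots> = (C_rem * real q / real n) ^ q"
  proof (rule arg_cong[where f = "\<lambda>x. x ^ q"])
    have "(2 * real n) ^ m = (4 * (real n / 2)) ^ m" by simp
    then have "(2 * real n) ^ m = 4 ^ m * (real n / 2) ^ m" by (simp only: power_mult_distrib)
    then show "?Br * (2 * real n) ^ m * (real (q * m) / real n) / (real n / 2) ^ m = C_rem * real q / real n"
      using n0 by (simp add: C_rem_def)
  qed
  finally show ?thesis .
qed

definition zeta :: real where "zeta = (\<integral>x. (hajek x)\<^sup>2 \<partial>P)"

lemma hajek_integrable: "integrable P hajek" "integrable P (\<lambda>x. (hajek x)\<^sup>2)"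
proof -
  show "integrable P hajek"
    using hajek_bd by (intro integrable_const_bound[where B = "real m * (2 * B)"]) auto
  show "integrable P (\<lambda>x. (hajek x)\<^sup>2)"
    using hajek_bd by (intro integrable_const_bound[where B = "(real m * (2 * B))\<^sup>2"]) (auto simp: abs_le_square_iff[symmetric] abs_mult B_nonneg intro!: AE_I2)
qed

lemma hajek_cov:
  assumes ij: "i < n" "j < n" "i \<noteq> j"
  shows "(\<integral>z. hajek (z i) * hajek (z j) \<partial>Q n) = 0"
proof -
  interpret PP: product_prob_space "\<lambda>_::nat. P" by unfold_locales
  define f where "f k = (\<lambda>x. if k = i \<or> k = j then hajek x else 1)" for k :: nat
  have f: "integrable P (f k)" for k by (cases "k = i \<or> k = j") (auto simp: f_def hajek_integrable)
  have pair: "(\<Prod>k<n. f k (z k)) = hajek (z i) * hajek (z j)" for z :: "nat \<Rightarrow> real \<times> real"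
  proof -
    have "(\<Prod>k<n. f k (z k)) = (\<Prod>k\<in>{i, j}. f k (z k))"
      using ij by (intro prod.mono_neutral_right) (auto simp: f_def)
    then show ?thesis using ij by (simp add: f_def)
  qed
  have "(\<integral>z. hajek (z i) * hajek (z j) \<partial>Q n) = (\<integral>z. (\<Prod>k<n. f k (z k)) \<partial>Q n)"
    by (simp only: pair)
  also have "\<dots> = (\<Prod>k<n. \<integral>x. f k x \<partial>P)"
    by (rule PP.product_integral_prod) (auto intro: f)
  also have "\<dots> = 0"
    using ij by (intro prod_zero) (auto simp: f_def hajek_mean intro!: bexI[of _ i])
  finally show ?thesis .
qed

lemma hajek_sum_second_moment: "(\<integral>z. (\<Sum>i<n. hajek (z i))\<^sup>2 \<partial>Q n) = real n * zeta"
proof -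
  interpret Qn: prob_space "Q n" by (rule Q_prob)
  have zs: "z i \<in> space P" if "i < n" "z \<in> space (Q n)" for i z using that by (auto simp: space_PiM PiE_def)
  have i: "integrable (Q n) (\<lambda>z. hajek (z i) * hajek (z j))" if "i < n" "j < n" for i j
  proof (rule Qn.integrable_const_bound[where B = "(real m * (2 * B)) * (real m * (2 * B))"])
    show "AE z in Q n. norm (hajek (z i) * hajek (z j)) \<le> (real m * (2 * B)) * (real m * (2 * B))"
    proof (rule AE_I2)
      fix z assume z: "z \<in> space (Q n)"
      have "\<bar>hajek (z i)\<bar> * \<bar>hajek (z j)\<bar> \<le> (real m * (2 * B)) * (real m * (2 * B))"
        using that zs[OF _ z] B_nonneg by (intro mult_mono hajek_bd) auto
      then show "norm (hajek (z i) * hajek (z j)) \<le> (real m * (2 * B)) * (real m * (2 * B))"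
        by (simp only: real_norm_def abs_mult)
    qed
    show "(\<lambda>z. hajek (z i) * hajek (z j)) \<in> borel_measurable (Q n)"
      using that by (intro borel_measurable_times measurable_compose[OF _ hajek_meas]) auto
  qed
  have "(\<integral>z. (\<Sum>i<n. hajek (z i))\<^sup>2 \<partial>Q n) = (\<integral>z. (\<Sum>i<n. \<Sum>j<n. hajek (z i) * hajek (z j)) \<partial>Q n)"
    by (simp add: power2_eq_square sum_product)
  also have "\<dots> = (\<Sum>i<n. \<Sum>j<n. \<integral>z. hajek (z i) * hajek (z j) \<partial>Q n)"
    using i by (subst Bochner_Integration.integral_sum) (auto intro!: Bochner_Integration.integrable_sum sum.cong Bochner_Integration.integral_sum)
  also have "\<dots> = (\<Sum>i<n. \<Sum>j<n. if i = j then zeta else 0)"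
  proof (intro sum.cong refl)
    fix i j assume ij: "i \<in> {..<n}" "j \<in> {..<n}"
    show "(\<integral>z. hajek (z i) * hajek (z j) \<partial>Q n) = (if i = j then zeta else 0)"
    proof (cases "i = j")
      case True
      have "(\<integral>z. (hajek (z i))\<^sup>2 \<partial>Q n) = zeta"
        unfolding zeta_def using ij by (intro integral_component[of "\<lambda>x. (hajek x)\<^sup>2"]) auto
      then show ?thesis using True by (simp add: power2_eq_square)
    qed (use ij hajek_cov in auto)
  qed
  also have "\<dots> = real n * zeta" by simp
  finally show ?thesis .
qed

definition uvar :: "nat \<Rightarrow> real" where
  "uvar n = (\<integral>z. (ustat m h n z - theta)\<^sup>2 \<partial>Q n)"

text \<open>
  The cross term is controlled by \<open>2 \<bar>L R\<bar> \<le> L\<^sup>2 / \<surd>n + \<surd>n R\<^sup>2\<close>, which suffices because only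
  \<open>t\<^sup>2 (n uvar n - zeta) \<rightarrow> 0\<close> is needed later on.
\<close>

lemma uvar_approx:
  assumes n: "2 * m \<le> n"
  shows "\<bar>real n * uvar n - zeta\<bar> \<le> (zeta + 8 * C_rem\<^sup>2) / sqrt (real n)"
proof -
  interpret Qn: prob_space "Q n" by (rule Q_prob)
  have mn: "m \<le> n" and n0: "0 < n" using n m by auto
  have zs: "z i \<in> space P" if "i < n" "z \<in> space (Q n)" for i z using that by (auto simp: space_PiM PiE_def)
  define L where "L z = (\<Sum>i<n. hajek (z i)) / real n" for z :: "nat \<Rightarrow> real \<times> real"
  define R where "R = ustat m remainder n"
  define s where "s = sqrt (real n)"
  have s: "1 \<le> s" "s * s = real n" using n0 by (auto simp: s_def)
  have L_meas [measurable]: "L \<in> borel_measurable (Q n)"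
    unfolding L_def[abs_def] by (intro borel_measurable_divide borel_measurable_sum measurable_compose[OF _ hajek_meas]) auto
  have R_meas [measurable]: "R \<in> borel_measurable (Q n)" unfolding R_def by (rule ustat_meas[OF remainder_meas])
  have R_bd: "\<bar>R z\<bar> \<le> (2 + 2 * real m) * B" if "z \<in> space (Q n)" for z
    unfolding R_def by (rule ustat_bd[OF remainder_bd mn that])
  have L_bd: "\<bar>L z\<bar> \<le> real m * (2 * B)" if z: "z \<in> space (Q n)" for z
  proof -
    have "\<bar>\<Sum>i<n. hajek (z i)\<bar> \<le> (\<Sum>i<n. \<bar>hajek (z i)\<bar>)" by (rule sum_abs)
    also have "\<dots> \<le> (\<Sum>i<n. real m * (2 * B))" using z by (intro sum_mono hajek_bd zs) auto
    finally show ?thesis using n0 by (simp add: L_def abs_divide divide_le_eq mult.commute)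
  qed
  have iL: "integrable (Q n) (\<lambda>z. (L z)\<^sup>2)"
  proof (rule Qn.integrable_const_bound[where B = "(real m * (2 * B))\<^sup>2"])
    show "AE z in Q n. norm ((L z)\<^sup>2) \<le> (real m * (2 * B))\<^sup>2"
      using L_bd B_nonneg by (intro AE_I2) (auto simp: abs_le_square_iff[symmetric] abs_mult)
  qed measurable
  have iR: "integrable (Q n) (\<lambda>z. (R z)\<^sup>2)"
  proof (rule Qn.integrable_const_bound[where B = "((2 + 2 * real m) * B)\<^sup>2"])
    show "AE z in Q n. norm ((R z)\<^sup>2) \<le> ((2 + 2 * real m) * B)\<^sup>2"
      using R_bd B_nonneg by (intro AE_I2) (auto simp: abs_le_square_iff[symmetric] abs_mult)
  qed measurable
  have iLR: "integrable (Q n) (\<lambda>z. 2 * L z * R z)"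
  proof (rule Bochner_Integration.integrable_bound[OF Bochner_Integration.integrable_add[OF iL iR]])
    show "AE z in Q n. norm (2 * L z * R z) \<le> norm ((L z)\<^sup>2 + (R z)\<^sup>2)"
    proof (rule AE_I2)
      fix z
      show "norm (2 * L z * R z) \<le> norm ((L z)\<^sup>2 + (R z)\<^sup>2)"
        using zero_le_power2[of "L z + R z"] zero_le_power2[of "L z - R z"]
        by (simp add: power2_sum power2_diff abs_le_iff)
    qed
  qed measurable
  have EL: "(\<integral>z. (L z)\<^sup>2 \<partial>Q n) = zeta / real n"
  proof -
    have "(\<integral>z. (L z)\<^sup>2 \<partial>Q n) = (\<integral>z. (\<Sum>i<n. hajek (z i))\<^sup>2 \<partial>Q n) / (real n)\<^sup>2"
      unfolding L_def by (simp add: power_divide)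
    also have "\<dots> = zeta / real n"
      unfolding hajek_sum_second_moment using n0 by (simp add: power2_eq_square)
    finally show ?thesis .
  qed
  have ER: "(\<integral>z. (R z)\<^sup>2 \<partial>Q n) \<le> 4 * C_rem\<^sup>2 / (real n)\<^sup>2"
    using remainder_moment[of 2 n] n by (simp add: R_def power_mult_distrib power_divide mult.commute)
  have ER0: "0 \<le> (\<integral>z. (R z)\<^sup>2 \<partial>Q n)" by (intro integral_nonneg_AE) auto
  have ELR: "\<bar>\<integral>z. 2 * L z * R z \<partial>Q n\<bar> \<le> zeta / real n / s + s * (\<integral>z. (R z)\<^sup>2 \<partial>Q n)"
  proof -
    have "\<bar>\<integral>z. 2 * L z * R z \<partial>Q n\<bar> \<le> (\<integral>z. \<bar>2 * L z * R z\<bar> \<partial>Q n)" by (rule integral_abs_bound)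
    also have "\<dots> \<le> (\<integral>z. (L z)\<^sup>2 / s + s * (R z)\<^sup>2 \<partial>Q n)"
    proof (rule integral_mono)
      fix z
      \<comment> \<open>the weight \<open>s = \<surd>n\<close> reflects that \<open>R\<close> is smaller than \<open>L\<close> by this order of magnitude\<close>
      have "0 \<le> (\<bar>L z\<bar> - s * \<bar>R z\<bar>)\<^sup>2 / s" using s by simp
      then show "\<bar>2 * L z * R z\<bar> \<le> (L z)\<^sup>2 / s + s * (R z)\<^sup>2"
        using s by (simp add: power2_eq_square abs_mult field_simps)
    qed (use iL iR iLR in auto)
    also have "\<dots> = zeta / real n / s + s * (\<integral>z. (R z)\<^sup>2 \<partial>Q n)" using iL iR EL by simp
    finally show ?thesis .
  qed
  have "uvar n = (\<integral>z. (L z)\<^sup>2 + 2 * L z * R z + (R z)\<^sup>2 \<partial>Q n)"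
    unfolding uvar_def ustat_hoeffding[OF mn] by (simp add: L_def R_def power2_sum algebra_simps)
  also have "\<dots> = zeta / real n + (\<integral>z. 2 * L z * R z \<partial>Q n) + (\<integral>z. (R z)\<^sup>2 \<partial>Q n)"
    using iL iR iLR EL by simp
  finally have "\<bar>uvar n - zeta / real n\<bar> \<le> zeta / real n / s + s * (\<integral>z. (R z)\<^sup>2 \<partial>Q n) + 1 * (\<integral>z. (R z)\<^sup>2 \<partial>Q n)"
    using ELR ER0 by linarith
  also have "\<dots> \<le> zeta / real n / s + s * (4 * C_rem\<^sup>2 / (real n)\<^sup>2) + s * (4 * C_rem\<^sup>2 / (real n)\<^sup>2)"
    using ER ER0 s by (intro add_mono mult_mono) auto
  finally have "real n * \<bar>uvar n - zeta / real n\<bar> \<le> real n * (zeta / real n / s + s * (4 * C_rem\<^sup>2 / (real n)\<^sup>2) + s * (4 * C_rem\<^sup>2 / (real n)\<^sup>2))"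
    by (intro mult_left_mono) auto
  also have "\<dots> = (zeta + 8 * C_rem\<^sup>2) / s"
    unfolding s(2)[symmetric] using s(1) by (simp add: power2_eq_square field_simps)
  also have "real n * \<bar>uvar n - zeta / real n\<bar> = \<bar>real n * (uvar n - zeta / real n)\<bar>" by (simp add: abs_mult)
  also have "real n * (uvar n - zeta / real n) = real n * uvar n - zeta" using n0 by (simp add: algebra_simps)
  finally show ?thesis by (simp add: s_def)
qed

end

section \<open>Moderate deviations of a non-degenerate U-statistic\<close>

lemma std_rv_bounded:
  assumes P: "prob_space P" and \<xi>: "\<xi> \<in> borel_measurable P" "\<And>x. x \<in> space P \<Longrightarrow> \<bar>\<xi> x\<bar> \<le> K"
    and mean: "(\<integral>x. \<xi> x \<partial>P) = 0" and var: "(\<integral>x. (\<xi> x)\<^sup>2 \<partial>P) = 1"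
  shows "std_rv P \<xi>"
proof -
  interpret PS: prob_space P by fact
  note [measurable] = \<xi>(1)
  have "integrable P (\<lambda>u. \<bar>\<xi> u\<bar> ^ 3 * exp \<bar>\<xi> u\<bar>)"
  proof (rule PS.integrable_const_bound[where B = "K ^ 3 * exp K"])
    show "AE u in P. norm (\<bar>\<xi> u\<bar> ^ 3 * exp \<bar>\<xi> u\<bar>) \<le> K ^ 3 * exp K"
    proof (rule AE_I2)
      fix u assume u: "u \<in> space P"
      have "\<bar>\<xi> u\<bar> ^ 3 * exp \<bar>\<xi> u\<bar> \<le> K ^ 3 * exp K"
        using \<xi>(2)[OF u] by (intro mult_mono power_mono) auto
      then show "norm (\<bar>\<xi> u\<bar> ^ 3 * exp \<bar>\<xi> u\<bar>) \<le> K ^ 3 * exp K" by simp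
    qed
  qed measurable
  then show ?thesis using assms by (simp add: std_rv_def)
qed

text \<open>
  The reciprocal of the asymptotic upper tail probability \<open>exp (- x\<^sup>2 / 2) / (x \<surd>(2 \<pi>))\<close> of the standard
  normal law, which is what Mills' ratio amounts to for large \<open>x\<close>.
\<close>

definition mills :: "real \<Rightarrow> real" where
  "mills x = x * exp (x\<^sup>2 / 2) * sqrt (2 * pi)"

text \<open>
  A change of the level by \<open>c / t\<close> changes \<open>t\<^sup>2 / 2\<close> by \<open>c + o(1)\<close>. Perturbations of the statistic that
  are small compared with \<open>1 / t\<close> are therefore harmless.
\<close>

lemma iid_moderate_deviation_shift:
  fixes t :: "nat \<Rightarrow> real"
  assumes P: "std_rv P \<xi>" and t: "filterlim t at_top sequentially"
    and t3: "(\<lambda>n. (t n) ^ 3 / sqrt (real n)) \<longlonglongrightarrow> 0"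
  shows "(\<lambda>n. mills (t n) * measure (PiM {..<n} (\<lambda>_. P))
      {z \<in> space (PiM {..<n} (\<lambda>_. P)). t n + c / t n < (\<Sum>i<n. \<xi> (z i)) / sqrt (real n)}) \<longlonglongrightarrow> exp (- c)"
proof -
  define t' where "t' n = t n + c / t n" for n
  define A where "A n = measure (PiM {..<n} (\<lambda>_. P)) {z \<in> space (PiM {..<n} (\<lambda>_. P)). t' n < (\<Sum>i<n. \<xi> (z i)) / sqrt (real n)}" for n
  have ct: "(\<lambda>n. c / t n) \<longlonglongrightarrow> 0"
    by (rule tendsto_divide_0[OF tendsto_const filterlim_at_top_imp_at_infinity[OF t]])
  have t'_top: "filterlim t' at_top sequentially"
    unfolding t'_def[abs_def] add.commute[of "t _"] by (rule filterlim_tendsto_add_at_top[OF ct t])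
  have ev: "eventually (\<lambda>n. 1 + \<bar>c\<bar> \<le> t n \<and> 1 \<le> t' n) sequentially"
    using t t'_top by (simp add: filterlim_at_top eventually_conj_iff)
  have t'3: "(\<lambda>n. (t' n) ^ 3 / sqrt (real n)) \<longlonglongrightarrow> 0"
  proof (rule tendsto_sandwich[where f = "\<lambda>_. 0"])
    show "(\<lambda>n. 8 * ((t n) ^ 3 / sqrt (real n))) \<longlonglongrightarrow> 0" using tendsto_mult_left[OF t3, of 8] by simp
    show "\<forall>\<^sub>F n in sequentially. (t' n) ^ 3 / sqrt (real n) \<le> 8 * ((t n) ^ 3 / sqrt (real n))"
      using ev
    proof eventually_elim
      fix n assume n: "1 + \<bar>c\<bar> \<le> t n \<and> 1 \<le> t' n"
      have tn: "1 \<le> t n" "\<bar>c\<bar> \<le> t n" using n abs_ge_zero[of c] by linarith+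
      have "t n * 1 \<le> t n * t n" using tn by (intro mult_left_mono) auto
      then have "c \<le> t n * t n" using tn abs_ge_self[of c] by linarith
      then have "c / t n \<le> t n" using tn by (simp add: divide_le_eq)
      then have "t' n \<le> 2 * t n" by (simp add: t'_def)
      then have "(t' n) ^ 3 \<le> (2 * t n) ^ 3" using n by (intro power_mono) auto
      then have "(t' n) ^ 3 / sqrt (real n) \<le> (2 * t n) ^ 3 / sqrt (real n)" by (intro divide_right_mono) auto
      then show "(t' n) ^ 3 / sqrt (real n) \<le> 8 * ((t n) ^ 3 / sqrt (real n))" by (simp add: power_mult_distrib)
    qed
    show "\<forall>\<^sub>F n in sequentially. 0 \<le> (t' n) ^ 3 / sqrt (real n)"
      using ev by eventually_elim auto
  qed (rule tendsto_const)
  have md: "(\<lambda>n. mills (t' n) * A n) \<longlonglongrightarrow> 1"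
    using iid_moderate_deviation[OF P t'_top t'3] by (simp add: mills_def A_def)
  have it: "(\<lambda>n. inverse (t n)) \<longlonglongrightarrow> 0" by (rule tendsto_inverse_0_at_top[OF t])
  have "(\<lambda>n. 1 / (1 + c * (inverse (t n))\<^sup>2) * exp (- c - c\<^sup>2 * (inverse (t n))\<^sup>2 / 2)) \<longlonglongrightarrow> 1 / (1 + c * 0\<^sup>2) * exp (- c - c\<^sup>2 * 0\<^sup>2 / 2)"
    by (intro tendsto_intros it) auto
  then have "(\<lambda>n. (1 / (1 + c * (inverse (t n))\<^sup>2) * exp (- c - c\<^sup>2 * (inverse (t n))\<^sup>2 / 2)) * (mills (t' n) * A n)) \<longlonglongrightarrow> exp (- c) * 1"
    by (intro tendsto_mult md) simp
  then have "(\<lambda>n. mills (t n) * A n) \<longlonglongrightarrow> exp (- c) * 1"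
  proof (rule Lim_transform_eventually)
    show "\<forall>\<^sub>F n in sequentially. (1 / (1 + c * (inverse (t n))\<^sup>2) * exp (- c - c\<^sup>2 * (inverse (t n))\<^sup>2 / 2)) * (mills (t' n) * A n) = mills (t n) * A n"
      using ev
    proof eventually_elim
      fix n assume n: "1 + \<bar>c\<bar> \<le> t n \<and> 1 \<le> t' n"
      have tn: "0 < t n" "0 < t' n" using n abs_ge_zero[of c] by linarith+
      have a: "t' n = t n * (1 + c * (inverse (t n))\<^sup>2)"
        using tn by (simp add: t'_def power2_eq_square field_simps)
      then have p: "1 + c * (inverse (t n))\<^sup>2 \<noteq> 0" using tn by auto
      have b: "(t' n)\<^sup>2 / 2 = (t n)\<^sup>2 / 2 - (- c - c\<^sup>2 * (inverse (t n))\<^sup>2 / 2)"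
        using tn by (simp add: t'_def power2_eq_square field_simps)
      have "exp (- c - c\<^sup>2 * (inverse (t n))\<^sup>2 / 2) * exp ((t' n)\<^sup>2 / 2) = exp ((t n)\<^sup>2 / 2)"
        unfolding b by (simp flip: exp_add)
      moreover have "1 / (1 + c * (inverse (t n))\<^sup>2) * t' n = t n" unfolding a using p by simp
      ultimately have "(1 / (1 + c * (inverse (t n))\<^sup>2) * t' n) * (exp (- c - c\<^sup>2 * (inverse (t n))\<^sup>2 / 2) * exp ((t' n)\<^sup>2 / 2)) = t n * exp ((t n)\<^sup>2 / 2)"
        by simp
      then have "((1 / (1 + c * (inverse (t n))\<^sup>2) * t' n) * (exp (- c - c\<^sup>2 * (inverse (t n))\<^sup>2 / 2) * exp ((t' n)\<^sup>2 / 2))) * (sqrt (2 * pi) * A n) = t n * exp ((t n)\<^sup>2 / 2) * (sqrt (2 * pi) * A n)"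
        by (rule arg_cong)
      then show "(1 / (1 + c * (inverse (t n))\<^sup>2) * exp (- c - c\<^sup>2 * (inverse (t n))\<^sup>2 / 2)) * (mills (t' n) * A n) = mills (t n) * A n"
        unfolding mills_def by (simp only: mult_ac)
    qed
  qed
  then show ?thesis by (simp add: A_def t'_def)
qed

context bounded_kernel
begin

text \<open>
  Markov's inequality for the moment of order \<open>2 p\<close> with \<open>p\<close> close to \<open>t\<^sup>2\<close> bounds the probability by
  \<open>(C' t\<^sup>3 / \<surd>n) ^ (2 p)\<close>. As the base tends to zero this is at most \<open>exp (- 2 t\<^sup>2)\<close> eventually, far
  below the Gaussian tail \<open>exp (- t\<^sup>2 / 2)\<close>.
\<close>

lemma remainder_tail:
  assumes t: "filterlim t at_top sequentially" and t3: "(\<lambda>n. (t n) ^ 3 / sqrt (real n)) \<longlonglongrightarrow> 0"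
    and \<delta>: "0 < \<delta>"
  shows "(\<lambda>n. mills (t n) * measure (Q n) {z \<in> space (Q n). \<delta> / t n < \<bar>sqrt (real n) * ustat m remainder n z\<bar>}) \<longlonglongrightarrow> 0"
proof -
  \<comment> \<open>half the order of the moment\<close>
  define p where "p n = nat \<lceil>(t n)\<^sup>2\<rceil>" for n
  define A where "A n = measure (Q n) {z \<in> space (Q n). \<delta> / t n < \<bar>sqrt (real n) * ustat m remainder n z\<bar>}" for n
  have t1: "eventually (\<lambda>n. 1 \<le> t n) sequentially" using t by (simp add: filterlim_at_top)
  have small: "eventually (\<lambda>n. (t n) ^ 3 / sqrt (real n) < e) sequentially" if "0 < e" for e
    using order_tendstoD(2)[OF t3 that] .
  have small1: "eventually (\<lambda>n. (t n) ^ 3 / sqrt (real n) < 1 / (4 * real m)) sequentially"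
    using m by (intro small) simp
  have small2: "eventually (\<lambda>n. (t n) ^ 3 / sqrt (real n) < \<delta> / (4 * (C_rem + 1) * exp 1)) sequentially"
    using \<delta> C_rem_nonneg by (intro small) (simp add: add_nonneg_pos)
  have "eventually (\<lambda>n. A n \<le> exp (- 2 * (t n)\<^sup>2)) sequentially"
    using t1 small1 small2 eventually_ge_at_top[of "2 * m"]
  proof eventually_elim
    case (elim n)
    interpret Qn: prob_space "Q n" by (rule Q_prob)
    let ?R = "ustat m remainder n"
    have n: "2 * m \<le> n" and tn: "1 \<le> t n" using elim by simp_all
    have n1: "1 \<le> n" using n m by linarith
    have sn: "1 \<le> sqrt (real n)" "0 < sqrt (real n)" using n1 by auto
    have t2: "1 \<le> (t n)\<^sup>2" using tn by simp
    have p: "(t n)\<^sup>2 \<le> real (p n)" "real (p n) \<le> 2 * (t n)\<^sup>2"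
    proof -
      show "(t n)\<^sup>2 \<le> real (p n)" unfolding p_def by linarith
      have "real (p n) \<le> (t n)\<^sup>2 + 1" unfolding p_def using t2 by linarith
      then show "real (p n) \<le> 2 * (t n)\<^sup>2" using t2 by linarith
    qed
    then have p0: "0 < p n" using t2 by (cases "p n") auto
    have pm: "2 * p n * m \<le> n"
    proof -
      have "(t n)\<^sup>2 \<le> (t n) ^ 3" using tn by (intro power_increasing) auto
      also have "\<dots> \<le> sqrt (real n) / (4 * real m)"
        using elim(2) sn m by (simp add: field_simps)
      also have "\<dots> \<le> real n / (4 * real m)"
        using mult_left_mono[OF sn(1), of "sqrt (real n)"] by (intro divide_right_mono) auto
      finally have "4 * real m * (t n)\<^sup>2 \<le> real n" using m by (simp add: field_simps)
      moreover have "real (2 * p n * m) \<le> 4 * real m * (t n)\<^sup>2"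
        using mult_right_mono[OF p(2), of "2 * real m"] by (simp add: algebra_simps)
      ultimately show ?thesis by linarith
    qed
    let ?\<rho> = "\<delta> / (t n * sqrt (real n))"
    have \<rho>: "0 < ?\<rho>" using \<delta> tn sn by simp
    have R_meas [measurable]: "?R \<in> borel_measurable (Q n)" by (rule ustat_meas[OF remainder_meas])
    have iR: "integrable (Q n) (\<lambda>z. (?R z) ^ (2 * p n))"
    proof (rule Qn.integrable_const_bound[where B = "((2 + 2 * real m) * B) ^ (2 * p n)"])
      show "AE z in Q n. norm (?R z ^ (2 * p n)) \<le> ((2 + 2 * real m) * B) ^ (2 * p n)"
      proof (rule AE_I2)
        fix z assume z: "z \<in> space (Q n)"
        have "\<bar>?R z\<bar> \<le> (2 + 2 * real m) * B" using n by (intro ustat_bd remainder_bd z) auto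
        then have "\<bar>?R z\<bar> ^ (2 * p n) \<le> ((2 + 2 * real m) * B) ^ (2 * p n)" by (intro power_mono) auto
        then show "norm (?R z ^ (2 * p n)) \<le> ((2 + 2 * real m) * B) ^ (2 * p n)"
          unfolding real_norm_def power_abs .
      qed
    qed measurable
    have "A n \<le> measure (Q n) {z \<in> space (Q n). ?\<rho> ^ (2 * p n) \<le> ?R z ^ (2 * p n)}"
      unfolding A_def
    proof (rule Qn.finite_measure_mono)
      show "{z \<in> space (Q n). \<delta> / t n < \<bar>sqrt (real n) * ?R z\<bar>} \<subseteq> {z \<in> space (Q n). ?\<rho> ^ (2 * p n) \<le> ?R z ^ (2 * p n)}"
      proof safe
        fix z assume "\<delta> / t n < \<bar>sqrt (real n) * ?R z\<bar>"
        then have "?\<rho> \<le> \<bar>?R z\<bar>" using sn tn by (simp add: abs_mult field_simps)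
        then have "?\<rho> ^ (2 * p n) \<le> \<bar>?R z\<bar> ^ (2 * p n)" using \<rho> by (intro power_mono) auto
        then show "?\<rho> ^ (2 * p n) \<le> ?R z ^ (2 * p n)" by (simp add: power_mult)
      qed
    qed measurable
    also have "\<dots> \<le> (\<integral>z. (?R z) ^ (2 * p n) \<partial>Q n) / ?\<rho> ^ (2 * p n)"
      by (intro integral_Markov_inequality_measure[OF iR, where A = "{}"]) (auto simp: zero_less_power[OF \<rho>])
    also have "\<dots> \<le> (C_rem * real (2 * p n) / real n) ^ (2 * p n) / ?\<rho> ^ (2 * p n)"
      using remainder_moment[of "2 * p n" n] p0 pm n \<rho> by (intro divide_right_mono) auto
    also have "\<dots> = (C_rem * real (2 * p n) / real n / ?\<rho>) ^ (2 * p n)"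
      by (simp only: power_divide)
    also have "\<dots> \<le> (exp (- 1)) ^ (2 * p n)"
    proof (rule power_mono)
      have "C_rem * real (2 * p n) / real n / ?\<rho> = C_rem * real (2 * p n) * t n / (sqrt (real n) * \<delta>)"
      proof -
        have e: "x / (r * r) / (\<delta> / (v * r)) = x * v / (r * \<delta>)" if "0 < r" "0 < v" for x r v :: real
          using that \<delta> by (simp add: field_simps)
        have "sqrt (real n) * sqrt (real n) = real n" by simp
        then show ?thesis using e[OF sn(2), of "t n" "C_rem * real (2 * p n)"] tn by simp
      qed
      also have "\<dots> \<le> (C_rem + 1) * (4 * (t n)\<^sup>2) * t n / (sqrt (real n) * \<delta>)"
        using p(2) tn \<delta> C_rem_nonneg by (intro divide_right_mono mult_right_mono mult_mono) auto
      also have "\<dots> = (4 * (C_rem + 1) / \<delta>) * ((t n) ^ 3 / sqrt (real n))"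
      proof -
        have "c * (4 * v\<^sup>2) * v / (r * d) = (4 * c / d) * (v ^ 3 / r)" for c v r d :: real
          by (simp add: power2_eq_square power3_eq_cube mult_ac)
        then show ?thesis .
      qed
      also have "\<dots> \<le> (4 * (C_rem + 1) / \<delta>) * (\<delta> / (4 * (C_rem + 1) * exp 1))"
        using elim(3) \<delta> C_rem_nonneg by (intro mult_left_mono) auto
      also have "\<dots> = exp (- 1)"
      proof -
        have "(4 * c / d) * (d / (4 * c * exp 1)) = exp (- 1)" if "0 < c" "0 < d" for c d :: real
          using that by (simp add: exp_minus field_simps)
        then show ?thesis using \<delta> C_rem_nonneg by (simp only: add_nonneg_pos zero_less_one)
      qed
      finally show "C_rem * real (2 * p n) / real n / ?\<rho> \<le> exp (- 1)" .
      show "0 \<le> C_rem * real (2 * p n) / real n / ?\<rho>"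
        using C_rem_nonneg \<delta> tn by (intro divide_nonneg_nonneg mult_nonneg_nonneg) auto
    qed
    also have "\<dots> = exp (- 2 * real (p n))" by (simp flip: exp_of_nat_mult)
    also have "\<dots> \<le> exp (- 2 * (t n)\<^sup>2)" using p by simp
    finally show "A n \<le> exp (- 2 * (t n)\<^sup>2)" .
  qed
  then have bound: "eventually (\<lambda>n. mills (t n) * A n \<le> sqrt (2 * pi) * inverse (t n)) sequentially"
    using t1
  proof eventually_elim
    fix n assume A: "A n \<le> exp (- 2 * (t n)\<^sup>2)" and tn: "1 \<le> t n"
    have "mills (t n) * A n \<le> mills (t n) * exp (- 2 * (t n)\<^sup>2)"
      using A tn by (intro mult_left_mono) (auto simp: mills_def)
    also have "\<dots> = sqrt (2 * pi) * (t n * (exp ((t n)\<^sup>2 / 2) * exp (- 2 * (t n)\<^sup>2)))"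
      by (simp add: mills_def)
    also have "exp ((t n)\<^sup>2 / 2) * exp (- 2 * (t n)\<^sup>2) \<le> exp (- (t n)\<^sup>2)"
      by (simp flip: exp_add)
    also have "exp (- (t n)\<^sup>2) \<le> inverse ((t n)\<^sup>2)"
      unfolding exp_minus
      using exp_ge_add_one_self[of "(t n)\<^sup>2"] tn by (intro le_imp_inverse_le) (linarith, simp)
    also have "sqrt (2 * pi) * (t n * inverse ((t n)\<^sup>2)) = sqrt (2 * pi) * inverse (t n)"
      using tn by (simp add: power2_eq_square)
    finally show "mills (t n) * A n \<le> sqrt (2 * pi) * inverse (t n)" using tn by simp
  qed
  have "(\<lambda>n. mills (t n) * A n) \<longlonglongrightarrow> 0"
  proof (rule tendsto_sandwich[where f = "\<lambda>_. 0"])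
    show "\<forall>\<^sub>F n in sequentially. 0 \<le> mills (t n) * A n"
      using t1 by eventually_elim (auto simp: mills_def A_def)
    show "(\<lambda>n. sqrt (2 * pi) * inverse (t n)) \<longlonglongrightarrow> 0"
      using tendsto_mult_left[OF tendsto_inverse_0_at_top[OF t], of "sqrt (2 * pi)"] by simp
  qed (use bound in auto)
  then show ?thesis by (simp add: A_def)
qed

text \<open>
  The centred statistic times \<open>\<surd>n / \<surd>zeta\<close> is \<open>S + D / \<surd>zeta\<close> with a standardised i.i.d. sum \<open>S\<close> and a
  small remainder. Replacing \<open>zeta\<close> by the exact variance moves the level \<open>t\<close> by
  less than \<open>\<delta> / t\<close>, and \<open>\<bar>D\<bar> / \<surd>zeta > \<delta> / t\<close> is negligible, so the event lies between
  \<open>\<bar>S\<bar> > t \<plusminus> 2 \<delta> / t\<close> up to a negligible event. The limit \<open>2\<close> counts the two tails.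
\<close>

theorem ustat_moderate_deviation:
  assumes zeta: "0 < zeta"
    and t: "filterlim t at_top sequentially" and t3: "(\<lambda>n. (t n) ^ 3 / sqrt (real n)) \<longlonglongrightarrow> 0"
  shows "(\<lambda>n. mills (t n) * measure (Q n)
      {z \<in> space (Q n). (t n)\<^sup>2 * (real n * uvar n) < real n * (ustat m h n z - theta)\<^sup>2}) \<longlonglongrightarrow> 2"
proof -
  define s where "s = sqrt zeta"
  have s: "0 < s" "s * s = zeta" using zeta by (auto simp: s_def)
  define \<xi> where "\<xi> x = hajek x / s" for x
  define S where "S n z = (\<Sum>i<n. \<xi> (z i)) / sqrt (real n)" for n and z :: "nat \<Rightarrow> real \<times> real"
  define D where "D n z = sqrt (real n) * ustat m remainder n z" for n z
  define E where "E n = {z \<in> space (Q n). (t n)\<^sup>2 * (real n * uvar n) < real n * (ustat m h n z - theta)\<^sup>2}" for n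
  define up where "up c n = {z \<in> space (Q n). t n + c / t n < S n z}" for c n
  define dn where "dn c n = {z \<in> space (Q n). t n + c / t n < - S n z}" for c n
  define far where "far \<delta> n = {z \<in> space (Q n). s * \<delta> / t n < \<bar>D n z\<bar>}" for \<delta> n
  have \<xi>_meas [measurable]: "\<xi> \<in> borel_measurable P" unfolding \<xi>_def[abs_def] by measurable
  have \<xi>_bd: "\<bar>\<xi> x\<bar> \<le> real m * (2 * B) / s" if "x \<in> space P" for x
    using hajek_bd[OF that] s by (simp add: \<xi>_def abs_divide divide_right_mono)
  have \<xi>_var: "(\<integral>x. (\<xi> x)\<^sup>2 \<partial>P) = 1"
    using zeta s by (simp add: \<xi>_def power_divide zeta_def[symmetric] power2_eq_square[of s])
  have \<xi>_mean: "(\<integral>x. \<xi> x \<partial>P) = 0" by (simp add: \<xi>_def hajek_mean)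
  have std: "std_rv P \<xi>"
    using \<xi>_meas \<xi>_bd \<xi>_mean \<xi>_var by (rule std_rv_bounded[OF prob_space_axioms])
  have std': "std_rv P (\<lambda>x. - \<xi> x)"
  proof (rule std_rv_bounded[OF prob_space_axioms])
    show "(\<integral>x. - \<xi> x \<partial>P) = 0" using hajek_mean by (simp add: \<xi>_def)
    show "(\<integral>x. (- \<xi> x)\<^sup>2 \<partial>P) = 1" using \<xi>_var by simp
  qed (use \<xi>_bd in auto)
  have S_meas [measurable]: "S n \<in> borel_measurable (Q n)" for n
    unfolding S_def[abs_def] by (intro borel_measurable_divide borel_measurable_sum measurable_compose[OF _ \<xi>_meas]) auto
  have D_meas [measurable]: "D n \<in> borel_measurable (Q n)" for n
    unfolding D_def[abs_def] by (intro borel_measurable_times ustat_meas remainder_meas) auto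
  have U_meas [measurable]: "ustat m h n \<in> borel_measurable (Q n)" for n by (rule ustat_meas[OF h_meas])
  have up: "(\<lambda>n. mills (t n) * measure (Q n) (up c n)) \<longlonglongrightarrow> exp (- c)" for c
    using iid_moderate_deviation_shift[OF std t t3, of c] by (simp add: up_def S_def)
  have dn: "(\<lambda>n. mills (t n) * measure (Q n) (dn c n)) \<longlonglongrightarrow> exp (- c)" for c
    using iid_moderate_deviation_shift[OF std' t t3, of c] by (simp add: dn_def S_def sum_negf)
  have far: "(\<lambda>n. mills (t n) * measure (Q n) (far \<delta> n)) \<longlonglongrightarrow> 0" if "0 < \<delta>" for \<delta>
    using remainder_tail[OF t t3, of "s * \<delta>"] that s by (simp add: far_def D_def)
  have t1: "eventually (\<lambda>n. 1 \<le> t n) sequentially" using t by (simp add: filterlim_at_top)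
  have main: "eventually (\<lambda>n. E n \<subseteq> up (- 2 * \<delta>) n \<union> dn (- 2 * \<delta>) n \<union> far \<delta> n \<and>
      up (2 * \<delta>) n \<union> dn (2 * \<delta>) n \<subseteq> E n \<union> far \<delta> n \<and> 0 < t n) sequentially" if \<delta>: "0 < \<delta>" for \<delta>
  proof -
    define K where "K = (zeta + 8 * C_rem\<^sup>2) / zeta"
    have K: "0 < K" using zeta C_rem_nonneg by (simp add: K_def add_pos_nonneg)
    have "eventually (\<lambda>n. (t n) ^ 3 / sqrt (real n) < \<delta> / K) sequentially"
      using \<delta> K by (intro order_tendstoD(2)[OF t3]) auto
    then show ?thesis using t1 eventually_ge_at_top[of "2 * m"]
    proof eventually_elim
      fix n assume d: "(t n) ^ 3 / sqrt (real n) < \<delta> / K" and tn: "1 \<le> t n" and n: "2 * m \<le> n"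
      have n0: "0 < real n" and mn: "m \<le> n" using n m by auto
      have sn: "0 < sqrt (real n)" "sqrt (real n) * sqrt (real n) = real n" using n0 by auto
      define a where "a = sqrt (real n * uvar n / zeta)"
      have uv: "0 \<le> uvar n" unfolding uvar_def by (intro integral_nonneg_AE) auto
      have a0: "0 \<le> a" and a2: "a\<^sup>2 = real n * uvar n / zeta" using uv zeta n0 by (auto simp: a_def)
      have "\<bar>a - 1\<bar> * 1 \<le> \<bar>a - 1\<bar> * \<bar>a + 1\<bar>" using a0 by (intro mult_left_mono) auto
      also have "\<dots> = \<bar>a\<^sup>2 - 1\<bar>" by (simp add: abs_mult[symmetric] power2_eq_square algebra_simps)
      also have "a\<^sup>2 - 1 = (real n * uvar n - zeta) / zeta" using zeta by (simp add: a2 field_simps)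
      also have "\<bar>\<dots>\<bar> \<le> (zeta + 8 * C_rem\<^sup>2) / sqrt (real n) / zeta"
        using divide_right_mono[OF uvar_approx[OF n], of zeta] zeta by (simp add: abs_divide)
      also have "\<dots> = K / sqrt (real n)" by (simp add: K_def)
      finally have a1: "\<bar>a - 1\<bar> \<le> K / sqrt (real n)" by simp
      have "t n * a - t n = t n * (a - 1)" by (simp add: algebra_simps)
      then have "\<bar>t n * a - t n\<bar> = t n * \<bar>a - 1\<bar>" using tn by (simp add: abs_mult)
      also have "\<dots> \<le> t n * (K / sqrt (real n))" using tn a1 by (intro mult_left_mono) auto
      also have "\<dots> \<le> \<delta> / t n"
      proof -
        have "(t n)\<^sup>2 \<le> (t n) ^ 3" using tn by (intro power_increasing) auto
        then have "(t n)\<^sup>2 / sqrt (real n) \<le> (t n) ^ 3 / sqrt (real n)" by (intro divide_right_mono) auto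
        with d have "(t n)\<^sup>2 / sqrt (real n) \<le> \<delta> / K" by linarith
        then have "K * ((t n)\<^sup>2 / sqrt (real n)) \<le> \<delta>" using K by (simp add: field_simps)
        then show ?thesis using tn sn by (simp add: power2_eq_square field_simps)
      qed
      finally have ta: "\<bar>t n * a - t n\<bar> \<le> \<delta> / t n" .
      have E_iff: "z \<in> E n \<longleftrightarrow> t n * a < \<bar>S n z + D n z / s\<bar>" if z: "z \<in> space (Q n)" for z
      proof -
        have "sqrt (real n) * (ustat m h n z - theta) = s * (S n z + D n z / s)"
        proof -
          have 1: "(\<Sum>i<n. \<xi> (z i)) = (\<Sum>i<n. hajek (z i)) / s" by (simp add: \<xi>_def sum_divide_distrib)
          have 2: "(\<Sum>i<n. hajek (z i)) / real n * sqrt (real n) = (\<Sum>i<n. hajek (z i)) / sqrt (real n)"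
          proof -
            have "x / (r * r) * r = x / r" if "0 < r" for x r :: real using that by simp
            from this[OF sn(1)] show ?thesis unfolding sn(2) .
          qed
          show ?thesis
            unfolding ustat_hoeffding[OF mn] S_def D_def 1 using s 2 by (simp add: field_simps)
        qed
        then have "(sqrt (real n) * (ustat m h n z - theta))\<^sup>2 = (s * (S n z + D n z / s))\<^sup>2" by simp
        then have e: "real n * (ustat m h n z - theta)\<^sup>2 = zeta * (S n z + D n z / s)\<^sup>2"
          using s by (simp add: power_mult_distrib power2_eq_square[of s])
        have "z \<in> E n \<longleftrightarrow> (t n)\<^sup>2 * (real n * uvar n) < zeta * (S n z + D n z / s)\<^sup>2"
          using z by (simp add: E_def e)
        also have "real n * uvar n = zeta * a\<^sup>2" using zeta by (simp add: a2)
        also have "(t n)\<^sup>2 * (zeta * a\<^sup>2) = zeta * (t n * a)\<^sup>2" by (simp add: power_mult_distrib)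
        also have "(zeta * (t n * a)\<^sup>2 < zeta * (S n z + D n z / s)\<^sup>2) \<longleftrightarrow> \<bar>t n * a\<bar> < \<bar>S n z + D n z / s\<bar>"
          unfolding mult_less_cancel_left_pos[OF zeta] using abs_le_square_iff[of "S n z + D n z / s" "t n * a"] by linarith
        also have "\<bar>t n * a\<bar> = t n * a" using tn a0 by simp
        finally show ?thesis .
      qed
      have far_iff: "z \<in> far \<delta> n \<longleftrightarrow> \<delta> / t n < \<bar>D n z / s\<bar>" if z: "z \<in> space (Q n)" for z
        using z s tn by (simp add: far_def abs_divide field_simps)
      have two: "2 * \<delta> / t n = 2 * (\<delta> / t n)" "- 2 * \<delta> / t n = - 2 * (\<delta> / t n)" by simp_all
      have pos: "0 < \<delta> / t n" using \<delta> tn by simp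
      have spaceE: "E n \<subseteq> space (Q n)" by (auto simp: E_def)
      show "E n \<subseteq> up (- 2 * \<delta>) n \<union> dn (- 2 * \<delta>) n \<union> far \<delta> n \<and>
          up (2 * \<delta>) n \<union> dn (2 * \<delta>) n \<subseteq> E n \<union> far \<delta> n \<and> 0 < t n"
      proof (intro conjI subsetI)
        fix z assume zE: "z \<in> E n"
        then have z: "z \<in> space (Q n)" using spaceE by auto
        show "z \<in> up (- 2 * \<delta>) n \<union> dn (- 2 * \<delta>) n \<union> far \<delta> n"
        proof (cases "z \<in> far \<delta> n")
          case False
          then have "\<bar>D n z / s\<bar> \<le> \<delta> / t n" using far_iff[OF z] by simp
          moreover have "t n * a < \<bar>S n z + D n z / s\<bar>" using zE E_iff[OF z] by simp
          ultimately have "t n + - 2 * \<delta> / t n < S n z \<or> t n + - 2 * \<delta> / t n < - S n z"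
            using ta unfolding two by linarith
          then show ?thesis using z by (auto simp: up_def dn_def)
        qed simp
      next
        fix z assume z': "z \<in> up (2 * \<delta>) n \<union> dn (2 * \<delta>) n"
        then have z: "z \<in> space (Q n)" by (auto simp: up_def dn_def)
        show "z \<in> E n \<union> far \<delta> n"
        proof (cases "z \<in> far \<delta> n")
          case False
          then have "\<bar>D n z / s\<bar> \<le> \<delta> / t n" using far_iff[OF z] by simp
          moreover have "t n + 2 * \<delta> / t n < S n z \<or> t n + 2 * \<delta> / t n < - S n z"
            using z' by (auto simp: up_def dn_def)
          ultimately have "t n * a < \<bar>S n z + D n z / s\<bar>"
            using ta pos unfolding two by linarith
          then show ?thesis using E_iff[OF z] by simp
        qed simp
      qed (use tn in simp)
    qed
  qed
  have sets [measurable]: "E n \<in> sets (Q n)" "up c n \<in> sets (Q n)" "dn c n \<in> sets (Q n)" "far \<delta> n \<in> sets (Q n)" for n c \<delta>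
    unfolding E_def up_def dn_def far_def by measurable
  have upper: "eventually (\<lambda>n. mills (t n) * measure (Q n) (E n) \<le>
      mills (t n) * measure (Q n) (up (- 2 * \<delta>) n) + mills (t n) * measure (Q n) (dn (- 2 * \<delta>) n) + mills (t n) * measure (Q n) (far \<delta> n)) sequentially"
    if \<delta>: "0 < \<delta>" for \<delta>
    using main[OF \<delta>]
  proof eventually_elim
    case (elim n)
    interpret Qn: prob_space "Q n" by (rule Q_prob)
    have "measure (Q n) (E n) \<le> measure (Q n) (up (- 2 * \<delta>) n \<union> dn (- 2 * \<delta>) n \<union> far \<delta> n)"
      using elim by (intro Qn.finite_measure_mono) auto
    also have "\<dots> \<le> measure (Q n) (up (- 2 * \<delta>) n \<union> dn (- 2 * \<delta>) n) + measure (Q n) (far \<delta> n)"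
      by (rule measure_Un_le) auto
    also have "\<dots> \<le> measure (Q n) (up (- 2 * \<delta>) n) + measure (Q n) (dn (- 2 * \<delta>) n) + measure (Q n) (far \<delta> n)"
      by (intro add_right_mono measure_Un_le) auto
    finally have "mills (t n) * measure (Q n) (E n) \<le> mills (t n) * (measure (Q n) (up (- 2 * \<delta>) n) + measure (Q n) (dn (- 2 * \<delta>) n) + measure (Q n) (far \<delta> n))"
      using elim by (intro mult_left_mono) (auto simp: mills_def)
    then show ?case by (simp add: algebra_simps)
  qed
  have lower: "eventually (\<lambda>n. mills (t n) * measure (Q n) (up (2 * \<delta>) n) + mills (t n) * measure (Q n) (dn (2 * \<delta>) n) - mills (t n) * measure (Q n) (far \<delta> n)
      \<le> mills (t n) * measure (Q n) (E n)) sequentially"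
    if \<delta>: "0 < \<delta>" for \<delta>
    using main[OF \<delta>]
  proof eventually_elim
    case (elim n)
    interpret Qn: prob_space "Q n" by (rule Q_prob)
    have pos: "0 < t n + 2 * \<delta> / t n" using elim \<delta> by (simp add: add_pos_pos)
    have "up (2 * \<delta>) n \<inter> dn (2 * \<delta>) n = {}" using pos by (auto simp: up_def dn_def)
    then have "measure (Q n) (up (2 * \<delta>) n) + measure (Q n) (dn (2 * \<delta>) n) = measure (Q n) (up (2 * \<delta>) n \<union> dn (2 * \<delta>) n)"
      by (intro Qn.finite_measure_Union[symmetric]) auto
    also have "\<dots> \<le> measure (Q n) (E n \<union> far \<delta> n)"
      using elim by (intro Qn.finite_measure_mono) auto
    also have "\<dots> \<le> measure (Q n) (E n) + measure (Q n) (far \<delta> n)"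
      by (rule measure_Un_le) auto
    finally have "mills (t n) * (measure (Q n) (up (2 * \<delta>) n) + measure (Q n) (dn (2 * \<delta>) n)) \<le> mills (t n) * (measure (Q n) (E n) + measure (Q n) (far \<delta> n))"
      using elim by (intro mult_left_mono) (auto simp: mills_def)
    then show ?case by (simp add: algebra_simps)
  qed
  have lim_k: "(\<lambda>k. exp (- (c / real (Suc k))) + exp (- (c / real (Suc k))) :: real) \<longlonglongrightarrow> 2" for c
  proof -
    have "(\<lambda>k. exp (- (c * inverse (real (Suc k)))) + exp (- (c * inverse (real (Suc k)))) :: real) \<longlonglongrightarrow> exp (- (c * 0)) + exp (- (c * 0))"
      by (intro tendsto_intros LIMSEQ_inverse_real_of_nat)
    then show ?thesis by (simp add: divide_inverse)
  qed
  have "(\<lambda>n. mills (t n) * measure (Q n) (E n)) \<longlonglongrightarrow> 2"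
  proof (rule order_tendstoI)
    fix b :: real assume "b < 2"
    then obtain k where k: "b < exp (- (2 / real (Suc k))) + exp (- (2 / real (Suc k)))"
      using eventually_happens'[OF sequentially_bot order_tendstoD(1)[OF lim_k[of 2]]] by blast
    let ?\<delta> = "1 / real (Suc k)"
    have \<delta>: "0 < ?\<delta>" by simp
    have "(\<lambda>n. mills (t n) * measure (Q n) (up (2 * ?\<delta>) n) + mills (t n) * measure (Q n) (dn (2 * ?\<delta>) n) - mills (t n) * measure (Q n) (far ?\<delta> n))
       \<longlonglongrightarrow> exp (- (2 * ?\<delta>)) + exp (- (2 * ?\<delta>)) - 0"
      by (intro tendsto_intros up dn far \<delta>)
    moreover have "b < exp (- (2 * ?\<delta>)) + exp (- (2 * ?\<delta>)) - 0" using k by simp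
    ultimately have "\<forall>\<^sub>F n in sequentially. b < mills (t n) * measure (Q n) (up (2 * ?\<delta>) n) + mills (t n) * measure (Q n) (dn (2 * ?\<delta>) n) - mills (t n) * measure (Q n) (far ?\<delta> n)"
      by (rule order_tendstoD)
    with lower[OF \<delta>] show "\<forall>\<^sub>F n in sequentially. b < mills (t n) * measure (Q n) (E n)"
      by eventually_elim linarith
  next
    fix b :: real assume "2 < b"
    then obtain k where k: "exp (- (- 2 / real (Suc k))) + exp (- (- 2 / real (Suc k))) < b"
      using eventually_happens'[OF sequentially_bot order_tendstoD(2)[OF lim_k[of "- 2"]]] by blast
    let ?\<delta> = "1 / real (Suc k)"
    have \<delta>: "0 < ?\<delta>" by simp
    have "(\<lambda>n. mills (t n) * measure (Q n) (up (- 2 * ?\<delta>) n) + mills (t n) * measure (Q n) (dn (- 2 * ?\<delta>) n) + mills (t n) * measure (Q n) (far ?\<delta> n))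
       \<longlonglongrightarrow> exp (- (- 2 * ?\<delta>)) + exp (- (- 2 * ?\<delta>)) + 0"
      by (intro tendsto_intros up dn far \<delta>)
    moreover have "exp (- (- 2 * ?\<delta>)) + exp (- (- 2 * ?\<delta>)) + 0 < b" using k by simp
    ultimately have "\<forall>\<^sub>F n in sequentially. mills (t n) * measure (Q n) (up (- 2 * ?\<delta>) n) + mills (t n) * measure (Q n) (dn (- 2 * ?\<delta>) n) + mills (t n) * measure (Q n) (far ?\<delta> n) < b"
      by (rule order_tendstoD)
    with upper[OF \<delta>] show "\<forall>\<^sub>F n in sequentially. mills (t n) * measure (Q n) (E n) < b"
      by eventually_elim linarith
  qed
  then show ?thesis by (simp add: E_def)
qed

end

section \<open>Non-degeneracy\<close>

text \<open>
  Symmetrisation is the U-statistic of a sample of size \<open>m\<close>. Hoeffding's decomposition thus applies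
  to the symmetrised kernel without a separate argument.
\<close>

lemma symmetrized_eq_ustat: "symmetrized m h z = ustat m h m z"
proof -
  let ?r = "\<lambda>\<pi> :: nat \<Rightarrow> nat. restrict \<pi> {..<m}"
  have inj: "inj_on ?r {\<pi>. \<pi> permutes {..<m}}"
  proof (rule inj_onI)
    fix \<pi> \<pi>' assume p: "\<pi> \<in> {\<pi>. \<pi> permutes {..<m}}" "\<pi>' \<in> {\<pi>. \<pi> permutes {..<m}}" and eq: "?r \<pi> = ?r \<pi>'"
    show "\<pi> = \<pi>'"
    proof
      fix l show "\<pi> l = \<pi>' l"
      proof (cases "l < m")
        case True
        then show ?thesis using fun_cong[OF eq, of l] by simp
      next
        case False
        then show ?thesis using p permutes_not_in[of \<pi> "{..<m}" l] permutes_not_in[of \<pi>' "{..<m}" l] by simp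
      qed
    qed
  qed
  have img: "?r ` {\<pi>. \<pi> permutes {..<m}} = inj_tuples m m"
  proof
    show "?r ` {\<pi>. \<pi> permutes {..<m}} \<subseteq> inj_tuples m m"
    proof (rule image_subsetI)
      fix \<pi> assume "\<pi> \<in> {\<pi>. \<pi> permutes {..<m}}"
      then have \<pi>: "\<pi> permutes {..<m}" by simp
      have "?r \<pi> \<in> {..<m} \<rightarrow>\<^sub>E {..<m}" using permutes_in_image[OF \<pi>] by (intro restrict_PiE_iff[THEN iffD2]) auto
      moreover have "inj_on (?r \<pi>) {..<m}" using permutes_inj_on[OF \<pi>, of "{..<m}"] by (simp add: inj_on_def)
      ultimately show "?r \<pi> \<in> inj_tuples m m" by (simp add: inj_tuples_def)
    qed
    show "inj_tuples m m \<subseteq> ?r ` {\<pi>. \<pi> permutes {..<m}}"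
    proof
      fix I assume I: "I \<in> inj_tuples m m"
      let ?\<pi> = "\<lambda>l. if l < m then I l else l"
      have inj: "inj_on ?\<pi> {..<m}" using inj_tuplesD(2)[OF I] by (simp add: inj_on_def)
      have sub: "?\<pi> ` {..<m} \<subseteq> {..<m}" using inj_tuplesD(3)[OF I] by auto
      have "bij_betw ?\<pi> {..<m} {..<m}"
        unfolding bij_betw_def using inj endo_inj_surj[OF finite_lessThan sub inj] by blast
      then have "?\<pi> permutes {..<m}" by (rule bij_imp_permutes) simp
      moreover have "I = ?r ?\<pi>" using inj_tuplesD(1)[OF I] by (auto simp: fun_eq_iff PiE_def extensional_def)
      ultimately show "I \<in> ?r ` {\<pi>. \<pi> permutes {..<m}}" by blast
    qed
  qed
  have "real (card (inj_tuples m m)) = fact m"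
    unfolding img[symmetric] card_image[OF inj] by (simp add: card_permutations)
  moreover have "(\<Sum>I\<in>inj_tuples m m. h (\<lambda>l\<in>{..<m}. z (I l))) = (\<Sum>\<pi> | \<pi> permutes {..<m}. h (\<lambda>l\<in>{..<m}. z (\<pi> l)))"
    unfolding img[symmetric] sum.reindex[OF inj] comp_def
    by (intro sum.cong refl arg_cong[where f = h]) auto
  ultimately show ?thesis by (simp add: symmetrized_def ustat_inj_tuples)
qed

context bounded_kernel
begin

text \<open>
  If \<open>hajek\<close> vanished almost everywhere, the symmetrised kernel would be \<open>theta\<close> plus a degenerate part,
  and its conditional expectation given the first argument would be the constant \<open>theta\<close>.
\<close>

lemma zeta_pos:
  assumes nd: "nondegenerate m h P" and sP: "sets P = sets borel"
  shows "0 < zeta"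
proof (rule ccontr)
  assume "\<not> 0 < zeta"
  moreover have "0 \<le> zeta" unfolding zeta_def by (intro integral_nonneg_AE) auto
  ultimately have "zeta = 0" by simp
  then have "AE x in P. (hajek x)\<^sup>2 = 0"
    unfolding zeta_def using hajek_integrable(2) by (subst (asm) integral_nonneg_eq_0_iff_AE) auto
  then have h0: "AE x in P. hajek x = 0" by simp
  interpret Qm: prob_space "Q m" by (rule Q_prob)
  define F where "F = vimage_algebra (space (Q m)) (\<lambda>z. z 0) (borel :: (real \<times> real) measure)"
  have c0: "(\<lambda>z. z 0) \<in> measurable (Q m) borel"
    unfolding measurable_cong_sets[OF refl sP, symmetric] using m by (intro measurable_component_singleton) auto
  have sub: "subalgebra (Q m) F"
    unfolding subalgebra_def F_def using c0 by (auto simp: sets_vimage_algebra2 intro: measurable_sets)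
  interpret S: finite_measure_subalgebra "Q m" F by unfold_locales (rule sub)
  let ?s = "symmetrized m h"
  have s_eq: "?s = ustat m h m" by (rule ext) (rule symmetrized_eq_ustat)
  have s_meas [measurable]: "?s \<in> borel_measurable (Q m)" unfolding s_eq by (rule ustat_meas[OF h_meas])
  have s_int: "integrable (Q m) ?s"
    unfolding s_eq by (intro Qm.integrable_const_bound[where B = B] AE_I2 ustat_meas h_meas) (simp add: ustat_bd[OF h_bd order_refl])
  have AE0: "AE z in Q m. (\<Sum>i<m. hajek (z i)) = 0"
  proof -
    have "AE z in Q m. hajek (z i) = 0" if "i < m" for i
      using that h0 by (intro AE_PiM_component) (auto intro: prob_space_axioms)
    then have "AE z in Q m. \<forall>i\<in>{..<m}. hajek (z i) = 0" by (intro AE_finite_allI) auto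
    then show ?thesis by eventually_elim simp
  qed
  have R_meas [measurable]: "ustat m remainder m \<in> borel_measurable (Q m)" by (rule ustat_meas[OF remainder_meas])
  have "AE z in Q m. real_cond_exp (Q m) F ?s z = theta"
  proof (rule S.real_cond_exp_charact)
    fix A assume A: "A \<in> sets F"
    then have AQ [measurable]: "A \<in> sets (Q m)" using sub by (auto simp: subalgebra_def)
    obtain A0 where A0: "A = (\<lambda>z. z 0) -` A0 \<inter> space (Q m)"
      using A c0 by (auto simp: F_def sets_vimage_algebra2)
    have RI: "(\<integral>z. remainder (\<lambda>l\<in>{..<m}. z (I l)) * indicator A z \<partial>Q m) = 0" if I: "I \<in> inj_tuples m m" for I
    proof -
      \<comment> \<open>\<open>l0\<close> is the slot filled by the first observation, the only one that \<open>indicator A\<close> looks at\<close>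
      obtain l0 where l0: "l0 < m" "0 \<notin> I ` ({..<m} - {l0})"
      proof (cases "\<exists>l<m. I l = 0")
        case True
        then obtain l where "l < m" "I l = 0" by blast
        then show ?thesis using inj_tuplesD(2)[OF I] by (intro that[of l]) (auto simp: inj_on_def)
      next
        case False
        then show ?thesis using m by (intro that[of 0]) auto
      qed
      show ?thesis
      proof (rule integral_degenerate_eq_0[OF prob_space_axioms remainder_meas remainder_bd remainder_degenerate[OF l0(1)] I l0(1), where B' = 1])
        show "indicator A z = (indicator A z' :: real)"
          if "z \<in> space (Q m)" "z' \<in> space (Q m)" "\<And>i. i < m \<Longrightarrow> i \<notin> I ` ({..<m} - {l0}) \<Longrightarrow> z i = z' i" for z z'
          using that(3)[of 0] that(1,2) l0(2) m by (simp add: A0 indicator_def)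
      qed (auto simp: indicator_def)
    qed
    have iRI: "integrable (Q m) (\<lambda>z. remainder (\<lambda>l\<in>{..<m}. z (I l)) * indicator A z)" if I: "I \<in> inj_tuples m m" for I
    proof (rule integrable_real_mult_indicator[OF AQ])
      show "integrable (Q m) (\<lambda>z. remainder (\<lambda>l\<in>{..<m}. z (I l)))"
        using remainder_bd[OF measurable_space[OF sel_meas[OF I]]] measurable_compose[OF sel_meas[OF I] remainder_meas]
        by (intro Qm.integrable_const_bound[where B = "(2 + 2 * real m) * B"]) auto
    qed
    have R0: "(\<integral>z. ustat m remainder m z * indicator A z \<partial>Q m) = 0"
    proof -
      have "(\<integral>z. ustat m remainder m z * indicator A z \<partial>Q m)
        = (\<integral>z. (\<Sum>I\<in>inj_tuples m m. remainder (\<lambda>l\<in>{..<m}. z (I l)) * indicator A z) / real (card (inj_tuples m m)) \<partial>Q m)"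
        unfolding ustat_inj_tuples by (simp add: sum_distrib_right)
      also have "\<dots> = (\<Sum>I\<in>inj_tuples m m. \<integral>z. remainder (\<lambda>l\<in>{..<m}. z (I l)) * indicator A z \<partial>Q m) / real (card (inj_tuples m m))"
      proof -
        have "(\<integral>z. (\<Sum>I\<in>inj_tuples m m. remainder (\<lambda>l\<in>{..<m}. z (I l)) * indicator A z) \<partial>Q m)
          = (\<Sum>I\<in>inj_tuples m m. \<integral>z. remainder (\<lambda>l\<in>{..<m}. z (I l)) * indicator A z \<partial>Q m)"
          by (rule Bochner_Integration.integral_sum) (rule iRI)
        then show ?thesis by (simp only: integral_divide_zero)
      qed
      also have "\<dots> = 0" using RI by simp
      finally show ?thesis .
    qed
    have iR: "integrable (Q m) (\<lambda>z. ustat m remainder m z * indicator A z)"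
    proof (rule integrable_real_mult_indicator[OF AQ])
      show "integrable (Q m) (ustat m remainder m)"
        by (intro Qm.integrable_const_bound[where B = "(2 + 2 * real m) * B"] AE_I2 R_meas)
           (simp add: ustat_bd[OF remainder_bd order_refl])
    qed
    have "(\<integral>z\<in>A. ?s z \<partial>Q m) = (\<integral>z. theta * indicator A z + ustat m remainder m z * indicator A z \<partial>Q m)"
      unfolding set_lebesgue_integral_def
    proof (rule integral_cong_AE)
      show "AE z in Q m. indicat_real A z *\<^sub>R ?s z = theta * indicator A z + ustat m remainder m z * indicator A z"
        using AE0
      proof eventually_elim
        fix z assume "(\<Sum>i<m. hajek (z i)) = 0"
        then have "?s z = theta + ustat m remainder m z"
          unfolding s_eq using ustat_hoeffding[of m z] by simp
        then show "indicat_real A z *\<^sub>R ?s z = theta * indicator A z + ustat m remainder m z * indicator A z"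
          by (simp add: algebra_simps)
      qed
    qed measurable
    also have "\<dots> = (\<integral>z. theta * indicator A z \<partial>Q m) + (\<integral>z. ustat m remainder m z * indicator A z \<partial>Q m)"
    proof (rule Bochner_Integration.integral_add[OF integrable_mult_right iR])
      show "integrable (Q m) (indicat_real A)" using AQ by (simp add: Qm.emeasure_eq_measure)
    qed
    finally show "(\<integral>z\<in>A. ?s z \<partial>Q m) = (\<integral>z\<in>A. theta \<partial>Q m)"
      unfolding R0 by (simp add: set_lebesgue_integral_def mult.commute)
  qed (use s_int in auto)
  then have "AE z in Q m. (real_cond_exp (Q m) F ?s z - theta)\<^sup>2 = 0" by eventually_elim simp
  moreover have E: "Qm.expectation (real_cond_exp (Q m) F ?s) = theta"
  proof -
    have "Qm.expectation (real_cond_exp (Q m) F ?s) = Qm.expectation (\<lambda>_. theta)"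
      using \<open>AE z in Q m. real_cond_exp (Q m) F ?s z = theta\<close> by (intro integral_cong_AE) auto
    then show ?thesis by (simp add: Qm.prob_space)
  qed
  ultimately have "Qm.variance (real_cond_exp (Q m) F ?s) = 0"
    unfolding E by (subst integral_cong_AE[where g = "\<lambda>_. 0"]) auto
  with nd show False unfolding nondegenerate_def Let_def F_def by simp
qed

end

section \<open>Distribution-freeness of rank statistics\<close>

lemma ustat_cong:
  assumes "\<And>i. i < n \<Longrightarrow> z i = z' i"
  shows "ustat m h n z = ustat m h n z'"
proof -
  have "(\<lambda>l\<in>{..<m}. z (I l)) = (\<lambda>l\<in>{..<m}. z' (I l))" if "I \<in> inj_tuples m n" for I
    using inj_tuplesD(3)[OF that] assms by auto
  then show ?thesis unfolding ustat_inj_tuples by simp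
qed

text \<open>
  Ranks counted from \<open>0\<close> and extended by the identity, so that they form a permutation of \<open>{..<n}\<close> in the
  sense of \<^const>\<open>permutes\<close>.
\<close>

definition rank_perm :: "nat \<Rightarrow> (nat \<Rightarrow> real) \<Rightarrow> nat \<Rightarrow> nat" where
  "rank_perm n x i = (if i < n then rank_among n x i - 1 else i)"

lemma rank_among_bounds: "i < n \<Longrightarrow> 1 \<le> rank_among n x i \<and> rank_among n x i \<le> n"
proof -
  assume i: "i < n"
  have "card {l. l < n \<and> x l \<le> x i} \<le> card {..<n}" by (intro card_mono) auto
  moreover have "card {i} \<le> card {l. l < n \<and> x l \<le> x i}" using i by (intro card_mono) auto
  ultimately show ?thesis by (simp add: rank_among_def)
qed

lemma rank_among_strict: "i' < n \<Longrightarrow> x i < x i' \<Longrightarrow> rank_among n x i < rank_among n x i'"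
  unfolding rank_among_def
proof (rule psubset_card_mono)
  assume i': "i' < n" "x i < x i'"
  have "i' \<in> {l. l < n \<and> x l \<le> x i'}" "i' \<notin> {l. l < n \<and> x l \<le> x i}" using i' by simp_all
  moreover have "{l. l < n \<and> x l \<le> x i} \<subseteq> {l. l < n \<and> x l \<le> x i'}" using i' by auto
  ultimately show "{l. l < n \<and> x l \<le> x i} \<subset> {l. l < n \<and> x l \<le> x i'}" by blast
qed simp

lemma rank_among_eq_Suc: "i < n \<Longrightarrow> rank_among n x i = Suc (rank_perm n x i)"
  using rank_among_bounds[of i n x] by (simp add: rank_perm_def)

lemma rank_perm_permutes:
  assumes "inj_on x {..<n}"
  shows "rank_perm n x permutes {..<n}"
proof (rule bij_imp_permutes)
  have "inj_on (rank_perm n x) {..<n}"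
  proof (rule inj_onI)
    fix i i' assume i: "i \<in> {..<n}" "i' \<in> {..<n}" and eq: "rank_perm n x i = rank_perm n x i'"
    have "rank_among n x i = rank_among n x i'" using i eq by (simp add: rank_among_eq_Suc)
    then have "\<not> x i < x i'" "\<not> x i' < x i"
      using rank_among_strict[of i' n x i] rank_among_strict[of i n x i'] i by auto
    then show "i = i'" using assms i by (auto simp: inj_on_def)
  qed
  moreover have "rank_perm n x ` {..<n} \<subseteq> {..<n}"
  proof (rule image_subsetI)
    fix i assume "i \<in> {..<n}"
    then show "rank_perm n x i \<in> {..<n}" using rank_among_bounds[of i n x] by (auto simp: rank_perm_def)
  qed
  ultimately show "bij_betw (rank_perm n x) {..<n} {..<n}"
    by (simp add: bij_betw_def endo_inj_surj)
qed (simp add: rank_perm_def)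

lemma rel_rank_perm:
  assumes x: "inj_on x {..<n}" and r: "r < n"
  shows "rel_rank n x y (Suc r) = Suc ((rank_perm n y \<circ> inv (rank_perm n x)) r)"
proof -
  note px = rank_perm_permutes[OF x]
  let ?i = "inv (rank_perm n x) r"
  have i: "?i < n" using permutes_in_image[OF permutes_inv[OF px], of r] r by simp
  have "(THE i. i < n \<and> rank_among n x i = Suc r) = ?i"
  proof (rule the_equality)
    show "?i < n \<and> rank_among n x ?i = Suc r"
      using i by (simp add: rank_among_eq_Suc permutes_inverses[OF px])
    fix j assume "j < n \<and> rank_among n x j = Suc r"
    then have "rank_perm n x j = r" using rank_among_eq_Suc[of j n x] by auto
    then show "j = ?i" using permutes_inverses[OF px] by metis
  qed
  then show ?thesis unfolding rel_rank_def using i by (simp add: rank_among_eq_Suc)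
qed

lemma rank_perm_of_perm:
  assumes \<tau>: "\<tau> permutes {..<n}"
  shows "rank_perm n (\<lambda>i. real (\<tau> i)) = \<tau>"
proof
  fix i
  show "rank_perm n (\<lambda>i. real (\<tau> i)) i = \<tau> i"
  proof (cases "i < n")
    case True
    then have ti: "\<tau> i < n" using permutes_in_image[OF \<tau>, of i] by simp
    have "\<tau> ` {l. l < n \<and> \<tau> l \<le> \<tau> i} = {..\<tau> i}"
    proof
      show "{..\<tau> i} \<subseteq> \<tau> ` {l. l < n \<and> \<tau> l \<le> \<tau> i}"
      proof
        fix r assume r: "r \<in> {..\<tau> i}"
        then have "r \<in> \<tau> ` {..<n}" using permutes_image[OF \<tau>] ti by auto
        then show "r \<in> \<tau> ` {l. l < n \<and> \<tau> l \<le> \<tau> i}" using r by auto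
      qed
    qed auto
    moreover have "inj_on \<tau> {l. l < n \<and> \<tau> l \<le> \<tau> i}" using permutes_inj[OF \<tau>] by (rule inj_on_subset) simp
    ultimately have "card {l. l < n \<and> \<tau> l \<le> \<tau> i} = Suc (\<tau> i)"
      using card_image[of \<tau> "{l. l < n \<and> \<tau> l \<le> \<tau> i}"] by simp
    then show ?thesis using True by (simp add: rank_perm_def rank_among_def)
  next
    case False
    then show ?thesis using permutes_not_in[OF \<tau>, of i] by (simp add: rank_perm_def)
  qed
qed

lemma rank_perm_compose:
  assumes \<pi>: "\<pi> permutes {..<n}"
  shows "rank_perm n (\<lambda>i. y (\<pi> i)) = rank_perm n y \<circ> \<pi>"
proof
  fix i
  show "rank_perm n (\<lambda>i. y (\<pi> i)) i = (rank_perm n y \<circ> \<pi>) i"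
  proof (cases "i < n")
    case True
    then have pi: "\<pi> i < n" using permutes_in_image[OF \<pi>, of i] by simp
    have "\<pi> ` {l. l < n \<and> y (\<pi> l) \<le> y (\<pi> i)} = {l. l < n \<and> y l \<le> y (\<pi> i)}"
    proof
      show "{l. l < n \<and> y l \<le> y (\<pi> i)} \<subseteq> \<pi> ` {l. l < n \<and> y (\<pi> l) \<le> y (\<pi> i)}"
      proof
        fix r assume r: "r \<in> {l. l < n \<and> y l \<le> y (\<pi> i)}"
        then have "r \<in> \<pi> ` {..<n}" using permutes_image[OF \<pi>] by auto
        then show "r \<in> \<pi> ` {l. l < n \<and> y (\<pi> l) \<le> y (\<pi> i)}" using r by auto
      qed
      show "\<pi> ` {l. l < n \<and> y (\<pi> l) \<le> y (\<pi> i)} \<subseteq> {l. l < n \<and> y l \<le> y (\<pi> i)}"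
        using permutes_in_image[OF \<pi>] by auto
    qed
    moreover have "inj_on \<pi> {l. l < n \<and> y (\<pi> l) \<le> y (\<pi> i)}" using permutes_inj[OF \<pi>] by (rule inj_on_subset) simp
    ultimately have "card {l. l < n \<and> y (\<pi> l) \<le> y (\<pi> i)} = card {l. l < n \<and> y l \<le> y (\<pi> i)}"
      using card_image[of \<pi> "{l. l < n \<and> y (\<pi> l) \<le> y (\<pi> i)}"] by simp
    then show ?thesis using True pi by (simp add: rank_perm_def rank_among_def)
  next
    case False
    then show ?thesis using permutes_not_in[OF \<pi>, of i] by (simp add: rank_perm_def)
  qed
qed

text \<open>
  Both samples have the same relative ranks, namely the permutation that takes the ranks of the first
  column to those of the second.
\<close>

lemma rank_type_ustat:
  assumes h: "rank_type m h" and n: "m < n" and x: "inj_on x {..<n}" and y: "inj_on y {..<n}"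
  shows "ustat m h n (\<lambda>i. (x i, y i)) = ustat m h n (\<lambda>i. (real i, real ((rank_perm n y \<circ> inv (rank_perm n x)) i)))"
proof -
  let ?\<tau> = "rank_perm n y \<circ> inv (rank_perm n x)"
  have \<tau>: "?\<tau> permutes {..<n}"
    by (intro permutes_compose permutes_inv rank_perm_permutes x y)
  have id: "rank_perm n (\<lambda>i. real i) = id" using rank_perm_of_perm[OF permutes_id] by simp
  have injr: "inj_on (\<lambda>i. real i) {..<n}" by (simp add: inj_on_def)
  have inj\<tau>: "inj_on (\<lambda>i. real (?\<tau> i)) {..<n}"
    using permutes_inj[OF \<tau>] by (simp add: inj_on_def inj_def)
  have nt: "no_ties n (\<lambda>i. (x i, y i))" "no_ties n (\<lambda>i. (real i, real (?\<tau> i)))"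
    using x y injr inj\<tau> by (simp_all add: no_ties_def comp_def)
  have rel: "rel_rank n x y r = rel_rank n (\<lambda>i. real i) (\<lambda>i. real (?\<tau> i)) r" if r: "r \<in> {1..n}" for r
  proof -
    obtain k where k: "r = Suc k" "k < n" using r by (cases r) auto
    show ?thesis unfolding k rel_rank_perm[OF x k(2)] rel_rank_perm[OF injr k(2)] id rank_perm_of_perm[OF \<tau>] by simp
  qed
  have comps: "fst \<circ> (\<lambda>i. (f i, g i)) = f" "snd \<circ> (\<lambda>i. (f i, g i)) = g" for f g :: "nat \<Rightarrow> real"
    by (simp_all add: comp_def)
  show ?thesis
    by (rule h[unfolded rank_type_def, rule_format, OF n nt]) (simp only: comps rel)
qed

text \<open>
  The mean of \<open>G\<close> of the statistic when the relative ranks form a uniformly random permutation.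
\<close>

definition perm_average :: "nat \<Rightarrow> kernel \<Rightarrow> nat \<Rightarrow> (real \<Rightarrow> real) \<Rightarrow> real" where
  "perm_average m h n G = (\<Sum>\<tau> | \<tau> permutes {..<n}. G (ustat m h n (\<lambda>i. (real i, real (\<tau> i))))) / fact n"

text \<open>
  Permuting the second column by \<open>\<pi>\<close> multiplies the relative rank permutation by \<open>\<pi>\<close> between two fixed
  permutations. When \<open>\<pi>\<close> runs through the symmetric group, so does the product.
\<close>

lemma sum_perm_second:
  assumes h: "rank_type m h" and n: "m < n" and x: "inj_on x {..<n}" and y: "inj_on y {..<n}"
  shows "(\<Sum>\<pi> | \<pi> permutes {..<n}. G (ustat m h n (\<lambda>i. (x i, y (\<pi> i))))) = fact n * perm_average m h n G"
proof -
  let ?p = "rank_perm n x" and ?q = "rank_perm n y"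
  let ?F = "\<lambda>\<tau>. G (ustat m h n (\<lambda>i. (real i, real (\<tau> i))))"
  have "(\<Sum>\<pi> | \<pi> permutes {..<n}. G (ustat m h n (\<lambda>i. (x i, y (\<pi> i))))) = (\<Sum>\<pi> | \<pi> permutes {..<n}. ?F (?q \<circ> (\<pi> \<circ> inv ?p)))"
  proof (intro sum.cong refl)
    fix \<pi> assume "\<pi> \<in> {\<pi>. \<pi> permutes {..<n}}"
    then have \<pi>: "\<pi> permutes {..<n}" by simp
    have "inj_on (\<lambda>i. y (\<pi> i)) {..<n}"
      using comp_inj_on[of \<pi> "{..<n}" y] y permutes_inj_on[OF \<pi>] permutes_image[OF \<pi>] by (simp add: comp_def)
    from rank_type_ustat[OF h n x this]
    show "G (ustat m h n (\<lambda>i. (x i, y (\<pi> i)))) = ?F (?q \<circ> (\<pi> \<circ> inv ?p))"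
      by (simp add: rank_perm_compose[OF \<pi>] comp_assoc)
  qed
  also have "\<dots> = (\<Sum>\<pi> | \<pi> permutes {..<n}. ?F (?q \<circ> \<pi>))"
    by (rule sum_permutations_compose_right[OF permutes_inv[OF rank_perm_permutes[OF x]], symmetric])
  also have "\<dots> = (\<Sum>\<pi> | \<pi> permutes {..<n}. ?F \<pi>)"
    by (rule setum_permutations_compose_left[OF rank_perm_permutes[OF y], symmetric])
  finally show ?thesis by (simp add: perm_average_def)
qed

lemma sum_perm_first:
  assumes h: "rank_type m h" and n: "m < n" and x: "inj_on x {..<n}" and y: "inj_on y {..<n}"
  shows "(\<Sum>\<pi> | \<pi> permutes {..<n}. G (ustat m h n (\<lambda>i. (x (\<pi> i), y i)))) = fact n * perm_average m h n G"
proof -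
  let ?p = "rank_perm n x" and ?q = "rank_perm n y"
  let ?F = "\<lambda>\<tau>. G (ustat m h n (\<lambda>i. (real i, real (\<tau> i))))"
  have p: "?p permutes {..<n}" by (rule rank_perm_permutes[OF x])
  have "(\<Sum>\<pi> | \<pi> permutes {..<n}. G (ustat m h n (\<lambda>i. (x (\<pi> i), y i)))) = (\<Sum>\<pi> | \<pi> permutes {..<n}. ?F (?q \<circ> (inv \<pi> \<circ> inv ?p)))"
  proof (intro sum.cong refl)
    fix \<pi> assume "\<pi> \<in> {\<pi>. \<pi> permutes {..<n}}"
    then have \<pi>: "\<pi> permutes {..<n}" by simp
    have "inj_on (\<lambda>i. x (\<pi> i)) {..<n}"
      using comp_inj_on[of \<pi> "{..<n}" x] x permutes_inj_on[OF \<pi>] permutes_image[OF \<pi>] by (simp add: comp_def)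
    from rank_type_ustat[OF h n this y]
    show "G (ustat m h n (\<lambda>i. (x (\<pi> i), y i))) = ?F (?q \<circ> (inv \<pi> \<circ> inv ?p))"
      by (simp add: rank_perm_compose[OF \<pi>] o_inv_distrib[OF permutes_bij[OF p] permutes_bij[OF \<pi>]])
  qed
  also have "\<dots> = (\<Sum>\<pi> | \<pi> permutes {..<n}. ?F (?q \<circ> (\<pi> \<circ> inv ?p)))"
    by (rule sum_permutations_inverse[symmetric])
  also have "\<dots> = (\<Sum>\<pi> | \<pi> permutes {..<n}. ?F (?q \<circ> \<pi>))"
    by (rule sum_permutations_compose_right[OF permutes_inv[OF p], symmetric])
  also have "\<dots> = (\<Sum>\<pi> | \<pi> permutes {..<n}. ?F \<pi>)"
    by (rule setum_permutations_compose_left[OF rank_perm_permutes[OF y], symmetric])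
  finally show ?thesis by (simp add: perm_average_def)
qed

definition atomless_law :: "real measure \<Rightarrow> bool" where
  "atomless_law \<mu> \<longleftrightarrow> prob_space \<mu> \<and> sets \<mu> = sets borel \<and> (\<forall>a. measure \<mu> {a} = 0)"

text \<open>
  For \<open>i \<noteq> j\<close> resample coordinate \<open>i\<close> alone: given the other coordinates, it hits the value of
  coordinate \<open>j\<close> with probability zero.
\<close>

lemma AE_inj_on_PiM:
  fixes n :: nat
  assumes \<mu>: "atomless_law \<mu>"
  shows "AE y in PiM {..<n} (\<lambda>_. \<mu>). inj_on y {..<n}"
proof -
  interpret \<mu>: prob_space \<mu> using \<mu> by (simp add: atomless_law_def)
  let ?Q = "PiM {..<n} (\<lambda>_. \<mu>)"
  interpret Q: prob_space ?Q by (intro prob_space_PiM) (rule \<mu>.prob_space_axioms)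
  have s [measurable_cong]: "sets \<mu> = sets borel" using \<mu> by (simp add: atomless_law_def)
  have ne: "AE y in ?Q. y i \<noteq> y j" if ij: "i < n" "j < n" "i \<noteq> j" for i j
  proof -
    have ci [measurable]: "(\<lambda>y. y i) \<in> borel_measurable ?Q" "(\<lambda>y. y j) \<in> borel_measurable ?Q"
      using ij measurable_component_singleton[of _ "{..<n}" "\<lambda>_. \<mu>"] measurable_cong_sets[OF refl s] by auto
    let ?A = "{y \<in> space ?Q. y i = y j}"
    have A: "?A \<in> sets ?Q" by measurable
    have "measure ?Q ?A = (\<integral>y. indicator ?A y \<partial>?Q)"
      using A by (simp add: sets.Int_space_eq2)
    also have "\<dots> = (\<integral>y. (\<integral>y'. indicator ?A (\<lambda>k\<in>{..<n}. if k \<in> {i} then y' k else y k) \<partial>?Q) \<partial>?Q)"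
    proof (rule integral_PiM_splice[where B = 1])
      show "indicator ?A \<in> borel_measurable ?Q" by (rule borel_measurable_indicator[OF A])
    qed (auto simp: indicator_def intro: \<mu>.prob_space_axioms)
    also have "\<dots> = (\<integral>y. 0 \<partial>?Q)"
    proof (rule Bochner_Integration.integral_cong[OF refl])
      fix y assume y: "y \<in> space ?Q"
      have "(\<integral>y'. indicator ?A (\<lambda>k\<in>{..<n}. if k \<in> {i} then y' k else y k) \<partial>?Q) = (\<integral>y'. indicator {y j} (y' i) \<partial>?Q :: real)"
      proof (rule Bochner_Integration.integral_cong[OF refl])
        fix y' assume y': "y' \<in> space ?Q"
        have "(\<lambda>k\<in>{..<n}. if k \<in> {i} then y' k else y k) \<in> space ?Q"
          using y y' by (auto simp: space_PiM PiE_def Pi_def)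
        then show "indicator ?A (\<lambda>k\<in>{..<n}. if k \<in> {i} then y' k else y k) = (indicator {y j} (y' i) :: real)"
          using ij by (simp add: indicator_def)
      qed
      also have "\<dots> = (\<integral>a. indicator {y j} a \<partial>distr ?Q \<mu> (\<lambda>y'. y' i))"
        using ij s by (intro integral_distr[symmetric]) (auto simp: measurable_cong_sets[OF s refl])
      also have "\<dots> = (\<integral>a. indicator {y j} a \<partial>\<mu>)"
        using ij by (subst distr_PiM_component) (auto intro: \<mu>.prob_space_axioms)
      also have "\<dots> = 0"
        using \<mu> s sets_eq_imp_space_eq[OF s] by (simp add: atomless_law_def)
      finally show "(\<integral>y'. indicator ?A (\<lambda>k\<in>{..<n}. if k \<in> {i} then y' k else y k) \<partial>?Q) = (0 :: real)" .
    qed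
    finally have "measure ?Q ?A = 0" by simp
    then have "?A \<in> null_sets ?Q" using A by (simp add: null_sets_def Q.emeasure_eq_measure)
    from AE_not_in[OF this] AE_space show ?thesis by eventually_elim auto
  qed
  have "AE y in ?Q. \<forall>i\<in>{..<n}. \<forall>j\<in>{..<n} - {i}. y i \<noteq> y j"
    using ne by (auto intro!: AE_finite_allI)
  then show ?thesis by eventually_elim (auto simp: inj_on_def)
qed

lemma integral_PiM_permute:
  fixes f :: "(nat \<Rightarrow> real) \<Rightarrow> real"
  assumes \<mu>: "prob_space \<mu>" and \<pi>: "\<pi> permutes {..<n}" and f: "f \<in> borel_measurable (PiM {..<n} (\<lambda>_. \<mu>))"
  shows "(\<integral>y. f (\<lambda>i\<in>{..<n}. y (\<pi> i)) \<partial>PiM {..<n} (\<lambda>_. \<mu>)) = (\<integral>y. f y \<partial>PiM {..<n} (\<lambda>_. \<mu>))"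
proof -
  let ?Q = "PiM {..<n} (\<lambda>_. \<mu>)"
  have im: "\<pi> i \<in> {..<n}" if "i < n" for i using permutes_in_image[OF \<pi>, of i] that by simp
  have "distr ?Q ?Q (\<lambda>y. \<lambda>i\<in>{..<n}. y (\<pi> i)) = ?Q"
    using im by (intro distr_PiM_reindex \<mu> permutes_inj_on[OF \<pi>]) auto
  then have "(\<integral>y. f y \<partial>?Q) = (\<integral>y. f y \<partial>distr ?Q ?Q (\<lambda>y. \<lambda>i\<in>{..<n}. y (\<pi> i)))" by simp
  also have "\<dots> = (\<integral>y. f (\<lambda>i\<in>{..<n}. y (\<pi> i)) \<partial>?Q)"
    using im f by (intro integral_distr measurable_restrict measurable_component_singleton) auto
  finally show ?thesis by simp
qed

text \<open>
  An i.i.d. sample is exchangeable, so the integrand may be averaged over all permutations of the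
  sample. If that average is constant on samples without ties, it is the value of the integral.
\<close>

lemma integral_permutation_average:
  fixes f :: "(nat \<Rightarrow> real) \<Rightarrow> real"
  assumes \<mu>: "atomless_law \<mu>" and f: "f \<in> borel_measurable (PiM {..<n} (\<lambda>_. \<mu>))" "\<And>y. \<bar>f y\<bar> \<le> 1"
    and avg: "\<And>y. inj_on y {..<n} \<Longrightarrow> (\<Sum>\<pi> | \<pi> permutes {..<n}. f (\<lambda>i\<in>{..<n}. y (\<pi> i))) = fact n * c"
  shows "(\<integral>y. f y \<partial>PiM {..<n} (\<lambda>_. \<mu>)) = c"
proof -
  let ?Q = "PiM {..<n} (\<lambda>_. \<mu>)"
  have P: "prob_space \<mu>" using \<mu> by (simp add: atomless_law_def)
  interpret Q: prob_space ?Q by (intro prob_space_PiM) (rule P)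
  note [measurable] = f(1)
  have perm_meas: "(\<lambda>y. \<lambda>i\<in>{..<n}. y (\<pi> i)) \<in> measurable ?Q ?Q" if "\<pi> permutes {..<n}" for \<pi>
    using permutes_in_image[OF that] by (intro measurable_restrict measurable_component_singleton) auto
  have int: "integrable ?Q (\<lambda>y. f (\<lambda>i\<in>{..<n}. y (\<pi> i)))" if "\<pi> permutes {..<n}" for \<pi>
    using f(2) by (intro Q.integrable_const_bound[where B = 1] measurable_compose[OF perm_meas[OF that] f(1)]) auto
  have "fact n * (\<integral>y. f y \<partial>?Q) = (\<Sum>\<pi> | \<pi> permutes {..<n}. \<integral>y. f y \<partial>?Q)"
    by (simp add: card_permutations)
  also have "\<dots> = (\<Sum>\<pi> | \<pi> permutes {..<n}. \<integral>y. f (\<lambda>i\<in>{..<n}. y (\<pi> i)) \<partial>?Q)"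
    using integral_PiM_permute[OF P _ f(1)] by (intro sum.cong) auto
  also have "\<dots> = (\<integral>y. (\<Sum>\<pi> | \<pi> permutes {..<n}. f (\<lambda>i\<in>{..<n}. y (\<pi> i))) \<partial>?Q)"
    using int by (intro Bochner_Integration.integral_sum[symmetric]) auto
  also have "\<dots> = (\<integral>y. fact n * c \<partial>?Q)"
  proof (rule integral_cong_AE)
    show "AE y in ?Q. (\<Sum>\<pi> | \<pi> permutes {..<n}. f (\<lambda>i\<in>{..<n}. y (\<pi> i))) = fact n * c"
      using AE_inj_on_PiM[OF \<mu>, of n] by eventually_elim (rule avg)
    show "(\<lambda>y. \<Sum>\<pi> | \<pi> permutes {..<n}. f (\<lambda>i\<in>{..<n}. y (\<pi> i))) \<in> borel_measurable ?Q"
      using int by (intro borel_measurable_sum) auto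
  qed simp
  also have "\<dots> = fact n * c" by (simp add: Q.prob_space)
  finally show ?thesis by simp
qed

lemma ustat_columns_measurable:
  assumes h: "h \<in> borel_measurable (PiM {..<m} (\<lambda>_. borel))"
    and x: "x \<in> measurable N (PiM {..<n} (\<lambda>_. borel))" and y: "y \<in> measurable N (PiM {..<n} (\<lambda>_. borel))"
  shows "(\<lambda>\<omega>. ustat m h n (\<lambda>i. (x \<omega> i, y \<omega> i))) \<in> borel_measurable N"
proof -
  have c: "(\<lambda>\<omega>. (x \<omega> i, y \<omega> i)) \<in> borel_measurable N" if "i < n" for i
    using that measurable_compose[OF x measurable_component_singleton[of i]] measurable_compose[OF y measurable_component_singleton[of i]]
    by (intro borel_measurable_Pair) auto
  have "(\<lambda>\<omega>. \<lambda>l\<in>{..<m}. (x \<omega> (I l), y \<omega> (I l))) \<in> measurable N (PiM {..<m} (\<lambda>_. borel))" if "I \<in> inj_tuples m n" for I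
    using inj_tuplesD(3)[OF that] by (intro measurable_restrict c) auto
  then show ?thesis
    unfolding ustat_inj_tuples by (intro borel_measurable_divide borel_measurable_sum borel_measurable_const measurable_compose[OF _ h]) auto
qed

text \<open>
  The value depends neither on the fixed column nor on the atomless law of the other one. This is the
  source of both distribution-freeness and pairwise independence.
\<close>

lemma rank_ustat_given_first:
  assumes h: "rank_type m h" "h \<in> borel_measurable (PiM {..<m} (\<lambda>_. borel))" and n: "m < n"
    and \<mu>: "atomless_law \<mu>" and A: "A \<in> sets borel" and x: "inj_on x {..<n}"
  shows "(\<integral>y. indicator A (ustat m h n (\<lambda>i. (x i, y i))) \<partial>PiM {..<n} (\<lambda>_. \<mu>)) = perm_average m h n (indicator A)"
proof (rule integral_permutation_average[OF \<mu>])
  have s: "sets \<mu> = sets borel" using \<mu> by (simp add: atomless_law_def)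
  have id: "(\<lambda>y. y) \<in> measurable (PiM {..<n} (\<lambda>_. \<mu>)) (PiM {..<n} (\<lambda>_. borel))"
    using s by (intro measurable_ident_sets sets_PiM_cong) auto
  have "(\<lambda>y. ustat m h n (\<lambda>i. (restrict x {..<n} i, y i))) \<in> borel_measurable (PiM {..<n} (\<lambda>_. \<mu>))"
    by (intro ustat_columns_measurable h id measurable_const) (auto simp: space_PiM simp del: restrict_apply)
  moreover have "ustat m h n (\<lambda>i. (restrict x {..<n} i, y i)) = ustat m h n (\<lambda>i. (x i, y i))" for y
    by (rule ustat_cong) simp
  ultimately show "(\<lambda>y. indicator A (ustat m h n (\<lambda>i. (x i, y i)))) \<in> borel_measurable (PiM {..<n} (\<lambda>_. \<mu>))"
    using A by (intro borel_measurable_indicator') auto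
  show "\<bar>indicator A (ustat m h n (\<lambda>i. (x i, y i)))\<bar> \<le> (1 :: real)" for y by (simp add: indicator_def)
  fix y :: "nat \<Rightarrow> real" assume y: "inj_on y {..<n}"
  have "ustat m h n (\<lambda>i. (x i, (\<lambda>i\<in>{..<n}. y (\<pi> i)) i)) = ustat m h n (\<lambda>i. (x i, y (\<pi> i)))" for \<pi>
    by (rule ustat_cong) simp
  then show "(\<Sum>\<pi> | \<pi> permutes {..<n}. indicator A (ustat m h n (\<lambda>i. (x i, (\<lambda>i\<in>{..<n}. y (\<pi> i)) i)))) = fact n * perm_average m h n (indicator A)"
    using sum_perm_second[OF h(1) n x y, of "indicator A"] by simp
qed

lemma rank_ustat_given_second:
  assumes h: "rank_type m h" "h \<in> borel_measurable (PiM {..<m} (\<lambda>_. borel))" and n: "m < n"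
    and \<mu>: "atomless_law \<mu>" and A: "A \<in> sets borel" and y: "inj_on y {..<n}"
  shows "(\<integral>x. indicator A (ustat m h n (\<lambda>i. (x i, y i))) \<partial>PiM {..<n} (\<lambda>_. \<mu>)) = perm_average m h n (indicator A)"
proof (rule integral_permutation_average[OF \<mu>])
  have s: "sets \<mu> = sets borel" using \<mu> by (simp add: atomless_law_def)
  have id: "(\<lambda>y. y) \<in> measurable (PiM {..<n} (\<lambda>_. \<mu>)) (PiM {..<n} (\<lambda>_. borel))"
    using s by (intro measurable_ident_sets sets_PiM_cong) auto
  have "(\<lambda>x. ustat m h n (\<lambda>i. (x i, restrict y {..<n} i))) \<in> borel_measurable (PiM {..<n} (\<lambda>_. \<mu>))"
    by (intro ustat_columns_measurable h id measurable_const) (auto simp: space_PiM simp del: restrict_apply)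
  moreover have "ustat m h n (\<lambda>i. (x i, restrict y {..<n} i)) = ustat m h n (\<lambda>i. (x i, y i))" for x
    by (rule ustat_cong) simp
  ultimately show "(\<lambda>x. indicator A (ustat m h n (\<lambda>i. (x i, y i)))) \<in> borel_measurable (PiM {..<n} (\<lambda>_. \<mu>))"
    using A by (intro borel_measurable_indicator') auto
  show "\<bar>indicator A (ustat m h n (\<lambda>i. (x i, y i)))\<bar> \<le> (1 :: real)" for x by (simp add: indicator_def)
  fix x :: "nat \<Rightarrow> real" assume x: "inj_on x {..<n}"
  have "ustat m h n (\<lambda>i. ((\<lambda>i\<in>{..<n}. x (\<pi> i)) i, y i)) = ustat m h n (\<lambda>i. (x (\<pi> i), y i))" for \<pi>
    by (rule ustat_cong) simp
  then show "(\<Sum>\<pi> | \<pi> permutes {..<n}. indicator A (ustat m h n (\<lambda>i. ((\<lambda>i\<in>{..<n}. x (\<pi> i)) i, y i)))) = fact n * perm_average m h n (indicator A)"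
    using sum_perm_first[OF h(1) n x y, of "indicator A"] by simp
qed

section \<open>Independence of the coordinate columns\<close>

abbreviation col_space :: "nat \<Rightarrow> (nat \<Rightarrow> real) measure" where
  "col_space n \<equiv> PiM {..<n} (\<lambda>_. borel)"

definition sample_column :: "nat \<Rightarrow> (nat \<Rightarrow> nat \<Rightarrow> 'a \<Rightarrow> real) \<Rightarrow> nat \<Rightarrow> 'a \<Rightarrow> nat \<Rightarrow> real" where
  "sample_column n Z j \<omega> = (\<lambda>i\<in>{..<n}. Z i j \<omega>)"

context prob_space
begin

text \<open>
  Independence of the rows and of the entries within each row gives independence of all entries. This
  is read off from the joint law on boxes, which factorises over rows and then over columns.
\<close>

lemma entries_of_independent_rows:
  fixes Z :: "nat \<Rightarrow> nat \<Rightarrow> 'a \<Rightarrow> real"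
  assumes n: "0 < n" and d: "0 < d"
    and rows: "indep_vars (\<lambda>_. PiM {..<d} (\<lambda>_. borel)) (\<lambda>i. coord_vec d (Z i)) {..<n}"
    and law: "\<And>i. i < n \<Longrightarrow> distr M (PiM {..<d} (\<lambda>_. borel)) (coord_vec d (Z i)) = PiM {..<d} \<mu>"
    and \<mu>: "\<And>j. prob_space (\<mu> j)" "\<And>j. sets (\<mu> j) = sets borel"
  shows "indep_vars (\<lambda>_. borel) (\<lambda>(i, j). Z i j) ({..<n} \<times> {..<d})"
    and "\<And>i j. i < n \<Longrightarrow> j < d \<Longrightarrow> random_variable borel (Z i j)"
    and "\<And>i j. i < n \<Longrightarrow> j < d \<Longrightarrow> distr M borel (Z i j) = \<mu> j"
proof -
  let ?S = "{..<n} \<times> {..<d}" and ?R = "PiM {..<d} (\<lambda>_. borel :: real measure)"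
  have rv_row: "random_variable ?R (coord_vec d (Z i))" if "i < n" for i
    using rows that by (auto simp: indep_vars_def)
  show rv: "random_variable borel (Z i j)" if ij: "i < n" "j < d" for i j
  proof -
    have "(\<lambda>\<omega>. coord_vec d (Z i) \<omega> j) \<in> borel_measurable M"
      using measurable_compose[OF rv_row[OF ij(1)] measurable_component_singleton[of j]] ij by simp
    then show ?thesis using ij by (simp add: coord_vec_def)
  qed
  show dist: "distr M borel (Z i j) = \<mu> j" if ij: "i < n" "j < d" for i j
  proof -
    have "distr M borel (Z i j) = distr M (\<mu> j) (\<lambda>\<omega>. coord_vec d (Z i) \<omega> j)"
      using ij by (intro distr_cong) (auto simp: \<mu> coord_vec_def)
    also have "\<dots> = distr (distr M ?R (coord_vec d (Z i))) (\<mu> j) (\<lambda>v. v j)"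
    proof (subst distr_distr[OF _ rv_row[OF ij(1)]])
      show "(\<lambda>v. v j) \<in> ?R \<rightarrow>\<^sub>M \<mu> j"
        unfolding measurable_cong_sets[OF refl \<mu>(2)] using ij by (intro measurable_component_singleton) auto
    qed (simp add: comp_def)
    also have "\<dots> = \<mu> j" unfolding law[OF ij(1)] using ij \<mu> by (intro distr_PiM_component) auto
    finally show ?thesis .
  qed
  have ne: "?S \<noteq> {}" using n d by auto
  have rvS: "random_variable borel (case s of (i, j) \<Rightarrow> Z i j)" if "s \<in> ?S" for s
    using that rv by auto
  have "distr M (PiM ?S (\<lambda>_. borel)) (\<lambda>\<omega>. \<lambda>s\<in>?S. (case s of (i, j) \<Rightarrow> Z i j) \<omega>) = PiM ?S (\<lambda>s. distr M borel (case s of (i, j) \<Rightarrow> Z i j))"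
  proof -
    interpret PS: product_sigma_finite "\<lambda>s. \<mu> (snd s)" by (simp add: product_sigma_finite_def \<mu> prob_space_imp_sigma_finite)
    interpret PD: product_sigma_finite \<mu> by (simp add: product_sigma_finite_def \<mu> prob_space_imp_sigma_finite)
    let ?F = "\<lambda>\<omega>. \<lambda>s\<in>?S. (case s of (i, j) \<Rightarrow> Z i j) \<omega>"
    have F: "?F \<in> measurable M (PiM ?S (\<lambda>_. borel))" using rvS by (intro measurable_restrict) auto
    have "distr M (PiM ?S (\<lambda>_. borel)) ?F = PiM ?S (\<lambda>s. \<mu> (snd s))"
    proof (rule PS.PiM_eqI)
      show "sets (distr M (PiM ?S (\<lambda>_. borel)) ?F) = sets (PiM ?S (\<lambda>s. \<mu> (snd s)))"
        by (auto intro!: sets_PiM_cong simp: \<mu>)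
      fix A assume A: "\<And>s. s \<in> ?S \<Longrightarrow> A s \<in> sets (\<mu> (snd s))"
      then have A': "A (i, j) \<in> sets borel" if "i < n" "j < d" for i j using that \<mu>(2) by force
      define Row where "Row i = PiE {..<d} (\<lambda>j. A (i, j))" for i
      have Row: "Row i \<in> sets ?R" if "i < n" for i
        unfolding Row_def using that A' by (intro sets_PiM_I_finite) auto
      have "emeasure (distr M (PiM ?S (\<lambda>_. borel)) ?F) (PiE ?S A) = emeasure M (?F -` PiE ?S A \<inter> space M)"
        using A' by (intro emeasure_distr F sets_PiM_I_finite) auto
      also have "?F -` PiE ?S A \<inter> space M = (\<Inter>i\<in>{..<n}. coord_vec d (Z i) -` Row i \<inter> space M)"
        using n by (auto simp: Row_def coord_vec_def PiE_iff)
      also have "emeasure M \<dots> = (\<Prod>i<n. emeasure M (coord_vec d (Z i) -` Row i \<inter> space M))"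
        unfolding emeasure_eq_measure using n Row
        by (subst indep_varsD_finite[OF rows]) (auto simp: prod_ennreal)
      also have "\<dots> = (\<Prod>i<n. emeasure (PiM {..<d} \<mu>) (Row i))"
      proof (rule prod.cong[OF refl])
        fix i assume i: "i \<in> {..<n}"
        then have "emeasure M (coord_vec d (Z i) -` Row i \<inter> space M) = emeasure (distr M ?R (coord_vec d (Z i))) (Row i)"
          using Row rv_row by (intro emeasure_distr[symmetric]) auto
        then show "emeasure M (coord_vec d (Z i) -` Row i \<inter> space M) = emeasure (PiM {..<d} \<mu>) (Row i)"
          using law i by simp
      qed
      also have "\<dots> = (\<Prod>i<n. \<Prod>j<d. emeasure (\<mu> j) (A (i, j)))"
        unfolding Row_def using A' \<mu>(2) by (intro prod.cong refl PD.emeasure_PiM) auto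
      also have "\<dots> = (\<Prod>s\<in>?S. emeasure (\<mu> (snd s)) (A s))"
        by (simp add: prod.cartesian_product split_beta)
      finally show "emeasure (distr M (PiM ?S (\<lambda>_. borel)) ?F) (PiE ?S A) = (\<Prod>s\<in>?S. emeasure (\<mu> (snd s)) (A s))" .
    qed simp
    also have "\<dots> = PiM ?S (\<lambda>s. distr M borel (case s of (i, j) \<Rightarrow> Z i j))"
      using dist by (intro PiM_cong) auto
    finally show ?thesis .
  qed
  then show "indep_vars (\<lambda>_. borel) (\<lambda>(i, j). Z i j) ?S"
    using rvS by (subst indep_vars_iff_distr_eq_PiM'[OF ne]) auto
qed

text \<open>
  The entries, being jointly independent, can be regrouped by columns.
\<close>

lemma columns_of_independent_rows:
  fixes Z :: "nat \<Rightarrow> nat \<Rightarrow> 'a \<Rightarrow> real"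
  assumes n: "0 < n" and d: "0 < d"
    and rows: "indep_vars (\<lambda>_. PiM {..<d} (\<lambda>_. borel)) (\<lambda>i. coord_vec d (Z i)) {..<n}"
    and law: "\<And>i. i < n \<Longrightarrow> distr M (PiM {..<d} (\<lambda>_. borel)) (coord_vec d (Z i)) = PiM {..<d} \<mu>"
    and \<mu>: "\<And>j. prob_space (\<mu> j)" "\<And>j. sets (\<mu> j) = sets borel"
  shows "indep_vars (\<lambda>_. col_space n) (sample_column n Z) {..<d}"
    and "\<And>j. j < d \<Longrightarrow> distr M (col_space n) (sample_column n Z j) = PiM {..<n} (\<lambda>_. \<mu> j)"
proof -
  let ?S = "{..<n} \<times> {..<d}"
  note entries = entries_of_independent_rows[OF assms]
  have "indep_vars (\<lambda>j. PiM ({..<n} \<times> {j}) (\<lambda>_. borel)) (\<lambda>j \<omega>. restrict (\<lambda>s. (case s of (i, j) \<Rightarrow> Z i j) \<omega>) ({..<n} \<times> {j})) {..<d}"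
    by (rule indep_vars_restrict[OF entries(1)]) (auto simp: disjoint_family_on_def)
  then have "indep_vars (\<lambda>_. col_space n) (\<lambda>j \<omega>. \<lambda>i\<in>{..<n}. restrict (\<lambda>s. (case s of (i, j) \<Rightarrow> Z i j) \<omega>) ({..<n} \<times> {j}) (i, j)) {..<d}"
    by (rule indep_vars_compose2) (intro measurable_restrict measurable_component_singleton, auto)
  moreover have "(\<lambda>j \<omega>. \<lambda>i\<in>{..<n}. restrict (\<lambda>s. (case s of (i, j) \<Rightarrow> Z i j) \<omega>) ({..<n} \<times> {j}) (i, j)) = sample_column n Z"
    by (auto simp: sample_column_def fun_eq_iff)
  ultimately show "indep_vars (\<lambda>_. col_space n) (sample_column n Z) {..<d}" by simp
  fix j assume j: "j < d"
  have "indep_vars (\<lambda>_. borel) (\<lambda>i \<omega>. coord_vec d (Z i) \<omega> j) {..<n}"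
    using j by (intro indep_vars_compose2[OF rows, of "\<lambda>_ v. v j"]) auto
  then have "indep_vars (\<lambda>_. borel) (\<lambda>i. Z i j) {..<n}" using j by (simp add: coord_vec_def)
  then have "distr M (col_space n) (\<lambda>\<omega>. \<lambda>i\<in>{..<n}. Z i j \<omega>) = PiM {..<n} (\<lambda>i. distr M borel (Z i j))"
    using n j entries(2) by (subst (asm) indep_vars_iff_distr_eq_PiM') auto
  also have "\<dots> = PiM {..<n} (\<lambda>_. \<mu> j)" using j entries(3) by (intro PiM_cong) auto
  finally show "distr M (col_space n) (sample_column n Z j) = PiM {..<n} (\<lambda>_. \<mu> j)"
    by (simp add: sample_column_def[abs_def])
qed

text \<open>
  Fubini's theorem for the joint law. The two variables have the same type as \<^const>\<open>indep_var\<close> requires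
  it; families of columns over different index sets satisfy this.
\<close>

lemma integral_independent_pair:
  fixes f :: "'b \<times> 'b \<Rightarrow> real"
  assumes ind: "indep_var S X T Y" and f: "f \<in> borel_measurable (S \<Otimes>\<^sub>M T)" "\<And>z. \<bar>f z\<bar> \<le> 1"
  shows "expectation (\<lambda>\<omega>. f (X \<omega>, Y \<omega>)) = (\<integral>x. (\<integral>y. f (x, y) \<partial>distr M T Y) \<partial>distr M S X)"
proof -
  have rv: "random_variable S X" "random_variable T Y" using ind by (auto dest: indep_var_rv1 indep_var_rv2)
  interpret X: prob_space "distr M S X" using rv by (intro prob_space_distr)
  interpret Y: prob_space "distr M T Y" using rv by (intro prob_space_distr)
  interpret XY: pair_prob_space "distr M S X" "distr M T Y" by unfold_locales
  have fm: "f \<in> borel_measurable (distr M S X \<Otimes>\<^sub>M distr M T Y)"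
    using f(1) by (simp cong: measurable_cong_sets add: sets_pair_measure_cong[of "distr M S X" S "distr M T Y" T])
  have "expectation (\<lambda>\<omega>. f (X \<omega>, Y \<omega>)) = (\<integral>z. f z \<partial>distr M (S \<Otimes>\<^sub>M T) (\<lambda>\<omega>. (X \<omega>, Y \<omega>)))"
    using rv f(1) by (intro integral_distr[symmetric]) auto
  also have "distr M (S \<Otimes>\<^sub>M T) (\<lambda>\<omega>. (X \<omega>, Y \<omega>)) = distr M S X \<Otimes>\<^sub>M distr M T Y"
    using ind by (simp add: indep_var_distribution_eq)
  also have "(\<integral>z. f z \<partial>(distr M S X \<Otimes>\<^sub>M distr M T Y)) = (\<integral>x. (\<integral>y. f (x, y) \<partial>distr M T Y) \<partial>distr M S X)"
    using fm f(2) by (intro XY.integral_fst'[symmetric] XY.integrable_const_bound[where B = 1]) auto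
  finally show ?thesis .
qed

lemma indep_var_of_columns:
  assumes ind: "indep_vars (\<lambda>_. N) C J" and ab: "a \<in> J" "b \<in> J" "a \<noteq> b"
  shows "indep_var N (C a) N (C b)"
proof -
  have "indep_var (PiM {a} (\<lambda>_. N)) (\<lambda>\<omega>. restrict (\<lambda>i. C i \<omega>) {a}) (PiM {b} (\<lambda>_. N)) (\<lambda>\<omega>. restrict (\<lambda>i. C i \<omega>) {b})"
    by (rule indep_var_restrict[OF ind]) (use ab in auto)
  from indep_var_compose[OF this, of "\<lambda>g. g a" N "\<lambda>g. g b" N]
  show ?thesis by (simp add: comp_def)
qed

text \<open>
  Given the shared column \<open>C a\<close>, the two factors are independent with conditional means that are almost
  surely equal to the constant \<open>p\<close>.
\<close>

lemma shared_column_independence: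
  assumes ind: "indep_vars (\<lambda>_. N) C J" and abc: "a \<in> J" "b \<in> J" "c \<in> J" "a \<noteq> b" "a \<noteq> c" "b \<noteq> c"
    and f: "f \<in> borel_measurable (N \<Otimes>\<^sub>M N)" "\<And>z. \<bar>f z\<bar> \<le> (1 :: real)"
    and g: "g \<in> borel_measurable (N \<Otimes>\<^sub>M N)" "\<And>z. \<bar>g z\<bar> \<le> (1 :: real)"
    and fp: "AE x in distr M N (C a). (\<integral>y. f (x, y) \<partial>distr M N (C b)) = p"
    and gp: "AE x in distr M N (C a). (\<integral>y. g (x, y) \<partial>distr M N (C c)) = p"
  shows "expectation (\<lambda>\<omega>. f (C a \<omega>, C b \<omega>) * g (C a \<omega>, C c \<omega>)) = p * p"
proof -
  have rv: "random_variable N (C i)" if "i \<in> J" for i using ind that by (auto simp: indep_vars_def)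
  note [measurable] = rv[OF abc(1)] rv[OF abc(2)] rv[OF abc(3)] f(1) g(1)
  interpret A: prob_space "distr M N (C a)" by (intro prob_space_distr rv abc)
  interpret Bp: prob_space "distr M N (C b)" by (intro prob_space_distr rv abc)
  interpret Cp: prob_space "distr M N (C c)" by (intro prob_space_distr rv abc)
  let ?A = "PiM {a} (\<lambda>_. N)" and ?BC = "PiM {b, c} (\<lambda>_. N)"
  \<comment> \<open>one column and two columns, both seen as families so that they have the same type\<close>
  let ?X = "\<lambda>\<omega>. restrict (\<lambda>i. C i \<omega>) {a}" and ?Y = "\<lambda>\<omega>. restrict (\<lambda>i. C i \<omega>) {b, c}"
  let ?H = "\<lambda>(u, v). f (u a, v b) * g (u a, v c)"
  have X: "?X \<in> measurable M ?A" and Y: "?Y \<in> measurable M ?BC"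
    using rv abc by (auto intro!: measurable_restrict)
  have H: "?H \<in> borel_measurable (?A \<Otimes>\<^sub>M ?BC)" by measurable
  have indXY: "indep_var ?A ?X ?BC ?Y"
    by (rule indep_var_restrict[OF ind]) (use abc in auto)
  have H_bd: "\<bar>?H z\<bar> \<le> 1" for z
    using mult_mono[OF f(2) g(2)] by (auto simp: split_beta abs_mult)
  let ?I = "\<lambda>x. (\<integral>y. f (x, y) \<partial>distr M N (C b)) * (\<integral>w. g (x, w) \<partial>distr M N (C c))"
  have I [measurable]: "?I \<in> borel_measurable N" by measurable
  have "expectation (\<lambda>\<omega>. f (C a \<omega>, C b \<omega>) * g (C a \<omega>, C c \<omega>)) = expectation (\<lambda>\<omega>. ?H (?X \<omega>, ?Y \<omega>))" by simp
  also have "\<dots> = (\<integral>u. (\<integral>v. ?H (u, v) \<partial>distr M ?BC ?Y) \<partial>distr M ?A ?X)"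
    by (rule integral_independent_pair[OF indXY H H_bd])
  also have "\<dots> = (\<integral>u. ?I (u a) \<partial>distr M ?A ?X)"
  proof (rule Bochner_Integration.integral_cong[OF refl])
    fix u assume "u \<in> space (distr M ?A ?X)"
    then have u: "u a \<in> space N" by (auto simp: space_PiM PiE_def)
    have mx [measurable]: "(\<lambda>y. f (u a, y)) \<in> borel_measurable N" "(\<lambda>w. g (u a, w)) \<in> borel_measurable N"
      using u by measurable
    let ?G = "\<lambda>z. f (u a, fst z) * g (u a, snd z)"
    have G: "?G \<in> borel_measurable (N \<Otimes>\<^sub>M N)" by measurable
    have "(\<integral>v. ?H (u, v) \<partial>distr M ?BC ?Y) = expectation (\<lambda>\<omega>. ?G (C b \<omega>, C c \<omega>))"
      by (subst integral_distr[OF Y]) auto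
    also have "\<dots> = (\<integral>y. (\<integral>w. ?G (y, w) \<partial>distr M N (C c)) \<partial>distr M N (C b))"
      using mult_mono[OF f(2) g(2)]
      by (intro integral_independent_pair[OF indep_var_of_columns[OF ind abc(2,3,6)] G]) (auto simp: abs_mult)
    finally show "(\<integral>v. ?H (u, v) \<partial>distr M ?BC ?Y) = ?I (u a)" by simp
  qed
  also have "\<dots> = expectation (\<lambda>\<omega>. ?I (C a \<omega>))"
    by (subst integral_distr[OF X]) auto
  also have "\<dots> = (\<integral>x. ?I x \<partial>distr M N (C a))"
    by (rule integral_distr[symmetric]) measurable
  also have "\<dots> = (\<integral>x. p * p \<partial>distr M N (C a))"
  proof (rule integral_cong_AE)
    show "AE x in distr M N (C a). (\<integral>y. f (x, y) \<partial>distr M N (C b)) * (\<integral>w. g (x, w) \<partial>distr M N (C c)) = p * p"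
      using fp gp by eventually_elim simp
  qed measurable
  finally show ?thesis using A.prob_space by simp
qed

end

section \<open>Poisson approximation for dissociated events\<close>

text \<open>
  Apply the mean value theorem to \<open>exp (- c s) \<psi> s\<close>, whose derivative is at most \<open>e\<close> in absolute value.
\<close>

lemma exponential_decay_comparison:
  fixes \<psi> \<psi>' :: "real \<Rightarrow> real"
  assumes der: "\<And>s. 0 \<le> s \<Longrightarrow> s \<le> 1 \<Longrightarrow> (\<psi> has_real_derivative \<psi>' s) (at s)"
    and close: "\<And>s. 0 \<le> s \<Longrightarrow> s \<le> 1 \<Longrightarrow> \<bar>\<psi>' s - c * \<psi> s\<bar> \<le> e"
    and c: "0 \<le> c" and one: "\<psi> 1 = 1"
  shows "\<bar>\<psi> 0 - exp (- c)\<bar> \<le> e"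
proof -
  define f where "f s = exp (- c * s) * \<psi> s" for s
  have d: "(f has_real_derivative (exp (- c * s) * (\<psi>' s - c * \<psi> s))) (at s)" if "0 \<le> s" "s \<le> 1" for s
    unfolding f_def[abs_def] using der[OF that]
    by (auto intro!: derivative_eq_intros simp: algebra_simps)
  have "\<exists>z>0. z < 1 \<and> f 1 - f 0 = (1 - 0) * (exp (- c * z) * (\<psi>' z - c * \<psi> z))"
    by (rule MVT2) (simp, rule d)
  then obtain z where z: "0 < z" "z < 1" "f 1 - f 0 = exp (- c * z) * (\<psi>' z - c * \<psi> z)" by auto
  have "\<bar>f 1 - f 0\<bar> \<le> 1 * e"
    unfolding z(3) abs_mult using z c close[of z] by (intro mult_mono) auto
  then show ?thesis by (simp add: f_def one abs_minus_commute)
qed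

definition event_count :: "'i set \<Rightarrow> ('i \<Rightarrow> 'a set) \<Rightarrow> 'a \<Rightarrow> nat" where
  "event_count I E \<omega> = card {\<alpha> \<in> I. \<omega> \<in> E \<alpha>}"

lemma event_count_sum: "finite I \<Longrightarrow> real (event_count I E \<omega>) = (\<Sum>\<alpha>\<in>I. indicator (E \<alpha>) \<omega>)"
  by (simp add: event_count_def indicator_def sum.If_cases Collect_conj_eq)

context prob_space
begin

lemma measurable_event_count [measurable]:
  assumes "finite I" "\<And>\<alpha>. \<alpha> \<in> I \<Longrightarrow> E \<alpha> \<in> events"
  shows "event_count I E \<in> measurable M (count_space UNIV)"
proof -
  note assms(2)[measurable]
  have "event_count I E = (\<lambda>\<omega>. nat \<lfloor>\<Sum>\<alpha>\<in>I. indicator (E \<alpha>) \<omega> :: real\<rfloor>)"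
    unfolding event_count_sum[OF assms(1), symmetric] by simp
  also have "\<dots> \<in> measurable M (count_space UNIV)" by measurable
  finally show ?thesis .
qed

text \<open>
  Let \<open>W\<close> count the events and \<open>\<psi> s = E (s ^ W)\<close>, so that \<open>\<psi> 0\<close> is the probability of no event and
  \<open>\<psi>' s\<close> is the sum over \<open>\<alpha>\<close> of \<open>E (1_\<alpha> s ^ (W - 1))\<close>. Dropping the events of the neighbourhood
  \<open>N \<alpha>\<close> from the exponent makes the two factors independent, and then restoring them yields \<open>p \<psi> s\<close>. Both
  changes of the exponent cost at most the expected number of events concerned, whence
  \<open>\<psi>' s = card I * p * \<psi> s\<close> up to the stated error.
\<close>

theorem dissociated_poisson:
  fixes I :: "'i set" and E :: "'i \<Rightarrow> 'a set" and N :: "'i \<Rightarrow> 'i set"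
  assumes I: "finite I" and E: "\<And>\<alpha>. \<alpha> \<in> I \<Longrightarrow> E \<alpha> \<in> events"
    and p: "\<And>\<alpha>. \<alpha> \<in> I \<Longrightarrow> prob (E \<alpha>) = p"
    and N: "\<And>\<alpha>. \<alpha> \<in> I \<Longrightarrow> N \<alpha> \<subseteq> I" "\<And>\<alpha>. \<alpha> \<in> I \<Longrightarrow> \<alpha> \<in> N \<alpha>"
    and pair: "\<And>\<alpha> \<beta>. \<alpha> \<in> I \<Longrightarrow> \<beta> \<in> N \<alpha> \<Longrightarrow> \<beta> \<noteq> \<alpha> \<Longrightarrow> prob (E \<alpha> \<inter> E \<beta>) = p * p"
    and far: "\<And>\<alpha> s. \<alpha> \<in> I \<Longrightarrow> 0 \<le> s \<Longrightarrow> s \<le> 1 \<Longrightarrow>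
      expectation (\<lambda>\<omega>. indicator (E \<alpha>) \<omega> * s ^ event_count (I - N \<alpha>) E \<omega>)
        = p * expectation (\<lambda>\<omega>. s ^ event_count (I - N \<alpha>) E \<omega>)"
  shows "\<bar>prob (space M - (\<Union>\<alpha>\<in>I. E \<alpha>)) - exp (- (real (card I) * p))\<bar> \<le> 2 * p * p * (\<Sum>\<alpha>\<in>I. real (card (N \<alpha>)))"
proof (cases "I = {}")
  case True
  then show ?thesis by (simp add: prob_space)
next
  case False
  then have p0: "0 \<le> p" using p by (metis all_not_in_conv measure_nonneg)
  let ?W = "event_count I E"
  define \<psi> where "\<psi> s = expectation (\<lambda>\<omega>. s ^ ?W \<omega>)" for s :: real
  define \<psi>' where "\<psi>' s = (\<Sum>\<alpha>\<in>I. expectation (\<lambda>\<omega>. indicator (E \<alpha>) \<omega> * s ^ (?W \<omega> - 1)))" for s :: real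
  define \<epsilon> where "\<epsilon> = 2 * p * p * (\<Sum>\<alpha>\<in>I. real (card (N \<alpha>)))"
  have fN: "finite (N \<alpha>)" if "\<alpha> \<in> I" for \<alpha> using N(1)[OF that] I by (rule finite_subset)
  have W_meas: "?W \<in> measurable M (count_space UNIV)" by (rule measurable_event_count[OF I E])
  have int: "integrable M (\<lambda>\<omega>. s ^ k \<omega>)" if "0 \<le> s" "s \<le> 1" "k \<in> measurable M (count_space UNIV)" for s :: real and k :: "'a \<Rightarrow> nat"
  proof (rule integrable_const_bound[where B = 1])
    show "AE \<omega> in M. norm (s ^ k \<omega>) \<le> 1" using that by (intro AE_I2) (simp add: power_le_one)
    show "(\<lambda>\<omega>. s ^ k \<omega>) \<in> borel_measurable M" by (rule measurable_compose[OF that(3)]) simp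
  qed
  have intI: "integrable M (\<lambda>\<omega>. indicator (E \<alpha>) \<omega> * s ^ k \<omega>)"
    if "\<alpha> \<in> I" "0 \<le> s" "s \<le> 1" "k \<in> measurable M (count_space UNIV)" for s :: real and k :: "'a \<Rightarrow> nat" and \<alpha>
    using integrable_mult_indicator[OF E[OF that(1)] int[OF that(2-4)]] by simp
  have W_le: "?W \<omega> \<le> card I" for \<omega>
    unfolding event_count_def using I by (intro card_mono) auto
  have der: "(\<psi> has_real_derivative \<psi>' s) (at s)" if s: "0 \<le> s" "s \<le> 1" for s
  proof -
    define q where "q k = prob {\<omega> \<in> space M. ?W \<omega> = k}" for k
    have ev: "{\<omega> \<in> space M. ?W \<omega> = k} \<in> events" for k using W_meas by measurable
    have expand: "expectation (\<lambda>\<omega>. f (?W \<omega>)) = (\<Sum>k\<le>card I. q k * f k)" for f :: "nat \<Rightarrow> real"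
    proof -
      have "f (?W \<omega>) = (\<Sum>k\<le>card I. f k * indicator {\<omega> \<in> space M. ?W \<omega> = k} \<omega>)" if "\<omega> \<in> space M" for \<omega>
      proof -
        have "(\<Sum>k\<le>card I. f k * indicator {\<omega> \<in> space M. ?W \<omega> = k} \<omega>) = (\<Sum>k\<in>{?W \<omega>}. f k * indicator {\<omega> \<in> space M. ?W \<omega> = k} \<omega>)"
          using W_le[of \<omega>] by (intro sum.mono_neutral_right) (auto simp: indicator_def)
        then show ?thesis using that by simp
      qed
      then have "expectation (\<lambda>\<omega>. f (?W \<omega>)) = expectation (\<lambda>\<omega>. \<Sum>k\<le>card I. f k * indicator {\<omega> \<in> space M. ?W \<omega> = k} \<omega>)"
        by (intro Bochner_Integration.integral_cong refl)
      also have "\<dots> = (\<Sum>k\<le>card I. f k * q k)"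
        using ev by (subst Bochner_Integration.integral_sum) (auto simp: q_def sets.Int_space_eq2[OF ev] emeasure_eq_measure)
      finally show ?thesis by (simp add: mult.commute)
    qed
    have "((\<lambda>s. \<Sum>k\<le>card I. q k * s ^ k) has_real_derivative (\<Sum>k\<le>card I. q k * (real k * s ^ (k - 1)))) (at s)"
      by (auto intro!: derivative_eq_intros sum.cong)
    moreover have "\<psi> = (\<lambda>s. \<Sum>k\<le>card I. q k * s ^ k)"
      unfolding \<psi>_def using expand by (intro ext) simp
    moreover have "\<psi>' s = (\<Sum>k\<le>card I. q k * (real k * s ^ (k - 1)))"
    proof -
      have k: "(\<lambda>\<omega>. ?W \<omega> - 1) \<in> measurable M (count_space UNIV)" using W_meas by measurable
      have "\<psi>' s = expectation (\<lambda>\<omega>. \<Sum>\<alpha>\<in>I. indicator (E \<alpha>) \<omega> * s ^ (?W \<omega> - 1))"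
        unfolding \<psi>'_def by (rule Bochner_Integration.integral_sum[symmetric]) (rule intI[OF _ s k])
      also have "\<dots> = expectation (\<lambda>\<omega>. real (?W \<omega>) * s ^ (?W \<omega> - 1))"
        by (simp add: event_count_sum[OF I] sum_distrib_right)
      finally show ?thesis using expand[of "\<lambda>k. real k * s ^ (k - 1)"] by simp
    qed
    ultimately show ?thesis by simp
  qed
  have close: "\<bar>\<psi>' s - real (card I) * p * \<psi> s\<bar> \<le> \<epsilon>" if s: "0 \<le> s" "s \<le> 1" for s
  proof -
    have each: "\<bar>expectation (\<lambda>\<omega>. indicator (E \<alpha>) \<omega> * s ^ (?W \<omega> - 1)) - p * \<psi> s\<bar> \<le> 2 * p * p * real (card (N \<alpha>))"
      if \<alpha>: "\<alpha> \<in> I" for \<alpha>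
    proof -
      let ?V = "event_count (I - N \<alpha>) E" and ?A = "event_count (N \<alpha>) E" and ?A' = "event_count (N \<alpha> - {\<alpha>}) E"
      have V_meas: "?V \<in> measurable M (count_space UNIV)" using I E by (intro measurable_event_count) auto
      have A_meas: "?A \<in> measurable M (count_space UNIV)"
        using I E fN[OF \<alpha>] N(1)[OF \<alpha>] by (intro measurable_event_count) auto
      have k: "(\<lambda>\<omega>. ?W \<omega> - 1) \<in> measurable M (count_space UNIV)" using W_meas by measurable
      have split: "?W \<omega> = ?A \<omega> + ?V \<omega>" for \<omega>
        unfolding event_count_def using N(1)[OF \<alpha>] I fN[OF \<alpha>]
        by (subst card_Un_disjoint[symmetric]) (auto intro!: arg_cong[where f = card])
      have splitA: "?A \<omega> = Suc (?A' \<omega>)" if "\<omega> \<in> E \<alpha>" for \<omega>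
      proof -
        have "{\<beta> \<in> N \<alpha>. \<omega> \<in> E \<beta>} = insert \<alpha> {\<beta> \<in> N \<alpha> - {\<alpha>}. \<omega> \<in> E \<beta>}" using that N(2)[OF \<alpha>] by auto
        then show ?thesis unfolding event_count_def using fN[OF \<alpha>] by simp
      qed
      have bern: "\<bar>s ^ (a + v) - s ^ v\<bar> \<le> real a" for a v
      proof -
        have "0 \<le> s ^ a" "s ^ a \<le> 1" "0 \<le> s ^ v" "s ^ v \<le> 1" using s by (auto simp: power_le_one)
        have "s ^ (a + v) - s ^ v = - ((1 - s ^ a) * s ^ v)" by (simp add: power_add algebra_simps)
        then have "\<bar>s ^ (a + v) - s ^ v\<bar> = (1 - s ^ a) * s ^ v"
          using \<open>s ^ a \<le> 1\<close> \<open>0 \<le> s ^ v\<close> by (simp add: abs_mult)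
        also have "\<dots> \<le> (1 - s ^ a) * 1" using \<open>s ^ a \<le> 1\<close> \<open>s ^ v \<le> 1\<close> by (intro mult_left_mono) auto
        also have "\<dots> \<le> real a"
          using \<open>0 \<le> s ^ a\<close> by (cases "a = 0") auto
        finally show ?thesis .
      qed
      have iA: "integrable M (\<lambda>\<omega>. real (?A \<omega>))"
        unfolding event_count_sum[OF fN[OF \<alpha>]] using E N(1)[OF \<alpha>]
        by (intro Bochner_Integration.integrable_sum integrable_real_indicator) (auto simp: emeasure_eq_measure)
      have EA: "expectation (\<lambda>\<omega>. real (?A \<omega>)) = real (card (N \<alpha>)) * p"
      proof -
        have "expectation (\<lambda>\<omega>. real (?A \<omega>)) = (\<Sum>\<beta>\<in>N \<alpha>. prob (E \<beta>))"
          unfolding event_count_sum[OF fN[OF \<alpha>]] using E N(1)[OF \<alpha>]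
          by (subst Bochner_Integration.integral_sum) (auto simp: emeasure_eq_measure sets.Int_space_eq2 intro!: sum.cong integrable_real_indicator)
        also have "\<dots> = (\<Sum>\<beta>\<in>N \<alpha>. p)" using N(1)[OF \<alpha>] by (intro sum.cong refl p) auto
        finally show ?thesis by simp
      qed
      have iA': "integrable M (\<lambda>\<omega>. \<Sum>\<beta>\<in>N \<alpha> - {\<alpha>}. indicator (E \<alpha> \<inter> E \<beta>) \<omega> :: real)"
        using E[OF \<alpha>] E N(1)[OF \<alpha>]
        by (intro Bochner_Integration.integrable_sum integrable_real_indicator) (auto simp: emeasure_eq_measure)
      have EA': "expectation (\<lambda>\<omega>. \<Sum>\<beta>\<in>N \<alpha> - {\<alpha>}. indicator (E \<alpha> \<inter> E \<beta>) \<omega>) \<le> real (card (N \<alpha>)) * (p * p) - p * p"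
      proof -
        have ev: "E \<alpha> \<inter> E \<beta> \<in> events" if "\<beta> \<in> N \<alpha>" for \<beta> using E[OF \<alpha>] E[of \<beta>] N(1)[OF \<alpha>] that by auto
        have "expectation (\<lambda>\<omega>. \<Sum>\<beta>\<in>N \<alpha> - {\<alpha>}. indicator (E \<alpha> \<inter> E \<beta>) \<omega> :: real) = (\<Sum>\<beta>\<in>N \<alpha> - {\<alpha>}. prob (E \<alpha> \<inter> E \<beta>))"
          using ev
          by (subst Bochner_Integration.integral_sum) (auto simp: emeasure_eq_measure sets.Int_space_eq2 intro!: sum.cong integrable_real_indicator)
        also have "\<dots> = (\<Sum>\<beta>\<in>N \<alpha> - {\<alpha>}. p * p)" by (intro sum.cong refl pair[OF \<alpha>]) auto
        also have "\<dots> = real (card (N \<alpha> - {\<alpha>})) * (p * p)" by simp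
        also have "card (N \<alpha> - {\<alpha>}) = card (N \<alpha>) - 1" using N(2)[OF \<alpha>] fN[OF \<alpha>] by simp
        also have "real (card (N \<alpha>) - 1) = real (card (N \<alpha>)) - 1"
          using N(2)[OF \<alpha>] fN[OF \<alpha>] by (subst of_nat_diff) (auto simp: Suc_le_eq card_gt_0_iff)
        finally show ?thesis by (simp add: algebra_simps)
      qed
      have "\<bar>expectation (\<lambda>\<omega>. indicator (E \<alpha>) \<omega> * s ^ (?W \<omega> - 1)) - expectation (\<lambda>\<omega>. indicator (E \<alpha>) \<omega> * s ^ ?V \<omega>)\<bar>
          = \<bar>expectation (\<lambda>\<omega>. indicator (E \<alpha>) \<omega> * s ^ (?W \<omega> - 1) - indicator (E \<alpha>) \<omega> * s ^ ?V \<omega>)\<bar>"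
        using intI[OF \<alpha> s k] intI[OF \<alpha> s V_meas] by simp
      also have "\<dots> \<le> expectation (\<lambda>\<omega>. \<bar>indicator (E \<alpha>) \<omega> * s ^ (?W \<omega> - 1) - indicator (E \<alpha>) \<omega> * s ^ ?V \<omega>\<bar>)"
        by (rule integral_abs_bound)
      also have "\<dots> \<le> expectation (\<lambda>\<omega>. \<Sum>\<beta>\<in>N \<alpha> - {\<alpha>}. indicator (E \<alpha> \<inter> E \<beta>) \<omega>)"
      proof (rule integral_mono)
        fix \<omega>
        show "\<bar>indicator (E \<alpha>) \<omega> * s ^ (?W \<omega> - 1) - indicator (E \<alpha>) \<omega> * s ^ ?V \<omega>\<bar> \<le> (\<Sum>\<beta>\<in>N \<alpha> - {\<alpha>}. indicator (E \<alpha> \<inter> E \<beta>) \<omega>)"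
        proof (cases "\<omega> \<in> E \<alpha>")
          case True
          then have W: "?W \<omega> - 1 = ?A' \<omega> + ?V \<omega>" using split splitA by simp
          have "(\<Sum>\<beta>\<in>N \<alpha> - {\<alpha>}. indicator (E \<alpha> \<inter> E \<beta>) \<omega>) = real (?A' \<omega>)"
            using fN[OF \<alpha>] True by (simp add: event_count_sum indicator_def)
          then show ?thesis using bern[of "?A' \<omega>" "?V \<omega>"] True unfolding W by simp
        qed (simp add: sum_nonneg)
      qed (use intI[OF \<alpha> s k] intI[OF \<alpha> s V_meas] iA' in auto)
      also have "\<dots> \<le> real (card (N \<alpha>)) * (p * p) - p * p" by (rule EA')
      finally have 1: "\<bar>expectation (\<lambda>\<omega>. indicator (E \<alpha>) \<omega> * s ^ (?W \<omega> - 1)) - p * expectation (\<lambda>\<omega>. s ^ ?V \<omega>)\<bar> \<le> real (card (N \<alpha>)) * (p * p) - p * p"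
        unfolding far[OF \<alpha> s] .
      have "\<bar>expectation (\<lambda>\<omega>. s ^ ?V \<omega>) - \<psi> s\<bar> = \<bar>expectation (\<lambda>\<omega>. s ^ ?V \<omega> - s ^ ?W \<omega>)\<bar>"
        unfolding \<psi>_def using int[OF s V_meas] int[OF s W_meas] by simp
      also have "\<dots> \<le> expectation (\<lambda>\<omega>. \<bar>s ^ ?V \<omega> - s ^ ?W \<omega>\<bar>)" by (rule integral_abs_bound)
      also have "\<dots> \<le> expectation (\<lambda>\<omega>. real (?A \<omega>))"
      proof (rule integral_mono)
        fix \<omega> show "\<bar>s ^ ?V \<omega> - s ^ ?W \<omega>\<bar> \<le> real (?A \<omega>)"
          unfolding split using bern[of "?A \<omega>" "?V \<omega>"] by (simp add: abs_minus_commute)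
      qed (use int[OF s V_meas] int[OF s W_meas] iA in auto)
      finally have "p * \<bar>expectation (\<lambda>\<omega>. s ^ ?V \<omega>) - \<psi> s\<bar> \<le> p * (real (card (N \<alpha>)) * p)"
        using p0 EA by (intro mult_left_mono) auto
      moreover have "\<bar>p * expectation (\<lambda>\<omega>. s ^ ?V \<omega>) - p * \<psi> s\<bar> = p * \<bar>expectation (\<lambda>\<omega>. s ^ ?V \<omega>) - \<psi> s\<bar>"
        unfolding right_diff_distrib[symmetric] abs_mult using p0 by simp
      ultimately have 2: "\<bar>p * expectation (\<lambda>\<omega>. s ^ ?V \<omega>) - p * \<psi> s\<bar> \<le> real (card (N \<alpha>)) * (p * p)"
        by (simp only: mult.left_commute[of p])
      have 3: "0 \<le> p * p" using p0 by simp
      have 4: "2 * p * p * real (card (N \<alpha>)) = real (card (N \<alpha>)) * (p * p) + real (card (N \<alpha>)) * (p * p)" by simp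
      show ?thesis unfolding 4 using 1 2 3 by linarith
    qed
    have "\<psi>' s - real (card I) * p * \<psi> s = (\<Sum>\<alpha>\<in>I. expectation (\<lambda>\<omega>. indicator (E \<alpha>) \<omega> * s ^ (?W \<omega> - 1)) - p * \<psi> s)"
      unfolding \<psi>'_def by (simp add: sum_subtractf)
    also have "\<bar>\<dots>\<bar> \<le> (\<Sum>\<alpha>\<in>I. \<bar>expectation (\<lambda>\<omega>. indicator (E \<alpha>) \<omega> * s ^ (?W \<omega> - 1)) - p * \<psi> s\<bar>)" by (rule sum_abs)
    also have "\<dots> \<le> (\<Sum>\<alpha>\<in>I. 2 * p * p * real (card (N \<alpha>)))" by (intro sum_mono each)
    finally show ?thesis by (simp add: \<epsilon>_def sum_distrib_left)
  qed
  have "\<psi> 1 = 1" by (simp add: \<psi>_def prob_space)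
  then have main: "\<bar>\<psi> 0 - exp (- (real (card I) * p))\<bar> \<le> \<epsilon>"
    using p0 by (intro exponential_decay_comparison[OF der close]) auto
  have "\<psi> 0 = prob (space M - (\<Union>\<alpha>\<in>I. E \<alpha>))"
  proof -
    have "\<psi> 0 = expectation (indicator (space M - (\<Union>\<alpha>\<in>I. E \<alpha>)))"
      unfolding \<psi>_def
    proof (rule Bochner_Integration.integral_cong[OF refl])
      fix \<omega> assume "\<omega> \<in> space M"
      then show "(0 :: real) ^ ?W \<omega> = indicator (space M - (\<Union>\<alpha>\<in>I. E \<alpha>)) \<omega>"
        using I by (auto simp: event_count_def indicator_def power_0_left)
    qed
    then show ?thesis using I E by (simp add: sets.Int_space_eq2 Int_absorb2)
  qed
  then show ?thesis using main by (simp add: \<epsilon>_def)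
qed

end

section \<open>Exceedances over pairs of coordinates\<close>

definition crit :: "nat \<Rightarrow> kernel \<Rightarrow> nat \<Rightarrow> real set \<Rightarrow> (nat \<Rightarrow> real) \<times> (nat \<Rightarrow> real) \<Rightarrow> real" where
  "crit m h n A = (\<lambda>(x, y). indicator A (ustat m h n (\<lambda>i. (x i, y i))))"

lemma crit_bd: "\<bar>crit m h n A z\<bar> \<le> 1"
  by (cases z) (simp add: crit_def indicator_def)

lemma crit_meas:
  assumes "h \<in> borel_measurable (PiM {..<m} (\<lambda>_. borel))" "A \<in> sets borel"
  shows "crit m h n A \<in> borel_measurable (col_space n \<Otimes>\<^sub>M col_space n)"
proof -
  have "(\<lambda>z. ustat m h n (\<lambda>i. (fst z i, snd z i))) \<in> borel_measurable (col_space n \<Otimes>\<^sub>M col_space n)"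
    by (intro ustat_columns_measurable assms) auto
  then show ?thesis
    unfolding crit_def split_beta using assms(2) by (intro borel_measurable_indicator') auto
qed

lemma pair_ustat_sample_column: "pair_ustat m h n Z j k \<omega> = ustat m h n (\<lambda>i. (sample_column n Z j \<omega> i, sample_column n Z k \<omega> i))"
  unfolding pair_ustat_def by (rule ustat_cong) (simp add: sample_column_def)

locale independent_columns = prob_space M for M :: "'a measure" +
  fixes n d m :: nat and Z :: "nat \<Rightarrow> nat \<Rightarrow> 'a \<Rightarrow> real" and \<mu> :: "nat \<Rightarrow> real measure" and h :: kernel
  assumes mn: "m < n"
    and columns: "indep_vars (\<lambda>_. col_space n) (sample_column n Z) {..<d}"
    and column_law: "\<And>j. j < d \<Longrightarrow> distr M (col_space n) (sample_column n Z j) = PiM {..<n} (\<lambda>_. \<mu> j)"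
    and atomless: "\<And>j. j < d \<Longrightarrow> atomless_law (\<mu> j)"
    and h_rank: "rank_type m h"
    and h_meas: "h \<in> borel_measurable (PiM {..<m} (\<lambda>_. borel))"
begin

lemma column_meas: "j < d \<Longrightarrow> sample_column n Z j \<in> measurable M (col_space n)"
  using columns by (auto simp: indep_vars_def)

lemma pair_ustat_meas: "j < d \<Longrightarrow> k < d \<Longrightarrow> pair_ustat m h n Z j k \<in> borel_measurable M"
  unfolding pair_ustat_sample_column[abs_def] by (intro ustat_columns_measurable h_meas column_meas)

lemma crit_given_first:
  assumes A: "A \<in> sets borel" and jk: "j < d" "k < d"
  shows "AE x in distr M (col_space n) (sample_column n Z j).
    (\<integral>y. crit m h n A (x, y) \<partial>distr M (col_space n) (sample_column n Z k)) = perm_average m h n (indicator A)"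
  using AE_inj_on_PiM[OF atomless[OF jk(1)], of n] unfolding column_law[OF jk(1)] column_law[OF jk(2)] crit_def
  by eventually_elim (simp add: rank_ustat_given_first[OF h_rank h_meas mn atomless[OF jk(2)] A])

lemma crit_given_second:
  assumes A: "A \<in> sets borel" and jk: "j < d" "k < d"
  shows "AE y in distr M (col_space n) (sample_column n Z k).
    (\<integral>x. crit m h n A (x, y) \<partial>distr M (col_space n) (sample_column n Z j)) = perm_average m h n (indicator A)"
  using AE_inj_on_PiM[OF atomless[OF jk(2)], of n] unfolding column_law[OF jk(1)] column_law[OF jk(2)] crit_def
  by eventually_elim (simp add: rank_ustat_given_second[OF h_rank h_meas mn atomless[OF jk(1)] A])

definition exceed :: "real set \<Rightarrow> nat \<times> nat \<Rightarrow> 'a set" where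
  "exceed A = (\<lambda>(j, k). {\<omega> \<in> space M. pair_ustat m h n Z j k \<omega> \<in> A})"

lemma exceed_sets: "A \<in> sets borel \<Longrightarrow> j < d \<Longrightarrow> k < d \<Longrightarrow> exceed A (j, k) \<in> events"
  unfolding exceed_def using measurable_sets[OF pair_ustat_meas[of j k], of A]
  by (simp add: vimage_def Int_def conj_commute)

lemma indicator_exceed:
  "\<omega> \<in> space M \<Longrightarrow> indicator (exceed A (j, k)) \<omega> = crit m h n A (sample_column n Z j \<omega>, sample_column n Z k \<omega>)"
  by (simp add: exceed_def crit_def pair_ustat_sample_column indicator_def)

text \<open>
  The right-hand side involves neither the pair \<open>(j, k)\<close> nor the laws \<open>\<mu>\<close> of the coordinates.
\<close>

lemma prob_exceed:
  assumes A: "A \<in> sets borel" and jk: "j < d" "k < d" "j \<noteq> k"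
  shows "prob (exceed A (j, k)) = perm_average m h n (indicator A)"
proof -
  interpret J: prob_space "distr M (col_space n) (sample_column n Z j)" by (intro prob_space_distr column_meas jk)
  have "prob (exceed A (j, k)) = expectation (indicator (exceed A (j, k)))"
    using exceed_sets[OF A jk(1,2)] by (simp add: sets.Int_space_eq2)
  also have "\<dots> = expectation (\<lambda>\<omega>. crit m h n A (sample_column n Z j \<omega>, sample_column n Z k \<omega>))"
    by (intro Bochner_Integration.integral_cong refl indicator_exceed)
  also have "\<dots> = (\<integral>x. (\<integral>y. crit m h n A (x, y) \<partial>distr M (col_space n) (sample_column n Z k)) \<partial>distr M (col_space n) (sample_column n Z j))"
    using jk by (intro integral_independent_pair indep_var_of_columns[OF columns] crit_meas h_meas A crit_bd) auto
  also have "\<dots> = (\<integral>x. perm_average m h n (indicator A) \<partial>distr M (col_space n) (sample_column n Z j))"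
  proof (rule integral_cong_AE)
    interpret K: prob_space "distr M (col_space n) (sample_column n Z k)" by (intro prob_space_distr column_meas jk)
    note [measurable] = crit_meas[OF h_meas A, of n]
    show "(\<lambda>x. \<integral>y. crit m h n A (x, y) \<partial>distr M (col_space n) (sample_column n Z k)) \<in> borel_measurable (distr M (col_space n) (sample_column n Z j))"
      by measurable
  qed (use crit_given_first[OF A jk(1,2)] in auto)
  finally show ?thesis using J.prob_space by simp
qed

lemma pair_ustat_distr_emeasure:
  assumes A: "A \<in> sets borel" and jk: "j < d" "k < d" "j \<noteq> k"
  shows "emeasure (distr M borel (pair_ustat m h n Z j k)) A = ennreal (perm_average m h n (indicator A))"
proof -
  have "emeasure (distr M borel (pair_ustat m h n Z j k)) A = emeasure M (exceed A (j, k))"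
    using A pair_ustat_meas[OF jk(1,2)] by (subst emeasure_distr) (auto simp: exceed_def intro!: arg_cong[where f = "emeasure M"])
  then show ?thesis using prob_exceed[OF assms] by (simp add: emeasure_eq_measure)
qed

text \<open>
  The shared column \<open>a\<close> may be the first or the second one in either pair; the flags \<open>o1\<close> and \<open>o2\<close>
  select the orientation.
\<close>

lemma exceed_shared:
  fixes o1 o2 :: bool
  assumes A: "A \<in> sets borel" and abc: "a < d" "b < d" "c < d" "a \<noteq> b" "a \<noteq> c" "b \<noteq> c"
  defines "\<alpha> \<equiv> (if o1 then (a, b) else (b, a))" and "\<beta> \<equiv> (if o2 then (a, c) else (c, a))"
  defines "p \<equiv> perm_average m h n (indicator A)"
  shows "prob (exceed A \<alpha> \<inter> exceed A \<beta>) = p * p"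
proof -
  define f where "f ori z = (if ori then crit m h n A z else crit m h n A (snd z, fst z))"
    for ori and z :: "(nat \<Rightarrow> real) \<times> (nat \<Rightarrow> real)"
  have f_meas: "f ori \<in> borel_measurable (col_space n \<Otimes>\<^sub>M col_space n)" for ori
  proof (cases ori)
    case True
    then show ?thesis using crit_meas[OF h_meas A] by (simp add: f_def[abs_def])
  next
    case False
    have "(\<lambda>z. (snd z, fst z)) \<in> measurable (col_space n \<Otimes>\<^sub>M col_space n) (col_space n \<Otimes>\<^sub>M col_space n)" by measurable
    from measurable_compose[OF this crit_meas[OF h_meas A]] show ?thesis using False by (simp add: f_def[abs_def])
  qed
  have f_bd: "\<bar>f ori z\<bar> \<le> 1" for ori z using crit_bd by (simp add: f_def)
  have f_p: "AE x in distr M (col_space n) (sample_column n Z a). (\<integral>y. f ori (x, y) \<partial>distr M (col_space n) (sample_column n Z b')) = p"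
    if "b' < d" for ori b'
    using crit_given_first[OF A abc(1) that] crit_given_second[OF A that abc(1)] by (cases ori) (simp_all add: f_def p_def)
  have ev: "exceed A \<alpha> \<inter> exceed A \<beta> \<in> events"
    using exceed_sets[OF A] abc by (auto simp: \<alpha>_def \<beta>_def)
  have "prob (exceed A \<alpha> \<inter> exceed A \<beta>) = expectation (indicator (exceed A \<alpha> \<inter> exceed A \<beta>))"
    using ev by (simp add: sets.Int_space_eq2)
  also have "\<dots> = expectation (\<lambda>\<omega>. f o1 (sample_column n Z a \<omega>, sample_column n Z b \<omega>) * f o2 (sample_column n Z a \<omega>, sample_column n Z c \<omega>))"
  proof (rule Bochner_Integration.integral_cong[OF refl])
    fix \<omega> assume \<omega>: "\<omega> \<in> space M"
    have "indicator (exceed A \<alpha>) \<omega> = f o1 (sample_column n Z a \<omega>, sample_column n Z b \<omega>)"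
      "indicator (exceed A \<beta>) \<omega> = f o2 (sample_column n Z a \<omega>, sample_column n Z c \<omega>)"
      using indicator_exceed[OF \<omega>] by (auto simp: \<alpha>_def \<beta>_def f_def)
    then show "indicator (exceed A \<alpha> \<inter> exceed A \<beta>) \<omega> = f o1 (sample_column n Z a \<omega>, sample_column n Z b \<omega>) * f o2 (sample_column n Z a \<omega>, sample_column n Z c \<omega>)"
      by (simp add: indicator_inter_arith)
  qed
  also have "\<dots> = p * p"
    using abc by (intro shared_column_independence[OF columns _ _ _ _ _ _ f_meas f_bd f_meas f_bd f_p f_p]) auto
  finally show ?thesis .
qed

definition pairs :: "(nat \<times> nat) set" where "pairs = {(j, k). j < k \<and> k < d}"

definition meeting :: "nat \<times> nat \<Rightarrow> (nat \<times> nat) set" where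
  "meeting \<alpha> = {\<beta> \<in> pairs. {fst \<alpha>, snd \<alpha>} \<inter> {fst \<beta>, snd \<beta>} \<noteq> {}}"

lemma finite_pairs [simp]: "finite pairs"
  by (rule finite_subset[of _ "{..<d} \<times> {..<d}"]) (auto simp: pairs_def)

lemma card_pairs: "real (card pairs) = real d * (real d - 1) / 2"
proof -
  have "pairs = (\<lambda>(k, j). (j, k)) ` (SIGMA k:{..<d}. {..<k})" by (auto simp: pairs_def)
  moreover have "inj_on (\<lambda>(k, j). (j, k)) (SIGMA k:{..<d}. {..<k})" by (auto simp: inj_on_def)
  ultimately have "card pairs = (\<Sum>k<d. k)" by (simp add: card_image)
  moreover have "real (\<Sum>k<d. k) = real d * (real d - 1) / 2"
    by (induction d) (auto simp: field_simps)
  ultimately show ?thesis by simp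
qed

text \<open>
  A pair that meets \<open>\<alpha>\<close> consists of one of the two elements of \<open>\<alpha>\<close> and one of the \<open>d\<close> coordinates.
\<close>

lemma card_meeting: "\<alpha> \<in> pairs \<Longrightarrow> card (meeting \<alpha>) \<le> 2 * d"
proof -
  assume \<alpha>: "\<alpha> \<in> pairs"
  have "meeting \<alpha> \<subseteq> (\<lambda>(c, x). (min c x, max c x)) ` ({fst \<alpha>, snd \<alpha>} \<times> {..<d})"
  proof
    fix \<beta> assume \<beta>: "\<beta> \<in> meeting \<alpha>"
    obtain j k where jk: "\<beta> = (j, k)" "j < k" "k < d" using \<beta> by (auto simp: meeting_def pairs_def)
    have "j \<in> {fst \<alpha>, snd \<alpha>} \<or> k \<in> {fst \<alpha>, snd \<alpha>}" using \<beta> jk by (auto simp: meeting_def)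
    then show "\<beta> \<in> (\<lambda>(c, x). (min c x, max c x)) ` ({fst \<alpha>, snd \<alpha>} \<times> {..<d})"
    proof
      assume "j \<in> {fst \<alpha>, snd \<alpha>}"
      then show ?thesis using jk by (intro image_eqI[of _ _ "(j, k)"]) auto
    next
      assume "k \<in> {fst \<alpha>, snd \<alpha>}"
      then show ?thesis using jk by (intro image_eqI[of _ _ "(k, j)"]) auto
    qed
  qed
  then have "card (meeting \<alpha>) \<le> card ((\<lambda>(c, x). (min c x, max c x)) ` ({fst \<alpha>, snd \<alpha>} \<times> {..<d}))"
    by (intro card_mono) auto
  also have "\<dots> \<le> card ({fst \<alpha>, snd \<alpha>} \<times> {..<d})" by (intro card_image_le) auto
  also have "\<dots> = card {fst \<alpha>, snd \<alpha>} * d" by (simp add: card_cartesian_product)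
  also have "\<dots> \<le> 2 * d" by (intro mult_right_mono) (auto simp: card_insert_if)
  finally show ?thesis .
qed

lemma exceed_meeting:
  assumes A: "A \<in> sets borel" and \<alpha>: "\<alpha> \<in> pairs" and \<beta>: "\<beta> \<in> meeting \<alpha>" "\<beta> \<noteq> \<alpha>"
  shows "prob (exceed A \<alpha> \<inter> exceed A \<beta>) = perm_average m h n (indicator A) * perm_average m h n (indicator A)"
proof -
  obtain j k where jk: "\<alpha> = (j, k)" "j < k" "k < d" using \<alpha> by (auto simp: pairs_def)
  obtain j' k' where jk': "\<beta> = (j', k')" "j' < k'" "k' < d" using \<beta> by (auto simp: meeting_def pairs_def)
  have "j = j' \<or> j = k' \<or> k = j' \<or> k = k'" using \<beta> jk jk' by (auto simp: meeting_def)
  then consider "j = j'" "k \<noteq> k'" | "j = k'" | "k = j'" | "k = k'" "j \<noteq> j'" using \<beta>(2) jk(1) jk'(1) by auto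
  then show ?thesis
  proof cases
    case 1
    then show ?thesis using exceed_shared[OF A, of j k k' True True] jk jk' by simp
  next
    case 2
    then show ?thesis using exceed_shared[OF A, of j k j' True False] jk jk' by simp
  next
    case 3
    then show ?thesis using exceed_shared[OF A, of k j k' False True] jk jk' by simp
  next
    case 4
    then show ?thesis using exceed_shared[OF A, of k j j' False False] jk jk' by simp
  qed
qed

text \<open>
  The remaining events are functions of the columns outside \<open>\<alpha>\<close>, which are independent of the two
  columns of \<open>\<alpha>\<close>.
\<close>

lemma exceed_far:
  assumes A: "A \<in> sets borel" and \<alpha>: "\<alpha> \<in> pairs" and s: "0 \<le> s" "s \<le> 1"
  shows "expectation (\<lambda>\<omega>. indicator (exceed A \<alpha>) \<omega> * s ^ event_count (pairs - meeting \<alpha>) (exceed A) \<omega>)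
    = perm_average m h n (indicator A) * expectation (\<lambda>\<omega>. s ^ event_count (pairs - meeting \<alpha>) (exceed A) \<omega>)"
proof -
  obtain j k where jk: "\<alpha> = (j, k)" "j < k" "k < d" using \<alpha> by (auto simp: pairs_def)
  let ?F = "pairs - meeting \<alpha>"
  let ?K1 = "{j, k}" and ?K2 = "{..<d} - {j, k}"
  let ?X = "\<lambda>\<omega>. restrict (\<lambda>i. sample_column n Z i \<omega>) ?K1" and ?Y = "\<lambda>\<omega>. restrict (\<lambda>i. sample_column n Z i \<omega>) ?K2"
  let ?N1 = "PiM ?K1 (\<lambda>_. col_space n)" and ?N2 = "PiM ?K2 (\<lambda>_. col_space n)"
  define \<phi> where "\<phi> u = crit m h n A (u j, u k)" for u :: "nat \<Rightarrow> nat \<Rightarrow> real"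
  \<comment> \<open>the power \<open>s ^ W\<close> written as a product, in which measurability is visible\<close>
  define \<gamma> where "\<gamma> v = (\<Prod>\<beta>\<in>?F. 1 + (s - 1) * crit m h n A (v (fst \<beta>), v (snd \<beta>)))" for v :: "nat \<Rightarrow> nat \<Rightarrow> real"
  have ind: "indep_var ?N1 ?X ?N2 ?Y"
    by (rule indep_var_restrict[OF columns]) (use jk in auto)
  have \<phi>: "\<phi> \<in> borel_measurable ?N1"
    unfolding \<phi>_def[abs_def]
    by (intro measurable_compose[OF _ crit_meas[OF h_meas A]] measurable_Pair measurable_component_singleton) auto
  have mem: "fst \<beta> \<in> ?K2 \<and> snd \<beta> \<in> ?K2" if "\<beta> \<in> ?F" for \<beta>
    using that jk by (auto simp: meeting_def pairs_def)
  have \<gamma>: "\<gamma> \<in> borel_measurable ?N2"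
    unfolding \<gamma>_def[abs_def] using mem
    by (intro borel_measurable_prod borel_measurable_add borel_measurable_times borel_measurable_const
        measurable_compose[OF _ crit_meas[OF h_meas A]] measurable_Pair measurable_component_singleton) auto
  have X\<phi>: "\<phi> (?X \<omega>) = indicator (exceed A \<alpha>) \<omega>" if "\<omega> \<in> space M" for \<omega>
    using that jk by (simp add: \<phi>_def indicator_exceed)
  have Y\<gamma>: "\<gamma> (?Y \<omega>) = s ^ event_count ?F (exceed A) \<omega>" if \<omega>: "\<omega> \<in> space M" for \<omega>
  proof -
    have "\<gamma> (?Y \<omega>) = (\<Prod>\<beta>\<in>?F. if \<omega> \<in> exceed A \<beta> then s else 1)"
      unfolding \<gamma>_def
    proof (rule prod.cong[OF refl])
      fix \<beta> assume "\<beta> \<in> ?F"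
      then have "crit m h n A (?Y \<omega> (fst \<beta>), ?Y \<omega> (snd \<beta>)) = indicator (exceed A \<beta>) \<omega>"
        using mem[of \<beta>] indicator_exceed[OF \<omega>, of A "fst \<beta>" "snd \<beta>"] by simp
      then show "1 + (s - 1) * crit m h n A (?Y \<omega> (fst \<beta>), ?Y \<omega> (snd \<beta>)) = (if \<omega> \<in> exceed A \<beta> then s else 1)"
        by (simp add: indicator_def)
    qed
    also have "\<dots> = s ^ event_count ?F (exceed A) \<omega>"
    proof -
      have "{\<beta> \<in> ?F. \<omega> \<in> exceed A \<beta>} = ?F \<inter> {\<beta>. \<omega> \<in> exceed A \<beta>}" by auto
      then show ?thesis by (simp add: prod.If_cases event_count_def)
    qed
    finally show ?thesis .
  qed
  have "indep_var borel (\<phi> \<circ> ?X) borel (\<gamma> \<circ> ?Y)"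
    by (rule indep_var_compose[OF ind \<phi> \<gamma>])
  then have ind': "indep_var borel (\<lambda>\<omega>. \<phi> (?X \<omega>)) borel (\<lambda>\<omega>. \<gamma> (?Y \<omega>))" by (simp add: comp_def)
  have X_meas: "(\<lambda>\<omega>. \<phi> (?X \<omega>)) \<in> borel_measurable M" and Y_meas: "(\<lambda>\<omega>. \<gamma> (?Y \<omega>)) \<in> borel_measurable M"
    using indep_var_rv1[OF ind'] indep_var_rv2[OF ind'] by auto
  have "integrable M (\<lambda>\<omega>. \<phi> (?X \<omega>))"
    using crit_bd by (intro integrable_const_bound[where B = 1] X_meas) (simp add: \<phi>_def)
  moreover have "integrable M (\<lambda>\<omega>. \<gamma> (?Y \<omega>))"
    using s Y\<gamma> by (intro integrable_const_bound[where B = 1] Y_meas AE_I2) (simp add: power_le_one)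
  ultimately have prod: "expectation (\<lambda>\<omega>. \<phi> (?X \<omega>) * \<gamma> (?Y \<omega>)) = expectation (\<lambda>\<omega>. \<phi> (?X \<omega>)) * expectation (\<lambda>\<omega>. \<gamma> (?Y \<omega>))"
    by (rule indep_var_lebesgue_integral[OF ind'])
  have "expectation (\<lambda>\<omega>. \<phi> (?X \<omega>)) = expectation (indicator (exceed A \<alpha>))"
    by (rule Bochner_Integration.integral_cong[OF refl]) (rule X\<phi>)
  also have "\<dots> = perm_average m h n (indicator A)"
    using exceed_sets[OF A, of j k] prob_exceed[OF A, of j k] jk by (simp add: sets.Int_space_eq2)
  finally have E1: "expectation (\<lambda>\<omega>. \<phi> (?X \<omega>)) = perm_average m h n (indicator A)" .
  have E2: "expectation (\<lambda>\<omega>. \<gamma> (?Y \<omega>)) = expectation (\<lambda>\<omega>. s ^ event_count ?F (exceed A) \<omega>)"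
    by (rule Bochner_Integration.integral_cong[OF refl]) (rule Y\<gamma>)
  have "expectation (\<lambda>\<omega>. indicator (exceed A \<alpha>) \<omega> * s ^ event_count ?F (exceed A) \<omega>) = expectation (\<lambda>\<omega>. \<phi> (?X \<omega>) * \<gamma> (?Y \<omega>))"
    by (rule Bochner_Integration.integral_cong[OF refl]) (simp only: X\<phi> Y\<gamma>)
  then show ?thesis unfolding prod E1 E2 .
qed

theorem no_exceedance_poisson:
  assumes A: "A \<in> sets borel"
  defines "p \<equiv> perm_average m h n (indicator A)"
  shows "\<bar>prob (space M - (\<Union>\<alpha>\<in>pairs. exceed A \<alpha>)) - exp (- (real (card pairs) * p))\<bar> \<le> 2 * p * p * (real (card pairs) * (2 * real d))"
proof -
  have "\<bar>prob (space M - (\<Union>\<alpha>\<in>pairs. exceed A \<alpha>)) - exp (- (real (card pairs) * p))\<bar> \<le> 2 * p * p * (\<Sum>\<alpha>\<in>pairs. real (card (meeting \<alpha>)))"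
    unfolding p_def
  proof (rule dissociated_poisson)
    fix \<alpha> assume \<alpha>: "\<alpha> \<in> pairs"
    then obtain j k where jk: "\<alpha> = (j, k)" "j < k" "k < d" by (auto simp: pairs_def)
    show "exceed A \<alpha> \<in> events" using exceed_sets[OF A, of j k] jk by simp
    show "prob (exceed A \<alpha>) = perm_average m h n (indicator A)" using prob_exceed[OF A, of j k] jk by simp
    show "meeting \<alpha> \<subseteq> pairs" by (auto simp: meeting_def)
    show "\<alpha> \<in> meeting \<alpha>" using \<alpha> by (simp add: meeting_def)
  qed (auto intro: exceed_meeting[OF A] exceed_far[OF A])
  also have "\<dots> \<le> 2 * p * p * (\<Sum>\<alpha>\<in>pairs. 2 * real d)"
  proof (intro mult_left_mono sum_mono)
    fix \<alpha> assume "\<alpha> \<in> pairs"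
    from card_meeting[OF this] show "real (card (meeting \<alpha>)) \<le> 2 * real d" by linarith
  qed simp
  finally show ?thesis by simp
qed

end

section \<open>The Gumbel limit\<close>

lemma (in prob_space) independent_columns_rows:
  fixes Z :: "nat \<Rightarrow> nat \<Rightarrow> 'a \<Rightarrow> real" and \<nu> :: "nat \<Rightarrow> real measure"
  assumes mn: "m < n" and d: "0 < d"
    and rows: "indep_vars (\<lambda>_. PiM {..<d} (\<lambda>_. borel)) (\<lambda>i. coord_vec d (Z i)) {..<n}"
    and law: "\<And>i. i < n \<Longrightarrow> distr M (PiM {..<d} (\<lambda>_. borel)) (coord_vec d (Z i)) = PiM {..<d} \<nu>"
    and \<nu>: "\<And>j. j < d \<Longrightarrow> atomless_law (\<nu> j)"
    and h: "rank_type m h" "h \<in> borel_measurable (PiM {..<m} (\<lambda>_. borel))"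
  shows "independent_columns M n d m Z \<nu> h"
proof -
  \<comment> \<open>outside \<open>{..<d}\<close> the laws are arbitrary; any probability law serves as a default\<close>
  define \<nu>' where "\<nu>' j = (if j < d then \<nu> j else \<nu> 0)" for j
  have \<nu>': "atomless_law (\<nu>' j)" for j using \<nu> d by (simp add: \<nu>'_def)
  have law': "distr M (PiM {..<d} (\<lambda>_. borel)) (coord_vec d (Z i)) = PiM {..<d} \<nu>'" if "i < n" for i
    unfolding law[OF that] by (intro PiM_cong refl) (simp add: \<nu>'_def)
  have pr: "prob_space (\<nu>' j)" "sets (\<nu>' j) = sets borel" for j using \<nu>'[of j] by (simp_all add: atomless_law_def)
  have n: "0 < n" using mn by simp
  note cols = columns_of_independent_rows[OF n d rows law' pr]
  show ?thesis
  proof (unfold_locales)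
    show "distr M (col_space n) (sample_column n Z j) = PiM {..<n} (\<lambda>_. \<nu> j)" if "j < d" for j
      using cols(2)[OF _ that] that by (simp add: \<nu>'_def)
  qed (use mn cols(1) \<nu> h in auto)
qed

lemma (in prob_space) atomless_marginals:
  assumes "continuous_vec M d X" "j < d"
  shows "atomless_law (distr M borel (X j))"
proof -
  have X: "X j \<in> borel_measurable M" "\<And>a. measure M {\<omega> \<in> space M. X j \<omega> = a} = 0"
    using assms by (auto simp: continuous_vec_def)
  have "measure (distr M borel (X j)) {a} = 0" for a
  proof -
    have "measure (distr M borel (X j)) {a} = measure M (X j -` {a} \<inter> space M)"
      using X(1) by (rule measure_distr) simp
    also have "X j -` {a} \<inter> space M = {\<omega> \<in> space M. X j \<omega> = a}" by auto
    finally show ?thesis by (simp add: X(2))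
  qed
  then show ?thesis using X prob_space_distr[of "X j" borel] by (simp add: atomless_law_def)
qed

lemma (in prob_space) coord_vec_law:
  assumes "continuous_vec M d X" "null_hyp M d X" "0 < d'" "d' \<le> d"
  shows "distr M (PiM {..<d'} (\<lambda>_. borel)) (coord_vec d' X) = PiM {..<d'} (\<lambda>j. distr M borel (X j))"
proof -
  have ind: "indep_vars (\<lambda>_. borel) X {..<d'}"
    by (rule indep_vars_subset[OF assms(2)[unfolded null_hyp_def]]) (use assms(4) in auto)
  have rv: "random_variable borel (X j)" if "j \<in> {..<d'}" for j
    using assms that by (auto simp: continuous_vec_def)
  have ne: "{..<d'} \<noteq> {}" using assms(3) by auto
  show ?thesis
    using indep_vars_iff_distr_eq_PiM'[where M' = "\<lambda>_. borel" and X = X, OF ne rv] ind unfolding coord_vec_def[abs_def] by simp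
qed

lemma independent_columns_sample:
  assumes P: "prob_space M" and cont: "continuous_vec M d X" and copies: "indep_copies M n d X Z" and H0: "null_hyp M d X"
    and h: "rank_type m h" "h \<in> borel_measurable (PiM {..<m} (\<lambda>_. borel))" and mn: "m < n" and d: "0 < d"
  shows "independent_columns M n d m Z (\<lambda>j. distr M borel (X j)) h"
proof -
  interpret prob_space M by fact
  show ?thesis
    using copies coord_vec_law[OF cont H0 d order_refl]
    by (intro independent_columns_rows mn d atomless_marginals[OF cont] h) (auto simp: indep_copies_def)
qed

definition split_pair :: "nat \<Rightarrow> nat \<Rightarrow> (nat \<Rightarrow> real \<times> real) \<Rightarrow> real" where
  "split_pair i j z = (if j = 0 then fst (z i) else snd (z i))"

text \<open>
  An i.i.d. sample of one pair of coordinates has independent columns. All distributional estimates are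
  carried out for such a sample and transferred to the other pairs and sample sizes.
\<close>

lemma independent_columns_pair:
  assumes P: "prob_space M" and cont: "continuous_vec M d X" and H0: "null_hyp M d X"
    and h: "rank_type m h" "h \<in> borel_measurable (PiM {..<m} (\<lambda>_. borel))" and mn: "m < n" and d: "2 \<le> d"
  defines "L \<equiv> distr M borel (\<lambda>\<omega>. (X 0 \<omega>, X 1 \<omega>))"
  shows "independent_columns (PiM {..<n} (\<lambda>_. L)) n 2 m split_pair (\<lambda>j. distr M borel (X j)) h"
proof -
  interpret prob_space M by fact
  have X: "X 0 \<in> borel_measurable M" "X 1 \<in> borel_measurable M" using cont d by (auto simp: continuous_vec_def)
  have XX [measurable]: "(\<lambda>\<omega>. (X 0 \<omega>, X 1 \<omega>)) \<in> borel_measurable M" using X by (rule borel_measurable_Pair)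
  have L: "prob_space L" unfolding L_def by (rule prob_space_distr) measurable
  have sL: "sets L = sets borel" by (simp add: L_def)
  let ?Q = "PiM {..<n} (\<lambda>_. L)" and ?R = "PiM {..<2} (\<lambda>_::nat. borel :: real measure)"
  interpret Q: prob_space ?Q by (intro prob_space_PiM L)
  define g where "g p = (\<lambda>j\<in>{..<2::nat}. if j = 0 then fst p else snd p)" for p :: "real \<times> real"
  have "(\<lambda>p. if j = 0 then fst p else snd p) \<in> borel_measurable (borel :: (real \<times> real) measure)" for j :: nat
    by (cases "j = 0") (simp_all add: borel_measurable_continuous_onI continuous_on_fst continuous_on_snd continuous_on_id)
  then have g_borel: "g \<in> measurable borel ?R" unfolding g_def[abs_def] by (intro measurable_restrict)
  then have g: "g \<in> measurable L ?R" unfolding measurable_cong_sets[OF sL refl] .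
  have cg: "coord_vec 2 (split_pair i) z = g (z i)" for i z by (auto simp: coord_vec_def split_pair_def g_def)
  have n: "0 < n" using mn by simp
  show ?thesis
  proof (rule Q.independent_columns_rows[OF mn _ _ _ _ h])
    have "Q.indep_vars (\<lambda>_. L) (\<lambda>i z. z i) {..<n}" using n L by (intro indep_vars_PiM_components) auto
    then have "Q.indep_vars (\<lambda>_. ?R) (\<lambda>i z. g (z i)) {..<n}" by (rule Q.indep_vars_compose2) (rule g)
    then show "Q.indep_vars (\<lambda>_. ?R) (\<lambda>i. coord_vec 2 (split_pair i)) {..<n}" by (simp add: cg[abs_def])
    show "distr ?Q ?R (coord_vec 2 (split_pair i)) = PiM {..<2} (\<lambda>j. distr M borel (X j))" if i: "i < n" for i
    proof -
      have "distr ?Q ?R (coord_vec 2 (split_pair i)) = distr (distr ?Q L (\<lambda>z. z i)) ?R g"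
        using i g by (subst distr_distr) (auto simp: cg[abs_def] comp_def)
      also have "distr ?Q L (\<lambda>z. z i) = L" using i L by (intro distr_PiM_component) auto
      also have "distr L ?R g = distr M ?R (\<lambda>\<omega>. g (X 0 \<omega>, X 1 \<omega>))"
        unfolding L_def distr_distr[OF g_borel XX] by (simp add: comp_def)
      also have "(\<lambda>\<omega>. g (X 0 \<omega>, X 1 \<omega>)) = coord_vec 2 X"
      proof -
        have "g (X 0 \<omega>, X 1 \<omega>) j = coord_vec 2 X \<omega> j" for \<omega> j
          by (cases "j = 0"; cases "j = 1") (auto simp: g_def coord_vec_def less_2_cases_iff)
        then show ?thesis by blast
      qed
      also have "distr M ?R (coord_vec 2 X) = PiM {..<2} (\<lambda>j. distr M borel (X j))"
        using coord_vec_law[OF cont H0 _ d] by simp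
      finally show ?thesis .
    qed
    show "atomless_law (distr M borel (X j))" if "j < 2" for j
      using that d by (intro atomless_marginals[OF cont]) auto
  qed simp
qed

text \<open>
  The maximum is attained and the square is monotone on nonnegative numbers, so the statement about the
  maximum is one about all pairs.
\<close>

lemma extreme_value_event:
  fixes u :: "nat \<Rightarrow> nat \<Rightarrow> real"
  assumes d: "2 \<le> d" and s: "0 < s" and n: "0 < (n :: real)"
  shows "n * (Max {\<bar>u j k - \<theta>\<bar> | j k. j < k \<and> k < d})\<^sup>2 / s \<le> T
    \<longleftrightarrow> (\<forall>j k. j < k \<longrightarrow> k < d \<longrightarrow> \<not> T * s < n * (u j k - \<theta>)\<^sup>2)"
proof -
  let ?S = "{\<bar>u j k - \<theta>\<bar> | j k. j < k \<and> k < d}"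
  have "?S = (\<lambda>(j, k). \<bar>u j k - \<theta>\<bar>) ` {(j, k). j < k \<and> k < d}" by auto
  moreover have "finite {(j, k). j < k \<and> k < d}"
    by (rule finite_subset[of _ "{..<d} \<times> {..<d}"]) auto
  ultimately have fin: "finite ?S" by simp
  have "\<bar>u 0 1 - \<theta>\<bar> \<in> ?S" using d by force
  then have ne: "?S \<noteq> {}" by blast
  have "Max ?S \<in> ?S" by (rule Max_in[OF fin ne])
  then obtain j k where jk: "j < k" "k < d" "Max ?S = \<bar>u j k - \<theta>\<bar>" by auto
  have le: "(u j' k' - \<theta>)\<^sup>2 \<le> (Max ?S)\<^sup>2" if "j' < k'" "k' < d" for j' k'
  proof -
    have "\<bar>u j' k' - \<theta>\<bar> \<le> Max ?S" using that by (intro Max_ge[OF fin]) auto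
    then have "\<bar>u j' k' - \<theta>\<bar>\<^sup>2 \<le> (Max ?S)\<^sup>2" by (intro power_mono) auto
    then show ?thesis by simp
  qed
  have "n * (Max ?S)\<^sup>2 / s \<le> T \<longleftrightarrow> n * (Max ?S)\<^sup>2 \<le> T * s" using s by (simp add: divide_le_eq)
  also have "\<dots> \<longleftrightarrow> (\<forall>j k. j < k \<longrightarrow> k < d \<longrightarrow> \<not> T * s < n * (u j k - \<theta>)\<^sup>2)"
  proof
    assume a: "n * (Max ?S)\<^sup>2 \<le> T * s"
    show "\<forall>j k. j < k \<longrightarrow> k < d \<longrightarrow> \<not> T * s < n * (u j k - \<theta>)\<^sup>2"
    proof (intro allI impI)
      fix j' k' assume "j' < k'" "k' < d"
      then have "n * (u j' k' - \<theta>)\<^sup>2 \<le> n * (Max ?S)\<^sup>2" using n le by (intro mult_left_mono) auto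
      with a show "\<not> T * s < n * (u j' k' - \<theta>)\<^sup>2" by simp
    qed
  next
    assume "\<forall>j k. j < k \<longrightarrow> k < d \<longrightarrow> \<not> T * s < n * (u j k - \<theta>)\<^sup>2"
    then have "\<not> T * s < n * (u j k - \<theta>)\<^sup>2" using jk by blast
    then show "n * (Max ?S)\<^sup>2 \<le> T * s" unfolding jk(3) by simp
  qed
  finally show ?thesis .
qed

text \<open>
  With \<open>l = ln d\<close> the squared level is \<open>T = 4 l - ln l + y\<close>, which grows like \<open>4 l\<close>. The last claim
  restates \<open>l = o(n\<^sup>1\<^sup>/\<^sup>3)\<close>, as \<open>(\<surd>T)\<^sup>3 / \<surd>n = (T / n\<^sup>1\<^sup>/\<^sup>3)\<^sup>3\<^sup>/\<^sup>2\<close>.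
\<close>

lemma threshold_growth:
  fixes d :: "nat \<Rightarrow> nat" and y :: real
  assumes d_top: "filterlim d at_top sequentially"
    and d_growth: "(\<lambda>n. ln (real (d n))) \<in> o(\<lambda>n. real n powr (1 / 3))"
  defines "T \<equiv> \<lambda>n. 4 * ln (real (d n)) - ln (ln (real (d n))) + y"
  shows "(\<lambda>n. T n / ln (real (d n))) \<longlonglongrightarrow> 4"
    and "filterlim (\<lambda>n. sqrt (T n)) at_top sequentially"
    and "(\<lambda>n. (sqrt (T n)) ^ 3 / sqrt (real n)) \<longlonglongrightarrow> 0"
proof -
  define l where "l n = ln (real (d n))" for n
  have l_top: "filterlim l at_top sequentially"
    unfolding l_def[abs_def]
    by (intro filterlim_compose[OF ln_at_top] filterlim_compose[OF filterlim_real_sequentially] d_top)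
  have "((\<lambda>x::real. (4 * x - ln x + y) / x) \<longlongrightarrow> 4) at_top" by real_asymp
  from filterlim_compose[OF this l_top]
  have lim4: "(\<lambda>n. T n / l n) \<longlonglongrightarrow> 4" by (simp add: T_def l_def)
  then show "(\<lambda>n. T n / ln (real (d n))) \<longlonglongrightarrow> 4" by (simp add: l_def)
  have "filterlim (\<lambda>x::real. sqrt (4 * x - ln x + y)) at_top at_top" by real_asymp
  from filterlim_compose[OF this l_top]
  show s_top: "filterlim (\<lambda>n. sqrt (T n)) at_top sequentially" by (simp add: T_def l_def)
  have lo: "(\<lambda>n. l n / real n powr (1 / 3)) \<longlonglongrightarrow> 0"
    using smalloD_tendsto[OF d_growth] by (simp add: l_def)
  have ev: "eventually (\<lambda>n. 0 < l n \<and> 0 < n \<and> 1 \<le> sqrt (T n)) sequentially"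
    using l_top[unfolded filterlim_at_top_dense, rule_format, of 0] eventually_gt_at_top[of 0]
      s_top[unfolded filterlim_at_top, rule_format, of 1]
    by (intro eventually_conj)
  have "(\<lambda>n. (T n / l n) * (l n / real n powr (1 / 3))) \<longlonglongrightarrow> 4 * 0" by (intro tendsto_mult lim4 lo)
  then have "(\<lambda>n. T n / real n powr (1 / 3)) \<longlonglongrightarrow> 4 * 0"
    by (rule Lim_transform_eventually) (use ev in eventually_elim, auto)
  then have "(\<lambda>n. T n / real n powr (1 / 3)) \<longlonglongrightarrow> 0" by simp
  then have "(\<lambda>n. (sqrt (T n / real n powr (1 / 3))) ^ 3) \<longlonglongrightarrow> (sqrt 0) ^ 3"
    by (intro tendsto_power tendsto_real_sqrt)
  then have "(\<lambda>n. (sqrt (T n / real n powr (1 / 3))) ^ 3) \<longlonglongrightarrow> 0" by simp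
  then show "(\<lambda>n. (sqrt (T n)) ^ 3 / sqrt (real n)) \<longlonglongrightarrow> 0"
  proof (rule Lim_transform_eventually)
    show "\<forall>\<^sub>F n in sequentially. (sqrt (T n / real n powr (1 / 3))) ^ 3 = (sqrt (T n)) ^ 3 / sqrt (real n)"
      using ev
    proof eventually_elim
      fix n assume n: "0 < l n \<and> 0 < n \<and> 1 \<le> sqrt (T n)"
      have "(sqrt (real n powr (1 / 3))) ^ 3 = sqrt (real n)"
        using n by (simp add: powr_half_sqrt[symmetric] powr_powr powr_realpow[symmetric])
      then show "(sqrt (T n / real n powr (1 / 3))) ^ 3 = (sqrt (T n)) ^ 3 / sqrt (real n)"
        by (simp add: real_sqrt_divide power_divide)
    qed
  qed
qed

text \<open>
  Since \<open>exp (T / 2) = d\<^sup>2 exp (y / 2) / \<surd>(ln d)\<close> and \<open>\<surd>T\<close> is close to \<open>2 \<surd>(ln d)\<close>, the logarithms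
  cancel in the product and only the constant remains; this is why the threshold contains the
  correction \<open>ln (ln d)\<close>.
\<close>

lemma pairs_times_mills:
  fixes d :: "nat \<Rightarrow> nat" and y :: real and p :: "nat \<Rightarrow> real"
  assumes d_top: "filterlim d at_top sequentially"
    and ratio: "(\<lambda>n. T n / ln (real (d n))) \<longlonglongrightarrow> 4"
    and T: "\<And>n. T n = 4 * ln (real (d n)) - ln (ln (real (d n))) + y"
    and md: "(\<lambda>n. mills (sqrt (T n)) * p n) \<longlonglongrightarrow> 2"
  shows "(\<lambda>n. (real (d n) * (real (d n) - 1) / 2) * p n) \<longlonglongrightarrow> (8 * pi) powr (- 1 / 2) * exp (- y / 2)"
proof -
  define l where "l n = ln (real (d n))" for n
  have dr: "filterlim (\<lambda>n. real (d n)) at_top sequentially"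
    by (rule filterlim_compose[OF filterlim_real_sequentially d_top])
  have l_top: "filterlim l at_top sequentially"
    unfolding l_def[abs_def] by (intro filterlim_compose[OF ln_at_top] dr)
  have T_pos: "eventually (\<lambda>n. 0 < T n / l n) sequentially"
    using order_tendstoD(1)[OF ratio, of 0] by (simp add: l_def)
  have ev: "eventually (\<lambda>n. 1 < real (d n) \<and> 0 < l n \<and> 0 < T n) sequentially"
  proof -
    have "eventually (\<lambda>n. 1 < real (d n)) sequentially" using dr unfolding filterlim_at_top_dense by blast
    moreover have "eventually (\<lambda>n. 0 < l n) sequentially" using l_top by (simp add: filterlim_at_top_dense)
    ultimately show ?thesis using T_pos by eventually_elim (auto simp: zero_less_divide_iff)
  qed
  let ?c = "\<lambda>n. ((1 - inverse (real (d n))) / 2) * (1 / sqrt (T n / l n)) * (exp (- y / 2) / sqrt (2 * pi))"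
  have "(\<lambda>n. ?c n * (mills (sqrt (T n)) * p n)) \<longlonglongrightarrow> ((1 - 0) / 2) * (1 / sqrt 4) * (exp (- y / 2) / sqrt (2 * pi)) * 2"
    using ratio by (intro tendsto_intros md tendsto_inverse_0_at_top[OF dr]) (auto simp: l_def)
  moreover have "((1 - 0) / 2) * (1 / sqrt 4) * (exp (- y / 2) / sqrt (2 * pi)) * 2 = (8 * pi) powr (- 1 / 2) * exp (- y / 2)"
  proof -
    have "(8 * pi) powr (- 1 / 2) = 1 / sqrt (8 * pi)"
      using powr_minus[of "8 * pi" "1 / 2"] by (simp add: powr_half_sqrt inverse_eq_divide)
    moreover have "sqrt (8 * pi) = 2 * sqrt (2 * pi)"
      using real_sqrt_mult[of 4 "2 * pi"] by simp
    ultimately show ?thesis by simp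
  qed
  ultimately have "(\<lambda>n. ?c n * (mills (sqrt (T n)) * p n)) \<longlonglongrightarrow> (8 * pi) powr (- 1 / 2) * exp (- y / 2)" by simp
  then show ?thesis
  proof (rule Lim_transform_eventually)
    show "\<forall>\<^sub>F n in sequentially. ?c n * (mills (sqrt (T n)) * p n) = (real (d n) * (real (d n) - 1) / 2) * p n"
      using ev
    proof eventually_elim
      fix n assume n: "1 < real (d n) \<and> 0 < l n \<and> 0 < T n"
      have e: "exp (T n / 2) = (real (d n))\<^sup>2 / sqrt (l n) * exp (y / 2)"
      proof -
        have "exp (T n / 2) = exp (l n + l n - ln (sqrt (l n)) + y / 2)"
          using n by (simp add: T l_def ln_sqrt field_simps)
        also have "\<dots> = exp (l n) * exp (l n) / exp (ln (sqrt (l n))) * exp (y / 2)"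
          by (simp only: exp_add exp_diff)
        also have "exp (l n) = real (d n)" using n by (simp add: l_def)
        also have "exp (ln (sqrt (l n))) = sqrt (l n)" using n by simp
        finally show ?thesis by (simp add: power2_eq_square)
      qed
      have m: "mills (sqrt (T n)) = sqrt (T n) * ((real (d n))\<^sup>2 / sqrt (l n) * exp (y / 2)) * sqrt (2 * pi)"
        unfolding mills_def e[symmetric] using n by simp
      have q: "1 / sqrt (T n / l n) = sqrt (l n) / sqrt (T n)" by (simp add: real_sqrt_divide)
      have a: "(1 - inverse (real (d n))) / 2 * (real (d n))\<^sup>2 = real (d n) * (real (d n) - 1) / 2"
        using n by (simp add: power2_eq_square field_simps)
      have "?c n * mills (sqrt (T n)) = ((1 - inverse (real (d n))) / 2 * (real (d n))\<^sup>2) * (sqrt (l n) / sqrt (T n) * (sqrt (T n) / sqrt (l n))) * (exp (- y / 2) * exp (y / 2)) * (1 / sqrt (2 * pi) * sqrt (2 * pi))"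
        unfolding m q by simp
      also have "\<dots> = real (d n) * (real (d n) - 1) / 2"
        unfolding a using n by (simp flip: exp_add)
      finally show "?c n * (mills (sqrt (T n)) * p n) = (real (d n) * (real (d n) - 1) / 2) * p n"
        by (simp only: mult.assoc[symmetric])
    qed
  qed
qed

theorem theorem2:
  fixes M :: "nat \<Rightarrow> 'a measure"
    and d :: "nat \<Rightarrow> nat"
    and X :: "nat \<Rightarrow> nat \<Rightarrow> 'a \<Rightarrow> real"
    and Z :: "nat \<Rightarrow> nat \<Rightarrow> nat \<Rightarrow> 'a \<Rightarrow> real"
    and m :: nat
    and h :: kernel
    and y :: real
  assumes prob: "\<And>n. prob_space (M n)"
    and cont: "\<And>n. continuous_vec (M n) (d n) (X n)"
    and copies: "\<And>n. indep_copies (M n) n (d n) (X n) (Z n)"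
    and H0: "\<And>n. null_hyp (M n) (d n) (X n)"
    and degree: "m \<ge> 1"
    and h_meas: "h \<in> borel_measurable (PiM {..<m} (\<lambda>_. borel))"
    and h_bdd: "bounded (h ` ({..<m} \<rightarrow>\<^sub>E UNIV))"
    and h_rank: "rank_type m h"
    and h_nondeg: "\<And>n j k. j < k \<Longrightarrow> k < d n \<Longrightarrow>
          nondegenerate m h (distr (M n) borel (\<lambda>\<omega>. (X n j \<omega>, X n k \<omega>)))"
    and d_top: "filterlim d at_top sequentially"
    and d_growth: "(\<lambda>n. ln (real (d n))) \<in> o(\<lambda>n. real n powr (1 / 3))"
  shows "(\<lambda>n. \<bar>measure (M n) {\<omega> \<in> space (M n).
              real n * (max_stat (M n) m h n (d n) (Z n) \<omega>)\<^sup>2 / sigma_U_sq (M n) m h n (Z n)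
                - 4 * ln (real (d n)) + ln (ln (real (d n))) \<le> y}
            - exp (- ((8 * pi) powr (- 1 / 2) * exp (- y / 2)))\<bar>) \<longlonglongrightarrow> 0"
proof -
  define T where "T n = 4 * ln (real (d n)) - ln (ln (real (d n))) + y" for n
  note growth = threshold_growth[OF d_top d_growth, of y, folded T_def]
  have d2: "eventually (\<lambda>n. 2 \<le> d n) sequentially" using d_top by (simp add: filterlim_at_top)
  \<comment> \<open>a single sample size provides the reference law \<open>L\<close> for all others\<close>
  then obtain n0 where n0: "2 \<le> d n0" by (auto simp: eventually_sequentially)
  define L where "L = distr (M n0) borel (\<lambda>\<omega>. (X n0 0 \<omega>, X n0 1 \<omega>))"
  have sL: "sets L = sets borel" by (simp add: L_def)
  obtain B where B: "\<And>z. z \<in> {..<m} \<rightarrow>\<^sub>E UNIV \<Longrightarrow> \<bar>h z\<bar> \<le> B"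
    using h_bdd by (auto simp: bounded_iff)
  interpret L: prob_space L
  proof -
    interpret M0: prob_space "M n0" by (rule prob)
    have "X n0 0 \<in> borel_measurable (M n0)" "X n0 1 \<in> borel_measurable (M n0)"
      using cont[of n0] n0 by (auto simp: continuous_vec_def)
    then show "prob_space L" unfolding L_def by (intro M0.prob_space_distr borel_measurable_Pair)
  qed
  interpret K: bounded_kernel L m h B
  proof unfold_locales
    show "0 < m" using degree by simp
    have "sets (PiM {..<m} (\<lambda>_. L)) = sets (PiM {..<m} (\<lambda>_. borel))" using sL by (intro sets_PiM_cong) auto
    then show "h \<in> borel_measurable (PiM {..<m} (\<lambda>_. L))" using h_meas by (simp cong: measurable_cong_sets)
    show "\<bar>h z\<bar> \<le> B" if "z \<in> space (PiM {..<m} (\<lambda>_. L))" for z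
      using that sets_eq_imp_space_eq[OF sL] by (intro B) (auto simp: space_PiM)
  qed
  have zeta: "0 < K.zeta"
    using h_nondeg[of 0 1 n0] n0 by (intro K.zeta_pos sL) (simp add: L_def)
  define A where "A n = {u. T n * (real n * K.uvar n) < real n * (u - K.theta)\<^sup>2}" for n
  have A_borel: "A n \<in> sets borel" for n unfolding A_def by measurable
  define p where "p n = perm_average m h n (indicator (A n))" for n
  have canon: "independent_columns (K.Q n) n 2 m split_pair (\<lambda>j. distr (M n0) borel (X n0 j)) h" if "m < n" for n
    unfolding L_def by (rule independent_columns_pair[OF prob cont H0 h_rank h_meas that n0])
  have split_pair_ustat: "pair_ustat m h n split_pair 0 1 z = ustat m h n z" for n z
    by (simp add: pair_ustat_def split_pair_def)
  have p_canon: "p n = measure (K.Q n) {z \<in> space (K.Q n). T n * (real n * K.uvar n) < real n * (ustat m h n z - K.theta)\<^sup>2}" if mn: "m < n" for n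
  proof -
    interpret C: independent_columns "K.Q n" n 2 m split_pair "\<lambda>j. distr (M n0) borel (X n0 j)" h by (rule canon[OF mn])
    show ?thesis
      using C.prob_exceed[OF A_borel, of 0 1 n] by (simp add: C.exceed_def split_pair_ustat[simplified] p_def A_def)
  qed
  \<comment> \<open>distribution-freeness: mean and variance can be computed under the reference law\<close>
  have law: "distr (M n) borel (pair_ustat m h n (Z n) j k) = distr (K.Q n) borel (ustat m h n)"
    if mn: "m < n" and jk: "j < d n" "k < d n" "j \<noteq> k" for n j k
  proof -
    interpret C: independent_columns "K.Q n" n 2 m split_pair "\<lambda>j. distr (M n0) borel (X n0 j)" h by (rule canon[OF mn])
    interpret S: independent_columns "M n" n "d n" m "Z n" "\<lambda>j. distr (M n) borel (X n j)" h
      using jk by (intro independent_columns_sample[OF prob cont copies H0 h_rank h_meas mn]) auto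
    have "distr (M n) borel (pair_ustat m h n (Z n) j k) = distr (K.Q n) borel (pair_ustat m h n split_pair 0 1)"
    proof (rule measure_eqI)
      fix E assume "E \<in> sets (distr (M n) borel (pair_ustat m h n (Z n) j k))"
      then have "E \<in> sets borel" by simp
      then show "emeasure (distr (M n) borel (pair_ustat m h n (Z n) j k)) E = emeasure (distr (K.Q n) borel (pair_ustat m h n split_pair 0 1)) E"
        using S.pair_ustat_distr_emeasure jk C.pair_ustat_distr_emeasure[of E 0 1] by simp
    qed simp
    moreover have "pair_ustat m h n split_pair 0 1 = ustat m h n" by (rule ext) (rule split_pair_ustat)
    ultimately show ?thesis by (simp only:)
  qed
  have transfer: "(\<integral>\<omega>. f (pair_ustat m h n (Z n) j k \<omega>) \<partial>M n) = (\<integral>z. f (ustat m h n z) \<partial>K.Q n)"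
    if mn: "m < n" and jk: "j < d n" "k < d n" "j \<noteq> k" and f: "f \<in> borel_measurable borel" for n j k and f :: "real \<Rightarrow> real"
  proof -
    interpret S: independent_columns "M n" n "d n" m "Z n" "\<lambda>j. distr (M n) borel (X n j)" h
      using jk by (intro independent_columns_sample[OF prob cont copies H0 h_rank h_meas mn]) auto
    have "(\<integral>\<omega>. f (pair_ustat m h n (Z n) j k \<omega>) \<partial>M n) = (\<integral>u. f u \<partial>distr (M n) borel (pair_ustat m h n (Z n) j k))"
      by (rule integral_distr[OF S.pair_ustat_meas[OF jk(1,2)] f, symmetric])
    also have "\<dots> = (\<integral>u. f u \<partial>distr (K.Q n) borel (ustat m h n))" unfolding law[OF mn jk] ..
    also have "\<dots> = (\<integral>z. f (ustat m h n z) \<partial>K.Q n)" by (rule integral_distr[OF K.ustat_meas[OF K.h_meas] f])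
    finally show ?thesis .
  qed
  have sigma: "sigma_U_sq (M n) m h n (Z n) = real n * K.uvar n" if mn: "m < n" and d: "2 \<le> d n" for n
  proof -
    have E: "(\<integral>\<omega>. pair_ustat m h n (Z n) 0 1 \<omega> \<partial>M n) = K.theta"
      using transfer[OF mn, of 0 1 "\<lambda>u. u"] d mn by (simp add: K.ustat_h_mean)
    have "(\<integral>\<omega>. (pair_ustat m h n (Z n) 0 1 \<omega> - K.theta)\<^sup>2 \<partial>M n) = K.uvar n"
      using transfer[OF mn, of 0 1 "\<lambda>u. (u - K.theta)\<^sup>2"] d by (simp add: K.uvar_def)
    then show ?thesis unfolding sigma_U_sq_def E by simp
  qed
  have mean: "(\<integral>\<omega>. pair_ustat m h n (Z n) j k \<omega> \<partial>M n) = K.theta" if mn: "m < n" and jk: "j < k" "k < d n" for n j k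
    using transfer[OF mn, of j k "\<lambda>u. u"] jk mn by (simp add: K.ustat_h_mean)
  have uvar_pos: "eventually (\<lambda>n. 0 < real n * K.uvar n) sequentially"
  proof -
    have "(\<lambda>n. (K.zeta + 8 * K.C_rem\<^sup>2) / sqrt (real n)) \<longlonglongrightarrow> 0"
      by (intro tendsto_divide_0[OF tendsto_const] filterlim_at_top_imp_at_infinity
          filterlim_compose[OF sqrt_at_top filterlim_real_sequentially])
    then have "eventually (\<lambda>n. (K.zeta + 8 * K.C_rem\<^sup>2) / sqrt (real n) < K.zeta) sequentially"
      using zeta by (rule order_tendstoD)
    then show ?thesis using eventually_ge_at_top[of "2 * m"]
    proof eventually_elim
      case (elim n)
      then show ?case using K.uvar_approx[of n] by linarith
    qed
  qed
  have md: "(\<lambda>n. mills (sqrt (T n)) * p n) \<longlonglongrightarrow> 2"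
  proof (rule Lim_transform_eventually[OF K.ustat_moderate_deviation[OF zeta growth(2,3)]])
    have T0: "eventually (\<lambda>n. 1 \<le> sqrt (T n)) sequentially"
      using growth(2) unfolding filterlim_at_top by blast
    show "\<forall>\<^sub>F n in sequentially. mills (sqrt (T n)) * measure (K.Q n)
      {z \<in> space (K.Q n). (sqrt (T n))\<^sup>2 * (real n * K.uvar n) < real n * (ustat m h n z - K.theta)\<^sup>2} = mills (sqrt (T n)) * p n"
      using T0 eventually_gt_at_top[of m]
    proof eventually_elim
      case (elim n)
      have "(sqrt (T n))\<^sup>2 = T n" using elim(1) by (cases "0 \<le> T n") auto
      then show ?case using p_canon[OF elim(2)] by simp
    qed
  qed
  define N where "N n = real (d n) * (real (d n) - 1) / 2" for n
  have rate: "(\<lambda>n. N n * p n) \<longlonglongrightarrow> (8 * pi) powr (- 1 / 2) * exp (- y / 2)"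
    unfolding N_def by (rule pairs_times_mills[OF d_top growth(1) T_def md])
  define W where "W n = measure (M n) {\<omega> \<in> space (M n).
              real n * (max_stat (M n) m h n (d n) (Z n) \<omega>)\<^sup>2 / sigma_U_sq (M n) m h n (Z n)
                - 4 * ln (real (d n)) + ln (ln (real (d n))) \<le> y}" for n
  have close: "eventually (\<lambda>n. \<bar>W n - exp (- (N n * p n))\<bar> \<le> 16 * (N n * p n)\<^sup>2 * inverse (real (d n))) sequentially"
    using d2 uvar_pos eventually_gt_at_top[of m]
  proof eventually_elim
    case (elim n)
    have d: "2 \<le> d n" and uv: "0 < real n * K.uvar n" and mn: "m < n" using elim by auto
    interpret S: independent_columns "M n" n "d n" m "Z n" "\<lambda>j. distr (M n) borel (X n j)" h
      using d by (intro independent_columns_sample[OF prob cont copies H0 h_rank h_meas mn]) auto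
    have "{\<omega> \<in> space (M n). real n * (max_stat (M n) m h n (d n) (Z n) \<omega>)\<^sup>2 / sigma_U_sq (M n) m h n (Z n)
                - 4 * ln (real (d n)) + ln (ln (real (d n))) \<le> y} = space (M n) - (\<Union>\<alpha>\<in>S.pairs. S.exceed (A n) \<alpha>)"
    proof -
      have ms: "max_stat (M n) m h n (d n) (Z n) \<omega> = Max {\<bar>pair_ustat m h n (Z n) j k \<omega> - K.theta\<bar> | j k. j < k \<and> k < d n}" for \<omega>
      proof -
        have "{\<bar>pair_ustat m h n (Z n) j k \<omega> - (\<integral>\<omega>. pair_ustat m h n (Z n) j k \<omega> \<partial>M n)\<bar> | j k. j < k \<and> k < d n}
            = {\<bar>pair_ustat m h n (Z n) j k \<omega> - K.theta\<bar> | j k. j < k \<and> k < d n}"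
          by (intro Collect_cong ex_cong1) (auto simp: mean[OF mn])
        then show ?thesis by (simp add: max_stat_def)
      qed
      have n_pos: "0 < real n" using mn by simp
      have "real n * (max_stat (M n) m h n (d n) (Z n) \<omega>)\<^sup>2 / sigma_U_sq (M n) m h n (Z n)
                - 4 * ln (real (d n)) + ln (ln (real (d n))) \<le> y \<longleftrightarrow> (\<forall>j k. j < k \<longrightarrow> k < d n \<longrightarrow> pair_ustat m h n (Z n) j k \<omega> \<notin> A n)" for \<omega>
      proof -
        have "real n * (max_stat (M n) m h n (d n) (Z n) \<omega>)\<^sup>2 / sigma_U_sq (M n) m h n (Z n)
                - 4 * ln (real (d n)) + ln (ln (real (d n))) \<le> y \<longleftrightarrow>
              real n * (Max {\<bar>pair_ustat m h n (Z n) j k \<omega> - K.theta\<bar> | j k. j < k \<and> k < d n})\<^sup>2 / (real n * K.uvar n) \<le> T n"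
          unfolding ms sigma[OF mn d] T_def by linarith
        also have "\<dots> \<longleftrightarrow> (\<forall>j k. j < k \<longrightarrow> k < d n \<longrightarrow> pair_ustat m h n (Z n) j k \<omega> \<notin> A n)"
          unfolding extreme_value_event[OF d uv n_pos] by (simp add: A_def)
        finally show ?thesis .
      qed
      then show ?thesis by (auto simp: S.pairs_def S.exceed_def)
    qed
    then have "\<bar>W n - exp (- (real (card S.pairs) * p n))\<bar> \<le> 2 * p n * p n * (real (card S.pairs) * (2 * real (d n)))"
      unfolding W_def p_def using S.no_exceedance_poisson[OF A_borel, of n] by simp
    then have 1: "\<bar>W n - exp (- (N n * p n))\<bar> \<le> 2 * p n * p n * (N n * (2 * real (d n)))"
      by (simp add: S.card_pairs N_def)
    have N4: "(real (d n))\<^sup>2 \<le> 4 * N n"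
    proof -
      have "real (d n) * 2 \<le> real (d n) * real (d n)" using d by (intro mult_left_mono) auto
      then show ?thesis by (simp add: N_def power2_eq_square algebra_simps)
    qed
    have "2 * p n * p n * (N n * (2 * real (d n))) = 4 * (N n * (p n)\<^sup>2) * ((real (d n))\<^sup>2 * inverse (real (d n)))"
      using d by (simp add: power2_eq_square)
    also have "\<dots> \<le> 4 * (N n * (p n)\<^sup>2) * ((4 * N n) * inverse (real (d n)))"
      using N4 d by (intro mult_left_mono mult_right_mono) (auto simp: N_def)
    also have "\<dots> = 16 * (N n * p n)\<^sup>2 * inverse (real (d n))" by (simp add: power2_eq_square)
    finally show "\<bar>W n - exp (- (N n * p n))\<bar> \<le> 16 * (N n * p n)\<^sup>2 * inverse (real (d n))" using 1 by linarith
  qed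
  let ?c = "(8 * pi) powr (- 1 / 2) * exp (- y / 2)"
  have dr: "filterlim (\<lambda>n. real (d n)) at_top sequentially"
    by (rule filterlim_compose[OF filterlim_real_sequentially d_top])
  have "(\<lambda>n. 16 * (N n * p n)\<^sup>2 * inverse (real (d n))) \<longlonglongrightarrow> 16 * ?c\<^sup>2 * 0"
    by (intro tendsto_intros rate tendsto_inverse_0_at_top[OF dr])
  then have "(\<lambda>n. 16 * (N n * p n)\<^sup>2 * inverse (real (d n))) \<longlonglongrightarrow> 0" by simp
  then have "(\<lambda>n. W n - exp (- (N n * p n))) \<longlonglongrightarrow> 0"
    by (rule Lim_null_comparison[rotated]) (use close in simp)
  moreover have "(\<lambda>n. exp (- (N n * p n))) \<longlonglongrightarrow> exp (- ?c)" by (intro tendsto_intros rate)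
  ultimately have "(\<lambda>n. (W n - exp (- (N n * p n))) + exp (- (N n * p n))) \<longlonglongrightarrow> 0 + exp (- ?c)"
    by (rule tendsto_add)
  then have "W \<longlonglongrightarrow> exp (- ?c)" by simp
  then have "(\<lambda>n. \<bar>W n - exp (- ?c)\<bar>) \<longlonglongrightarrow> \<bar>exp (- ?c) - exp (- ?c)\<bar>"
    by (intro tendsto_rabs tendsto_diff tendsto_const)
  then show ?thesis by (simp add: W_def)
qed

end
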